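(* Let $D\subset\mathbb{R}^n$ be a simply connected open set containing $0$, and let $\{f_1,\dots,f_n\}$ be a Combescure sequence of isothermic$_k$ hypersurfaces in $\mathbb{R}^{n+1}$ defined on $D$ with $f_i(0)=0$ for all $i$. Then there exist a solution $(F,\gamma)$ of the $\frac{\mathrm{O}(2n+1-k,k)}{\mathrm{O}(n+1)\times\mathrm{O}(n-k,k)}$-system on $D$, an extended frame $E$ for $(F,\gamma)$, and a null basis $\{{\vec{c}}_1,\dots,{\vec{c}}_n\}$ of $\mathbb{R}^{n-k,k}$ such that, writing $\frac{\partial E}{\partial\lambda}E^{-1}\big|_{\lambda=0}=\begin{pmatrix}0&Y\\-JY^T&0\end{pmatrix}$ with $Y$ an $(n+1)\times n$-matrix-valued map, one has $f_\ell=Y{\vec{c}}_\ell$ for all $1\le\ell\le n$.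
   Context: Fix integers $n\ge2$, $1\le k\le n-1$. Let $\epsilon_i=1$ for $i\le n-k$, $\epsilon_i=-1$ for $n-k<i\le n$, $J=\operatorname{diag}(\epsilon_1,\dots,\epsilon_n)$, $(\vec x,\vec y)_k=\vec x^TJ\vec y$ on $\mathbb{R}^n$ (denoted $\mathbb{R}^{n-k,k}$); a null basis is a basis of vectors ${\vec{c}}$ with $({\vec{c}},{\vec{c}})_k=0$. $\delta=\operatorname{diag}(\mathrm{d} x_1,\dots,\mathrm{d} x_n)$. Let $G=\operatorname{diag}(\mathrm{I}_{n+1},J)$; $\mathrm{O}(2n+1-k,k)^{\mathbb{C}}$ is the group of complex $(2n+1)\times(2n+1)$ matrices $A$ with $A^TGA=G$; $\mathrm{I}_{n+1,n}=\operatorname{diag}(\mathrm{I}_{n+1},-\mathrm{I}_n)$. The $\frac{\mathrm{O}(2n+1-k,k)}{\mathrm{O}(n+1)\times\mathrm{O}(n-k,k)}$-system is the PDE for smooth maps $F=(f_{ij})$ (real $n\times n$, $f_{ii}=0$) and $\gamma=(\gamma_1,\dots,\gamma_n)^T$ requiring flatness of $\omega=\begin{pmatrix}-\delta JF+F^TJ\delta&-\delta J\gamma\\ \gamma^TJ\delta&0\end{pmatrix}$ and $\tau=(F\delta-\delta F^T)J$; equivalently $\theta_\lambda=\begin{pmatrix}\omega&-\lambda\begin{pmatrix}\delta\\0\end{pmatrix}J\\ \lambda(\delta,0)&\tau\end{pmatrix}$ is flat for all $\lambda\in\mathbb{C}$. An extended frame is a smooth $E:D\times\mathbb{C}\to\mathrm{O}(2n+1-k,k)^{\mathbb{C}}$,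 holomorphic in $\lambda$, with $E(\cdot,\lambda)^{-1}\mathrm{d} E(\cdot,\lambda)=\theta_\lambda$, $\overline{E(x,\bar\lambda)}=E(x,\lambda)$ and $\mathrm{I}_{n+1,n}E(x,-\lambda)\mathrm{I}_{n+1,n}^{-1}=E(x,\lambda)$. A hypersurface $f$ in $\mathbb{R}^{n+1}$ is isothermic$_k$ if it is parametrised by line of curvature co-ordinates and its induced metric $\sum u_i^2\mathrm{d} x_i^2$ satisfies $\sum_{i\le n-k}u_i^2=\sum_{i>n-k}u_i^2$. $f\mapsto g$ is a Combescure transform if $f_{x_i}(x)\parallel g_{x_i}(x)$ for all $i,x$. A sequence $\{f_1,\dots,f_n\}$ of isothermic$_k$ hypersurfaces is a Combescure sequence if each $f_i\mapsto f_{i+1}$ is a Combescure transform and the vectors $\vec u_i=(u_{i1},\dots,u_{in})^T$, chosen so that $\mathrm{I}_{f_i}=\sum_ju_{ij}^2\mathrm{d} x_j^2$ and $(f_i)_{x_j}/u_{ij}=(f_1)_{x_j}/u_{1j}$ for all $i,j$, are linearly independent at every point. *)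

theory Defs
  imports "HOL-Analysis.Analysis"
begin

text \<open>Points of R^n are vectors real^('n::{finite,linorder}) over a finite linearly ordered index type;
  the j-th coordinate (j = 0..n-1, i.e. the paper's x_(j+1)) is the j-th element of the index type
  in increasing order.  Matrices are nat-indexed (0-based) functions.\<close>

definition ix :: "nat \<Rightarrow> 'a::{finite,linorder}" where
  "ix i = sorted_list_of_set (UNIV::'a set) ! i"

definition pd :: "nat \<Rightarrow> (real^('n::{finite,linorder}) \<Rightarrow> 'b::real_normed_vector) \<Rightarrow> real^('n::{finite,linorder}) \<Rightarrow> 'b" where
  "pd j g x = vector_derivative (\<lambda>t::real. g (x + t *\<^sub>R axis (ix j) 1)) (at 0)"

text \<open>C-infinity on an open set: g lies in a family of differentiable functions closed
  under taking partial derivatives.\<close>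
definition smooth_on :: "'a::euclidean_space set \<Rightarrow> ('a \<Rightarrow> 'b::real_normed_vector) \<Rightarrow> bool" where
  "smooth_on U g \<longleftrightarrow> (\<exists>S. g \<in> S \<and> (\<forall>h\<in>S. \<exists>h'. (\<forall>x\<in>U. (h has_derivative h' x) (at x))
       \<and> (\<forall>b\<in>Basis. (\<lambda>x. h' x b) \<in> S)))"

text \<open>signature: epsilon_a (0-based a), J = diag(eps)\<close>
definition eps :: "nat \<Rightarrow> nat \<Rightarrow> nat \<Rightarrow> real" where
  "eps n k a = (if a < n - k then 1 else -1)"

text \<open>coefficient of dx_j in omega (size (n+1)x(n+1), 0-based, last index n)\<close>
definition omega :: "nat \<Rightarrow> nat \<Rightarrow> (nat \<Rightarrow> nat \<Rightarrow> real) \<Rightarrow> (nat \<Rightarrow> real) \<Rightarrow> nat \<Rightarrow> nat \<Rightarrow> nat \<Rightarrow> real" where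
  "omega n k F g j a b =
    (if a < n \<and> b < n then (if a = j then - eps n k j * F j b else 0) + (if b = j then eps n k j * F j a else 0)
     else if a < n \<and> b = n then (if a = j then - eps n k j * g j else 0)
     else if a = n \<and> b < n then (if b = j then g j * eps n k j else 0)
     else 0)"

text \<open>coefficient of dx_j in tau = (F delta - delta F^T) J (size n x n)\<close>
definition tau :: "nat \<Rightarrow> nat \<Rightarrow> (nat \<Rightarrow> nat \<Rightarrow> real) \<Rightarrow> nat \<Rightarrow> nat \<Rightarrow> nat \<Rightarrow> real" where
  "tau n k F j a b = ((if b = j then F a j else 0) - (if a = j then F b j else 0)) * eps n k b"

text \<open>coefficient of dx_j in theta_lambda (size 2n+1; indices 0..n first block, n+1+a second block)\<close>
definition theta :: "nat \<Rightarrow> nat \<Rightarrow> complex \<Rightarrow> (nat \<Rightarrow> nat \<Rightarrow> real) \<Rightarrow> (nat \<Rightarrow> real) \<Rightarrow> nat \<Rightarrow> nat \<Rightarrow> nat \<Rightarrow> complex" where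
  "theta n k l F g j a b =
    (if a \<le> n \<and> b \<le> n then complex_of_real (omega n k F g j a b)
     else if a \<le> n \<and> n < b then (if a = j \<and> b - (n+1) = j then - l * complex_of_real (eps n k j) else 0)
     else if n < a \<and> b \<le> n then (if a - (n+1) = j \<and> b = j then l else 0)
     else complex_of_real (tau n k F j (a - (n+1)) (b - (n+1))))"

text \<open>Flatness of A = sum_j A_j dx_j (m x m matrices): d A + A wedge A = 0\<close>
definition flat_on :: "(real^('n::{finite,linorder})) set \<Rightarrow> nat \<Rightarrow> (real^('n::{finite,linorder}) \<Rightarrow> nat \<Rightarrow> nat \<Rightarrow> nat \<Rightarrow> real) \<Rightarrow> bool" where
  "flat_on D m A \<longleftrightarrow> (\<forall>x\<in>D. \<forall>i<CARD('n). \<forall>j<CARD('n). \<forall>a<m. \<forall>b<m.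
     pd i (\<lambda>y. A y j a b) x - pd j (\<lambda>y. A y i a b) x
     + (\<Sum>c<m. A x i a c * A x j c b - A x j a c * A x i c b) = 0)"

definition is_solution :: "(real^('n::{finite,linorder})) set \<Rightarrow> nat \<Rightarrow> (real^('n::{finite,linorder}) \<Rightarrow> nat \<Rightarrow> nat \<Rightarrow> real) \<Rightarrow> (real^('n::{finite,linorder}) \<Rightarrow> nat \<Rightarrow> real) \<Rightarrow> bool" where
  "is_solution D k F g \<longleftrightarrow>
    (\<forall>a<CARD('n). \<forall>b<CARD('n). smooth_on D (\<lambda>x. F x a b)) \<and>
    (\<forall>a<CARD('n). smooth_on D (\<lambda>x. g x a)) \<and>
    (\<forall>x\<in>D. \<forall>a<CARD('n). F x a a = 0) \<and>
    flat_on D (CARD('n) + 1) (\<lambda>x j a b. omega (CARD('n)) k (F x) (g x) j a b) \<and>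
    flat_on D (CARD('n)) (\<lambda>x j a b. tau (CARD('n)) k (F x) j a b)"

text \<open>G = diag(I_(n+1), J)\<close>
definition Gd :: "nat \<Rightarrow> nat \<Rightarrow> nat \<Rightarrow> complex" where
  "Gd n k a = (if a \<le> n then 1 else complex_of_real (eps n k (a - (n+1))))"

text \<open>A in O(2n+1-k,k)^C : A^T G A = G\<close>
definition in_Ogroup :: "nat \<Rightarrow> nat \<Rightarrow> (nat \<Rightarrow> nat \<Rightarrow> complex) \<Rightarrow> bool" where
  "in_Ogroup n k A \<longleftrightarrow> (\<forall>a<2*n+1. \<forall>b<2*n+1.
     (\<Sum>c<2*n+1. A c a * Gd n k c * A c b) = (if a = b then Gd n k a else 0))"

text \<open>diagonal entries of I_(n+1,n)\<close>
definition sg :: "nat \<Rightarrow> nat \<Rightarrow> complex" where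
  "sg n a = (if a \<le> n then 1 else -1)"

definition ext_frame :: "(real^('n::{finite,linorder})) set \<Rightarrow> nat \<Rightarrow> (real^('n::{finite,linorder}) \<Rightarrow> nat \<Rightarrow> nat \<Rightarrow> real) \<Rightarrow> (real^('n::{finite,linorder}) \<Rightarrow> nat \<Rightarrow> real)
     \<Rightarrow> (real^('n::{finite,linorder}) \<Rightarrow> complex \<Rightarrow> nat \<Rightarrow> nat \<Rightarrow> complex) \<Rightarrow> bool" where
  "ext_frame D k F g E \<longleftrightarrow> (let n = CARD('n); N = 2*n+1 in
    (\<forall>a<N. \<forall>b<N. smooth_on (D \<times> UNIV) (\<lambda>p. E (fst p) (snd p) a b)) \<and>
    (\<forall>x\<in>D. \<forall>a<N. \<forall>b<N. (\<lambda>l. E x l a b) holomorphic_on UNIV) \<and>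
    (\<forall>x\<in>D. \<forall>l. in_Ogroup n k (E x l)) \<and>
    (\<forall>x\<in>D. \<forall>l. \<forall>j<n. \<forall>a<N. \<forall>b<N.
        pd j (\<lambda>y. E y l a b) x = (\<Sum>c<N. E x l a c * theta n k l (F x) (g x) j c b)) \<and>
    (\<forall>x\<in>D. \<forall>l. \<forall>a<N. \<forall>b<N. cnj (E x (cnj l) a b) = E x l a b) \<and>
    (\<forall>x\<in>D. \<forall>l. \<forall>a<N. \<forall>b<N. sg n a * E x (-l) a b * sg n b = E x l a b))"

definition lin_indep :: "nat \<Rightarrow> (nat \<Rightarrow> nat \<Rightarrow> real) \<Rightarrow> bool" where
  "lin_indep n v \<longleftrightarrow> (\<forall>t. (\<forall>b<n. (\<Sum>i<n. t i * v i b) = 0) \<longrightarrow> (\<forall>i<n. t i = 0))"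

definition null_basis :: "nat \<Rightarrow> nat \<Rightarrow> (nat \<Rightarrow> nat \<Rightarrow> real) \<Rightarrow> bool" where
  "null_basis n k c \<longleftrightarrow> lin_indep n c \<and> (\<forall>l<n. (\<Sum>b<n. eps n k b * (c l b)^2) = 0)"

text \<open>isothermic_k hypersurface: smooth immersion in line of curvature coordinates
  (diagonal first and second fundamental forms) with sum_(i<=n-k) u_i^2 = sum_(i>n-k) u_i^2\<close>
definition isothermic_k :: "(real^('n::{finite,linorder})) set \<Rightarrow> nat \<Rightarrow> (real^('n::{finite,linorder}) \<Rightarrow> real^('m::{finite,linorder})) \<Rightarrow> bool" where
  "isothermic_k D k f \<longleftrightarrow> (let n = CARD('n) in
    smooth_on D f \<and>
    (\<forall>x\<in>D. \<forall>j<n. pd j f x \<noteq> 0) \<and>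
    (\<forall>x\<in>D. \<forall>i<n. \<forall>j<n. i \<noteq> j \<longrightarrow> pd i f x \<bullet> pd j f x = 0) \<and>
    (\<forall>x\<in>D. \<forall>i<n. \<forall>j<n. i \<noteq> j \<longrightarrow>
        (\<forall>v. (\<forall>l<n. v \<bullet> pd l f x = 0) \<longrightarrow> v \<bullet> pd i (pd j f) x = 0)) \<and>
    (\<forall>x\<in>D. (\<Sum>j<n-k. (norm (pd j f x))^2) = (\<Sum>j\<in>{n-k..<n}. (norm (pd j f x))^2)))"

definition combescure_seq :: "(real^('n::{finite,linorder})) set \<Rightarrow> nat \<Rightarrow> (nat \<Rightarrow> real^('n::{finite,linorder}) \<Rightarrow> real^('m::{finite,linorder})) \<Rightarrow> bool" where
  "combescure_seq D k f \<longleftrightarrow> (let n = CARD('n) in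
    (\<forall>i<n. isothermic_k D k (f i)) \<and>
    (\<forall>i. i + 1 < n \<longrightarrow> (\<forall>x\<in>D. \<forall>j<n. \<exists>t. pd j (f (i+1)) x = t *\<^sub>R pd j (f i) x)) \<and>
    (\<exists>u :: nat \<Rightarrow> nat \<Rightarrow> real^('n::{finite,linorder}) \<Rightarrow> real.
       (\<forall>i<n. \<forall>j<n. \<forall>x\<in>D. (u i j x)^2 = (norm (pd j (f i) x))^2 \<and>
            pd j (f i) x /\<^sub>R u i j x = pd j (f 0) x /\<^sub>R u 0 j x) \<and>
       (\<forall>x\<in>D. lin_indep n (\<lambda>i j. u i j x))))"

definition Mblock :: "nat \<Rightarrow> nat \<Rightarrow> (nat \<Rightarrow> nat \<Rightarrow> complex) \<Rightarrow> nat \<Rightarrow> nat \<Rightarrow> complex" where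
  "Mblock n k Y a d =
    (if a \<le> n \<and> n < d then Y a (d - (n+1))
     else if n < a \<and> d \<le> n then - complex_of_real (eps n k (a - (n+1))) * Y d (a - (n+1))
     else 0)"

end

(* Let e_1, ..., e_n be the common principal frame of the sequence, e_(n+1) a unit normal, and write
   d(f_l) = sum_j u_lj e_j dx_j.  The frame A = (e_1, ..., e_(n+1)) satisfies dA = A omega, and the isothermic_k
   condition makes the matrix B with rows sum_l Q_bl u_l, for Q the inverse of (u_lj(0)), a parallel frame of tau
   with B(0) = I; both connections are therefore flat.  With Phi = diag(A, B) and theta_l = theta_0 + l eta, the form
   Phi eta Phi^-1 is exact, equal to dZ where Z = (0, Y; -J Y^T, 0) and the columns of Y are, up to sign, the
   hypersurfaces sum_l Q_bl f_l.  Moreover dZ wedge dZ = 0, and in fact all products of distinct coefficients of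
   dZ vanish.  So E = H Phi, where H solves dH = l H dZ and is the power series sum_m l^m H_m of
   iterated integrals dH_(m+1) = H_m dZ; these forms are closed, hence exact on the simply connected D, and
   |H_m| <= K^m / m! locally.  Finally (dE/dl) E^-1 at l = 0 equals H_1 = Z. *)

theory Submission
  imports Defs
begin

section \<open>Smooth functions and partial derivatives\<close>

text \<open>The equation for E must be solved for all complex l at once, smoothly in x and l
  jointly. Gauging by \<open>Phi\<close> leaves a right side linear in l. Each block of a
  coefficient of \<open>dZ\<close> is a rank-one matrix made of the i-th columns of A and B, so a
  product of two coefficients contains an inner product of two columns; this is why distinct ones
  annihilate each other. Factorial bounds then yield holomorphy and joint smoothness together. The
  rows u_l are parallel for tau for two reasons. Equality of mixed second derivatives of f_l gives
  the derivative of u_li along x_j for i and j distinct, with one F for all l because the frame is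
  common. The derivative of u_lj along x_j comes from differentiating the isothermic_k identity and
  dividing by u_lj, which is nonzero for an immersion. The null vectors are c_l = - J u_l(0): the
  sign and J undo those in the upper right block of theta. The u of the hypothesis have signs chosen
  pointwise and need not be smooth. The proof therefore takes inner products with the normalised
  derivatives of the first hypersurface instead.\<close>

primrec Ck :: "nat \<Rightarrow> 'a::euclidean_space set \<Rightarrow> ('a \<Rightarrow> 'b::real_normed_vector) \<Rightarrow> bool" where
  "Ck 0 U g = True"
| "Ck (Suc n) U g = (\<exists>g'. (\<forall>x\<in>U. (g has_derivative g' x) (at x)) \<and> (\<forall>b\<in>Basis. Ck n U (\<lambda>x. g' x b)))"

lemma Ck_SucI:
  assumes "\<And>x. x \<in> U \<Longrightarrow> (g has_derivative g' x) (at x)" "\<And>b. b \<in> Basis \<Longrightarrow> Ck n U (\<lambda>x. g' x b)"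
  shows "Ck (Suc n) U g"
  using assms by auto

lemma Ck_cong:
  assumes "open U" "Ck n U g" "\<And>x. x \<in> U \<Longrightarrow> g x = h x"
  shows "Ck n U h"
proof (cases n)
  case (Suc m)
  with assms obtain g' where "\<forall>x\<in>U. (g has_derivative g' x) (at x)" "\<forall>b\<in>Basis. Ck m U (\<lambda>x. g' x b)"
    by auto
  moreover from this have "\<forall>x\<in>U. (h has_derivative g' x) (at x)"
    using assms(1,3) has_derivative_transform_within_open by blast
  ultimately show ?thesis using Suc by auto
qed auto

lemma Ck_Suc_imp: "Ck (Suc n) U g \<Longrightarrow> Ck n U g"
proof (induction n arbitrary: g)
  case (Suc n)
  from Suc.prems obtain g' where "\<forall>x\<in>U. (g has_derivative g' x) (at x)" "\<forall>b\<in>Basis. Ck (Suc n) U (\<lambda>x. g' x b)"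
    by auto
  with Suc.IH show ?case by auto
qed auto

text \<open>The family in \<open>smooth_on\<close> is existentially quantified, so each closure
  property would need a new family; grading by the number of derivatives turns these proofs into
  inductions. \<open>Ck n\<close> does not ask for continuity of the last derivatives, which makes
  no difference once all n are taken.\<close>

lemma smooth_on_Ck:
  fixes U :: "'a::euclidean_space set" and g :: "'a \<Rightarrow> 'b::real_normed_vector"
  assumes "open U"
  shows "smooth_on U g \<longleftrightarrow> (\<forall>n. Ck n U g)"
proof
  assume "smooth_on U g"
  then obtain S where "g \<in> S" and S: "\<forall>h\<in>S. \<exists>h'. (\<forall>x\<in>U. (h has_derivative h' x) (at x)) \<and> (\<forall>b\<in>Basis. (\<lambda>x. h' x b) \<in> S)"
    unfolding smooth_on_def by blast
  have "\<forall>h\<in>S. Ck n U h" for n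
  proof (induction n)
    case (Suc n)
    show ?case
    proof
      fix h assume "h \<in> S"
      with S obtain h' where "\<forall>x\<in>U. (h has_derivative h' x) (at x)" "\<forall>b\<in>Basis. (\<lambda>x. h' x b) \<in> S" by blast
      with Suc show "Ck (Suc n) U h" by auto
    qed
  qed simp
  with \<open>g \<in> S\<close> show "\<forall>n. Ck n U g" by blast
next
  assume g: "\<forall>n. Ck n U g"
  show "smooth_on U g"
    unfolding smooth_on_def
  proof (intro exI[of _ "{h. \<forall>n. Ck n U h}"] conjI ballI)
    fix h :: "'a \<Rightarrow> 'b" assume "h \<in> {h. \<forall>n. Ck n U h}"
    then have h: "Ck n U h" for n by blast
    from h[of "Suc 0"] obtain h' where h': "\<forall>x\<in>U. (h has_derivative h' x) (at x)" by auto
    have "Ck n U (\<lambda>x. h' x b)" if "b \<in> Basis" for b n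
    proof -
      from h[of "Suc n"] obtain k where k: "\<forall>x\<in>U. (h has_derivative k x) (at x)" "\<forall>b\<in>Basis. Ck n U (\<lambda>x. k x b)"
        by auto
      \<comment> \<open>Each order n brings its own derivative; uniqueness at points of U identifies
        it with the fixed \<open>h'\<close>, so that one derivative serves all orders.\<close>
      have "k x = h' x" if "x \<in> U" for x
        using k(1) h' that has_derivative_unique by blast
      then show ?thesis using Ck_cong[OF assms k(2)[rule_format, OF that]] by simp
    qed
    with h' show "\<exists>h'. (\<forall>x\<in>U. (h has_derivative h' x) (at x)) \<and> (\<forall>b\<in>Basis. (\<lambda>x. h' x b) \<in> {h. \<forall>n. Ck n U h})"
      by blast
  qed (use g in auto)
qed

lemma smooth_on_cong:
  assumes "open U" "smooth_on U g" "\<And>x. x \<in> U \<Longrightarrow> g x = h x"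
  shows "smooth_on U h"
  using assms(2) Ck_cong[OF assms(1) _ assms(3)] by (simp add: smooth_on_Ck[OF assms(1)])

lemma Ck_const: "Ck n U (\<lambda>x. c)"
proof (induction n arbitrary: c)
  case (Suc n)
  then show ?case by (auto intro!: exI[of _ "\<lambda>x b. 0"])
qed auto

lemma smooth_on_const [simp]: "open U \<Longrightarrow> smooth_on U (\<lambda>x. c)"
  by (simp add: smooth_on_Ck Ck_const)

lemma Ck_add: "Ck n U f \<Longrightarrow> Ck n U g \<Longrightarrow> Ck n U (\<lambda>x. f x + g x)"
proof (induction n arbitrary: f g)
  case (Suc n)
  then obtain f' g' where "\<forall>x\<in>U. (f has_derivative f' x) (at x)" "\<forall>b\<in>Basis. Ck n U (\<lambda>x. f' x b)"
    "\<forall>x\<in>U. (g has_derivative g' x) (at x)" "\<forall>b\<in>Basis. Ck n U (\<lambda>x. g' x b)" by auto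
  with Suc.IH show ?case
    by (auto intro!: exI[of _ "\<lambda>x b. f' x b + g' x b"] has_derivative_add)
qed auto

lemma smooth_on_add:
  "open U \<Longrightarrow> smooth_on U f \<Longrightarrow> smooth_on U g \<Longrightarrow> smooth_on U (\<lambda>x. f x + g x)"
  by (simp add: smooth_on_Ck Ck_add)

lemma smooth_on_sum:
  "open U \<Longrightarrow> (\<And>i. i \<in> I \<Longrightarrow> smooth_on U (f i)) \<Longrightarrow> smooth_on U (\<lambda>x. \<Sum>i\<in>I. f i x)"
  by (induction I rule: infinite_finite_induct) (auto intro: smooth_on_add)

lemma Ck_sum:
  "(\<And>i. i \<in> I \<Longrightarrow> Ck n U (f i)) \<Longrightarrow> Ck n U (\<lambda>x. \<Sum>i\<in>I. f i x)"
  by (induction I rule: infinite_finite_induct) (auto intro: Ck_add Ck_const)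

lemma (in bounded_bilinear) Ck_bilinear:
  "Ck n U f \<Longrightarrow> Ck n U g \<Longrightarrow> Ck n U (\<lambda>x. prod (f x) (g x))"
proof (induction n arbitrary: f g)
  case (Suc n)
  then obtain f' g' where *: "\<forall>x\<in>U. (f has_derivative f' x) (at x)" "\<forall>b\<in>Basis. Ck n U (\<lambda>x. f' x b)"
    "\<forall>x\<in>U. (g has_derivative g' x) (at x)" "\<forall>b\<in>Basis. Ck n U (\<lambda>x. g' x b)" by auto
  have "Ck n U f" "Ck n U g" using Suc.prems Ck_Suc_imp by auto
  with * Suc.IH show ?case
    by (auto intro!: exI[of _ "\<lambda>x b. prod (f x) (g' x b) + prod (f' x b) (g x)"] FDERIV Ck_add)
qed auto

lemma (in bounded_bilinear) smooth_on_bilinear: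
  "open U \<Longrightarrow> smooth_on U f \<Longrightarrow> smooth_on U g \<Longrightarrow> smooth_on U (\<lambda>x. prod (f x) (g x))"
  by (simp add: smooth_on_Ck Ck_bilinear)

lemmas Ck_mult = bounded_bilinear.Ck_bilinear[OF bounded_bilinear_mult]
lemmas smooth_on_mult = bounded_bilinear.smooth_on_bilinear[OF bounded_bilinear_mult]
lemmas smooth_on_scaleR = bounded_bilinear.smooth_on_bilinear[OF bounded_bilinear_scaleR]
lemmas smooth_on_inner = bounded_bilinear.smooth_on_bilinear[OF bounded_bilinear_inner]

lemma smooth_on_prod:
  fixes f :: "'i \<Rightarrow> 'a::euclidean_space \<Rightarrow> 'b::{real_normed_algebra,comm_ring_1}"
  shows "open U \<Longrightarrow> (\<And>i. i \<in> I \<Longrightarrow> smooth_on U (f i)) \<Longrightarrow> smooth_on U (\<lambda>x. \<Prod>i\<in>I. f i x)"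
  by (induction I rule: infinite_finite_induct) (auto intro: smooth_on_mult)

lemma (in bounded_linear) Ck_linear: "Ck n U g \<Longrightarrow> Ck n U (\<lambda>x. f (g x))"
proof (induction n arbitrary: g)
  case (Suc n)
  then obtain g' where "\<forall>x\<in>U. (g has_derivative g' x) (at x)" "\<forall>b\<in>Basis. Ck n U (\<lambda>x. g' x b)" by auto
  with Suc.IH show ?case
    by (auto intro!: exI[of _ "\<lambda>x b. f (g' x b)"] has_derivative)
qed auto

lemma (in bounded_linear) smooth_on_linear:
  "open U \<Longrightarrow> smooth_on U g \<Longrightarrow> smooth_on U (\<lambda>x. f (g x))"
  by (simp add: smooth_on_Ck Ck_linear)

lemmas smooth_on_component = bounded_linear.smooth_on_linear[OF bounded_linear_vec_nth]
lemmas smooth_on_uminus = bounded_linear.smooth_on_linear[OF bounded_linear_minus[OF bounded_linear_ident]]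

lemma smooth_on_diff:
  "open U \<Longrightarrow> smooth_on U f \<Longrightarrow> smooth_on U g \<Longrightarrow> smooth_on U (\<lambda>x. f x - g x)"
  using smooth_on_add[of U f "\<lambda>x. - g x"] smooth_on_uminus[of U g] by simp

text \<open>The derivative \<open>L'\<close> is the same at every point, so differentiating the
  composite brings in no derivative of L and the induction closes. The cases used later are
  projections and the insertion of x at a fixed l.\<close>

lemma Ck_compose_affine:
  fixes L :: "'c::euclidean_space \<Rightarrow> 'a::euclidean_space" and g :: "'a \<Rightarrow> 'b::real_normed_vector"
  assumes L: "\<And>x. (L has_derivative L') (at x)" "L ` V \<subseteq> U"
  shows "Ck n U g \<Longrightarrow> Ck n V (\<lambda>x. g (L x))"
proof (induction n arbitrary: g)
  case (Suc n)
  then obtain g' where *: "\<forall>x\<in>U. (g has_derivative g' x) (at x)" "\<forall>b\<in>Basis. Ck n U (\<lambda>x. g' x b)" by auto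
  \<comment> \<open>\<open>Ck\<close> controls \<open>g'\<close> along basis vectors only, hence the
    expansion of \<open>L' h\<close> in the basis.\<close>
  have "((\<lambda>x. g (L x)) has_derivative (\<lambda>h. \<Sum>b\<in>Basis. (L' h \<bullet> b) *\<^sub>R g' (L x) b)) (at x)"
    (is "(_ has_derivative ?D) _") if "x \<in> V" for x
  proof -
    have g': "(g has_derivative g' (L x)) (at (L x))" using * that L(2) by auto
    have "g' (L x) (L' h) = (\<Sum>b\<in>Basis. (L' h \<bullet> b) *\<^sub>R g' (L x) b)" for h
    proof -
      interpret bounded_linear "g' (L x)" using g' by (rule has_derivative_bounded_linear)
      have "g' (L x) (L' h) = g' (L x) (\<Sum>b\<in>Basis. (L' h \<bullet> b) *\<^sub>R b)" by (simp add: euclidean_representation)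
      then show ?thesis by (simp add: sum scaleR)
    qed
    moreover have "((\<lambda>x. g (L x)) has_derivative (\<lambda>h. g' (L x) (L' h))) (at x)"
      using has_derivative_compose[OF L(1) g'] .
    ultimately show ?thesis by simp
  qed
  moreover have "Ck n V (\<lambda>x. \<Sum>b\<in>Basis. (L' h \<bullet> b) *\<^sub>R g' (L x) b)" for h
    using * Suc.IH by (intro Ck_sum bounded_linear.Ck_linear[OF bounded_linear_scaleR_right]) auto
  ultimately show ?case by (rule Ck_SucI)
qed auto

lemmas Ck_compose_linear = Ck_compose_affine[OF bounded_linear_imp_has_derivative]

lemma smooth_on_compose_affine:
  fixes L :: "'c::euclidean_space \<Rightarrow> 'a::euclidean_space"
  assumes "open U" "open V" "\<And>x. (L has_derivative L') (at x)" "L ` V \<subseteq> U" "smooth_on U g"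
  shows "smooth_on V (\<lambda>x. g (L x))"
  using assms(5) by (auto simp: smooth_on_Ck assms(1,2) intro!: Ck_compose_affine[OF assms(3,4)])

lemmas smooth_on_compose_linear = smooth_on_compose_affine[OF _ _ bounded_linear_imp_has_derivative]

text \<open>The derivative of 1/g contains 1/g again, but one order lower, where the induction
  hypothesis already provides it.\<close>

lemma Ck_inverse:
  fixes g :: "'a::euclidean_space \<Rightarrow> real"
  assumes "Ck n U g" "\<And>x. x \<in> U \<Longrightarrow> g x \<noteq> 0"
  shows "Ck n U (\<lambda>x. inverse (g x))"
  using assms(1)
proof (induction n)
  case (Suc n)
  then obtain g' where *: "\<forall>x\<in>U. (g has_derivative g' x) (at x)" "\<forall>b\<in>Basis. Ck n U (\<lambda>x. g' x b)" by auto
  have "Ck n U (\<lambda>x. inverse (g x))" using Suc Ck_Suc_imp by blast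
  then have "Ck n U (\<lambda>x. - (inverse (g x) * g' x b * inverse (g x)))" if "b \<in> Basis" for b
    using * that by (intro bounded_linear.Ck_linear[OF bounded_linear_minus[OF bounded_linear_ident]] Ck_mult) auto
  moreover have "((\<lambda>x. inverse (g x)) has_derivative (\<lambda>b. - (inverse (g x) * g' x b * inverse (g x)))) (at x)"
    if "x \<in> U" for x
    using * assms(2) that by (intro Deriv.has_derivative_inverse) auto
  ultimately show ?case by (intro Ck_SucI)
qed auto

lemma smooth_on_inverse:
  fixes g :: "'a::euclidean_space \<Rightarrow> real"
  shows "open U \<Longrightarrow> smooth_on U g \<Longrightarrow> (\<And>x. x \<in> U \<Longrightarrow> g x \<noteq> 0) \<Longrightarrow> smooth_on U (\<lambda>x. inverse (g x))"
  by (simp add: smooth_on_Ck Ck_inverse)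

lemma Ck_sqrt:
  fixes g :: "'a::euclidean_space \<Rightarrow> real"
  assumes "Ck n U g" "\<And>x. x \<in> U \<Longrightarrow> g x > 0"
  shows "Ck n U (\<lambda>x. sqrt (g x))"
  using assms(1)
proof (induction n)
  case (Suc n)
  then obtain g' where *: "\<forall>x\<in>U. (g has_derivative g' x) (at x)" "\<forall>b\<in>Basis. Ck n U (\<lambda>x. g' x b)" by auto
  have "Ck n U (\<lambda>x. sqrt (g x))" using Suc Ck_Suc_imp by blast
  then have "Ck n U (\<lambda>x. inverse (sqrt (g x)))" using assms(2) by (intro Ck_inverse) (auto simp: less_imp_neq[symmetric])
  then have "Ck n U (\<lambda>x. g' x b * (inverse (sqrt (g x)) * (1/2)))" if "b \<in> Basis" for b
    using * that by (intro Ck_mult Ck_const) auto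
  moreover have "((\<lambda>x. sqrt (g x)) has_derivative (\<lambda>b. g' x b * (inverse (sqrt (g x)) * (1/2)))) (at x)"
    if "x \<in> U" for x
    using * assms(2)[OF that] that
    by (auto intro!: derivative_eq_intros simp: divide_simps)
  ultimately show ?case by (intro Ck_SucI)
qed auto

lemma smooth_on_norm:
  fixes g :: "'a::euclidean_space \<Rightarrow> 'b::real_inner"
  assumes "open U" "smooth_on U g" "\<And>x. x \<in> U \<Longrightarrow> g x \<noteq> 0"
  shows "smooth_on U (\<lambda>x. norm (g x))"
proof -
  have "smooth_on U (\<lambda>x. g x \<bullet> g x)" using assms by (intro smooth_on_inner)
  then show ?thesis using assms unfolding norm_eq_sqrt_inner by (simp add: smooth_on_Ck Ck_sqrt)
qed

lemma smooth_on_imp_differentiable: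
  assumes "open U" "smooth_on U g" "x \<in> U"
  shows "g differentiable (at x)"
  using assms smooth_on_Ck[of U g] Ck.simps(2)[of 0 U g] by (auto simp: differentiable_def)

lemma smooth_on_imp_continuous_on:
  assumes "open U" "smooth_on U g"
  shows "continuous_on U g"
  using assms smooth_on_imp_differentiable
  by (intro continuous_at_imp_continuous_on) (auto intro: differentiable_imp_continuous_within)

lemma smooth_on_derivative:
  assumes "open U" "smooth_on U g"
  obtains g' where "\<And>x. x \<in> U \<Longrightarrow> (g has_derivative g' x) (at x)"
    "\<And>b. b \<in> Basis \<Longrightarrow> smooth_on U (\<lambda>x. g' x b)"
proof -
  obtain S where "g \<in> S" and S: "\<forall>h\<in>S. \<exists>h'. (\<forall>x\<in>U. (h has_derivative h' x) (at x)) \<and> (\<forall>b\<in>Basis. (\<lambda>x. h' x b) \<in> S)"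
    using assms(2) unfolding smooth_on_def by blast
  then obtain g' where *: "\<forall>x\<in>U. (g has_derivative g' x) (at x)" "\<forall>b\<in>Basis. (\<lambda>x. g' x b) \<in> S" by blast
  have "smooth_on U (\<lambda>x. g' x b)" if "b \<in> Basis" for b
    unfolding smooth_on_def by (intro exI[of _ S]) (use * S that in auto)
  with * that show ?thesis by blast
qed

lemma smooth_onI:
  assumes "open U" "\<And>x. x \<in> U \<Longrightarrow> (g has_derivative g' x) (at x)"
    "\<And>b. b \<in> Basis \<Longrightarrow> smooth_on U (\<lambda>x. g' x b)"
  shows "smooth_on U g"
proof -
  have "Ck n U g" for n
    using assms by (cases n) (auto simp: smooth_on_Ck intro!: exI[of _ g'])
  with assms(1) show ?thesis by (simp add: smooth_on_Ck)
qed

section \<open>Enumeration of coordinates and calculus of partial derivatives\<close>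

lemma ix_bij: "bij_betw (ix :: nat \<Rightarrow> 'n::{finite,linorder}) {..<CARD('n)} UNIV"
  unfolding ix_def
  using bij_betw_nth[of "sorted_list_of_set (UNIV::'n set)" "{..<CARD('n)}" UNIV] by simp

lemma sum_ix: "(\<Sum>j<CARD('n::{finite,linorder}). f (ix j :: 'n)) = (\<Sum>i\<in>UNIV. f i)"
  using sum.reindex_bij_betw[OF ix_bij, of f] by simp

lemma ix_eq_iff: "i < CARD('n) \<Longrightarrow> j < CARD('n) \<Longrightarrow> (ix i :: 'n::{finite,linorder}) = ix j \<longleftrightarrow> i = j"
  using bij_betw_imp_inj_on[OF ix_bij] by (auto simp: inj_on_def)

lemma ix_surj: "\<exists>j<CARD('n). (i :: 'n::{finite,linorder}) = ix j"
  using bij_betw_imp_surj_on[OF ix_bij] by (metis UNIV_I imageE lessThan_iff)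

lemma pd_eq:
  assumes "(g has_derivative g') (at x)"
  shows "pd j g x = g' (axis (ix j) 1)"
proof -
  interpret bounded_linear g' using assms by (rule has_derivative_bounded_linear)
  have "((\<lambda>t. x + t *\<^sub>R axis (ix j) 1) has_derivative (\<lambda>t. t *\<^sub>R axis (ix j) 1)) (at 0)"
    by (auto intro!: derivative_eq_intros)
  moreover have "(g has_derivative g') (at (x + 0 *\<^sub>R axis (ix j) 1))" using assms by simp
  ultimately have "((\<lambda>t. g (x + t *\<^sub>R axis (ix j) 1)) has_derivative (\<lambda>t. g' (t *\<^sub>R axis (ix j) 1))) (at 0)"
    by (rule has_derivative_compose)
  then have "((\<lambda>t. g (x + t *\<^sub>R axis (ix j) 1)) has_vector_derivative g' (axis (ix j) 1)) (at 0)"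
    by (simp add: has_vector_derivative_def scaleR)
  then show ?thesis unfolding pd_def by (rule vector_derivative_at)
qed

lemma derivative_sum_pd:
  fixes g :: "real^'n::{finite,linorder} \<Rightarrow> 'b::real_normed_vector"
  assumes "(g has_derivative g') (at x)"
  shows "g' v = (\<Sum>j<CARD('n). (v $ ix j) *\<^sub>R pd j g x)"
proof -
  interpret bounded_linear g' using assms by (rule has_derivative_bounded_linear)
  have "g' v = g' (\<Sum>i\<in>UNIV. (v $ i) *\<^sub>R axis i 1)"
    using basis_expansion[of v] by (simp add: scalar_mult_eq_scaleR)
  also have "\<dots> = (\<Sum>i\<in>UNIV. (v $ i) *\<^sub>R g' (axis i 1))" by (simp add: sum scaleR)
  also have "\<dots> = (\<Sum>j<CARD('n). (v $ ix j) *\<^sub>R g' (axis (ix j) 1))"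
    by (simp add: sum_ix[symmetric])
  finally show ?thesis by (simp add: pd_eq[OF assms])
qed

lemma has_derivative_pd:
  fixes g :: "real^'n::{finite,linorder} \<Rightarrow> 'b::real_normed_vector"
  assumes "open U" "smooth_on U g" "x \<in> U"
  shows "(g has_derivative (\<lambda>v. \<Sum>j<CARD('n). (v $ ix j) *\<^sub>R pd j g x)) (at x)"
proof -
  obtain g' where g': "(g has_derivative g') (at x)"
    using smooth_on_imp_differentiable[OF assms] by (auto simp: differentiable_def)
  moreover have "g' = (\<lambda>v. \<Sum>j<CARD('n). (v $ ix j) *\<^sub>R pd j g x)"
    using derivative_sum_pd[OF g'] by blast
  ultimately show ?thesis by simp
qed

lemma smooth_on_pd:
  assumes "open U" "smooth_on U g"
  shows "smooth_on U (pd j g)"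
proof -
  obtain g' where *: "\<And>x. x \<in> U \<Longrightarrow> (g has_derivative g' x) (at x)"
    "\<And>b. b \<in> Basis \<Longrightarrow> smooth_on U (\<lambda>x. g' x b)" using smooth_on_derivative[OF assms] by blast
  have "smooth_on U (\<lambda>x. g' x (axis (ix j) 1))" by (intro *) (auto simp: axis_in_Basis_iff)
  then show ?thesis by (rule smooth_on_cong[OF assms(1)]) (rule pd_eq[OF *(1), symmetric])
qed

lemma smooth_on_pdI:
  fixes g :: "real^'n::{finite,linorder} \<Rightarrow> 'b::real_normed_vector"
  assumes "open U" "\<And>x. x \<in> U \<Longrightarrow> (g has_derivative (\<lambda>v. \<Sum>j<CARD('n). (v $ ix j) *\<^sub>R d j x)) (at x)"
    "\<And>j. j < CARD('n) \<Longrightarrow> smooth_on U (d j)"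
  shows "smooth_on U g"
  using assms(1,2)
  by (rule smooth_onI) (auto intro!: smooth_on_sum smooth_on_scaleR[OF assms(1) smooth_on_const] assms)

lemma pd_const [simp]: "pd j (\<lambda>y. c) x = 0"
  using pd_eq[OF has_derivative_const] .

lemma (in bounded_bilinear) pd_bilinear:
  assumes "open U" "smooth_on U f" "smooth_on U g" "x \<in> U"
  shows "pd j (\<lambda>y. prod (f y) (g y)) x = prod (f x) (pd j g x) + prod (pd j f x) (g x)"
proof -
  obtain f' g' where "(f has_derivative f') (at x)" "(g has_derivative g') (at x)"
    using smooth_on_imp_differentiable[OF assms(1,2,4)] smooth_on_imp_differentiable[OF assms(1,3,4)]
    unfolding differentiable_def by blast
  from pd_eq[OF FDERIV[OF this]] pd_eq[OF this(1)] pd_eq[OF this(2)] show ?thesis by simp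
qed

lemmas pd_mult = bounded_bilinear.pd_bilinear[OF bounded_bilinear_mult]
lemmas pd_scaleR = bounded_bilinear.pd_bilinear[OF bounded_bilinear_scaleR]
lemmas pd_inner = bounded_bilinear.pd_bilinear[OF bounded_bilinear_inner]

lemma (in bounded_linear) pd_linear:
  assumes "open U" "smooth_on U g" "x \<in> U"
  shows "pd j (\<lambda>y. f (g y)) x = f (pd j g x)"
proof -
  obtain g' where "(g has_derivative g') (at x)"
    using smooth_on_imp_differentiable[OF assms] unfolding differentiable_def by blast
  from pd_eq[OF has_derivative[OF this]] pd_eq[OF this] show ?thesis by simp
qed

lemmas pd_component = bounded_linear.pd_linear[OF bounded_linear_vec_nth]
lemmas pd_cmult = bounded_linear.pd_linear[OF bounded_linear_mult_right]
lemmas pd_uminus = bounded_linear.pd_linear[OF bounded_linear_minus[OF bounded_linear_ident]]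

lemma pd_sum:
  assumes "open U" "\<And>i. i \<in> I \<Longrightarrow> smooth_on U (f i)" "x \<in> U"
  shows "pd j (\<lambda>y. \<Sum>i\<in>I. f i y) x = (\<Sum>i\<in>I. pd j (f i) x)"
proof -
  have "\<forall>i\<in>I. \<exists>f'. (f i has_derivative f') (at x)"
    using smooth_on_imp_differentiable[OF assms(1) _ assms(3)] assms unfolding differentiable_def by blast
  from bchoice[OF this] obtain f' where f': "\<forall>i\<in>I. (f i has_derivative f' i) (at x)" by blast
  then have "((\<lambda>y. \<Sum>i\<in>I. f i y) has_derivative (\<lambda>v. \<Sum>i\<in>I. f' i v)) (at x)"
    by (intro has_derivative_sum) auto
  then have "pd j (\<lambda>y. \<Sum>i\<in>I. f i y) x = (\<Sum>i\<in>I. f' i (axis (ix j) 1))" by (rule pd_eq)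
  also have "\<dots> = (\<Sum>i\<in>I. pd j (f i) x)"
    using f' by (intro sum.cong refl pd_eq[symmetric]) auto
  finally show ?thesis .
qed

lemma pd_add:
  assumes "open U" "smooth_on U f" "smooth_on U g" "x \<in> U"
  shows "pd j (\<lambda>y. f y + g y) x = pd j f x + pd j g x"
proof -
  obtain f' g' where "(f has_derivative f') (at x)" "(g has_derivative g') (at x)"
    using smooth_on_imp_differentiable[OF assms(1,2,4)] smooth_on_imp_differentiable[OF assms(1,3,4)]
    unfolding differentiable_def by blast
  from pd_eq[OF has_derivative_add[OF this]] pd_eq[OF this(1)] pd_eq[OF this(2)] show ?thesis by simp
qed

lemma pd_cong:
  assumes "open U" "x \<in> U" "\<And>y. y \<in> U \<Longrightarrow> f y = g y"
  shows "pd j f x = pd j g x"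
proof -
  let ?T = "(\<lambda>t::real. x + t *\<^sub>R axis (ix j) 1) -` U"
  have T: "open ?T" "0 \<in> ?T" using assms(2) by (intro open_vimage[OF assms(1)] continuous_intros, simp)
  note * = has_derivative_transform_within_open[OF _ T]
  \<comment> \<open>Differentiability is not assumed: both functions of t have the same candidate
    derivatives at 0, so the choice behind \<open>vector_derivative\<close> is the same for
    both.\<close>
  have "((\<lambda>t. f (x + t *\<^sub>R axis (ix j) 1)) has_derivative D) (at 0) \<longleftrightarrow>
        ((\<lambda>t. g (x + t *\<^sub>R axis (ix j) 1)) has_derivative D) (at 0)" for D
    using *[of "\<lambda>t. f (x + t *\<^sub>R axis (ix j) 1)" D UNIV "\<lambda>t. g (x + t *\<^sub>R axis (ix j) 1)"]
      *[of "\<lambda>t. g (x + t *\<^sub>R axis (ix j) 1)" D UNIV "\<lambda>t. f (x + t *\<^sub>R axis (ix j) 1)"] assms(3) by auto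
  then show ?thesis unfolding pd_def vector_derivative_def has_vector_derivative_def by simp
qed

lemma pd_zero_imp_constant:
  fixes g :: "real^'n::{finite,linorder} \<Rightarrow> 'b::real_normed_vector"
  assumes "open D" "connected D" "smooth_on D g" "\<And>j x. j < CARD('n) \<Longrightarrow> x \<in> D \<Longrightarrow> pd j g x = 0"
    "x \<in> D" "y \<in> D"
  shows "g x = g y"
proof (rule has_derivative_zero_unique_connected[OF assms(1,2) _ assms(5,6)])
  fix z assume "z \<in> D"
  then show "(g has_derivative (\<lambda>x. 0)) (at z)"
    using has_derivative_pd[OF assms(1,3)] assms(4) by simp
qed

text \<open>Both mixed partials are limits of the same second difference quotient.\<close>

lemma mixed_partials_real:
  fixes f :: "'a::real_normed_vector \<Rightarrow> real"
  assumes "open U" "x \<in> U"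
    and f: "\<And>y. y \<in> U \<Longrightarrow> (f has_derivative f' y) (at y)"
    and fu: "\<And>y. y \<in> U \<Longrightarrow> ((\<lambda>z. f' z u) has_derivative fu y) (at y)"
    and fv: "\<And>y. y \<in> U \<Longrightarrow> ((\<lambda>z. f' z v) has_derivative fv y) (at y)"
    and cont: "isCont (\<lambda>y. fu y v) x" "isCont (\<lambda>y. fv y u) x"
  shows "fu x v = fv x u"
proof -
  let ?x = "\<lambda>u v s t. x + s *\<^sub>R u + t *\<^sub>R v"
  obtain r where r: "r > 0" "ball x r \<subseteq> U" using openE[OF assms(1,2)] .
  have pos: "1 + norm u + norm v > 0" using norm_ge_zero[of u] norm_ge_zero[of v] by linarith
  \<comment> \<open>Keeps every parallelogram with side lengths below h times u and v inside the
    ball; the summand 1 makes the estimate strict and covers u = v = 0.\<close>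
  define h where "h = r / (1 + norm u + norm v)"
  have h: "h > 0" using r pos by (simp add: h_def)
  have inU: "?x u v s t \<in> U" if "0 \<le> s" "s < h" "0 \<le> t" "t < h" for s t
  proof -
    have "norm (s *\<^sub>R u + t *\<^sub>R v) \<le> s * norm u + t * norm v"
      using norm_triangle_ineq[of "s *\<^sub>R u" "t *\<^sub>R v"] that by simp
    also have "\<dots> \<le> h * norm u + h * norm v" using that by (intro add_mono mult_right_mono) auto
    also have "\<dots> < h * (1 + norm u + norm v)" using h by (simp add: algebra_simps)
    also have "\<dots> = r" using pos by (simp add: h_def)
    finally have "norm (s *\<^sub>R u + t *\<^sub>R v) < r" .
    then have "?x u v s t \<in> ball x r"
      using dist_add_cancel[of x "s *\<^sub>R u + t *\<^sub>R v" 0] by (simp add: dist_commute add.assoc)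
    with r show ?thesis by blast
  qed
  \<comment> \<open>Two mean value theorems, first along u and then along v. The claim is
    generalised over u, v and \<open>fu\<close> so that it can be applied again with the directions
    exchanged.\<close>
  have key: "\<exists>\<xi> \<eta>. 0 < \<xi> \<and> \<xi> < t \<and> 0 < \<eta> \<and> \<eta> < t \<and>
      f (?x u v t t) - f (x + t *\<^sub>R u) - f (x + t *\<^sub>R v) + f x = t * (t * fu (?x u v \<xi> \<eta>) v)"
    if t: "0 < t" "t < h" and inU: "\<And>s t. 0 \<le> s \<Longrightarrow> s < h \<Longrightarrow> 0 \<le> t \<Longrightarrow> t < h \<Longrightarrow> ?x u v s t \<in> U"
      and fu: "\<And>y. y \<in> U \<Longrightarrow> ((\<lambda>z. f' z u) has_derivative fu y) (at y)"
    for t u v fu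
  proof -
    have lin: "bounded_linear (f' y)" if "y \<in> U" for y using f that has_derivative_bounded_linear by blast
    have linu: "bounded_linear (fu y)" if "y \<in> U" for y using fu that has_derivative_bounded_linear by blast
    have d1: "((\<lambda>s. f (?x u v s c)) has_real_derivative f' (?x u v s c) u) (at s)"
      if "0 \<le> s" "s \<le> t" "c \<in> {0,t}" for s c
    proof -
      have U: "?x u v s c \<in> U" by (intro inU) (use that t in auto)
      have "((\<lambda>s. ?x u v s c) has_derivative (\<lambda>s. s *\<^sub>R u)) (at s)" by (auto intro!: derivative_eq_intros)
      from has_derivative_compose[OF this f[OF U]] show ?thesis
        using bounded_linear.linear[OF lin[OF U]]
        by (simp add: has_field_derivative_def linear_scale mult_commute_abs)
    qed
    have "\<exists>\<xi>. \<xi> > 0 \<and> \<xi> < t \<and> (f (?x u v t t) - f (?x u v t 0)) - (f (?x u v 0 t) - f (?x u v 0 0))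
      = (t - 0) * (f' (?x u v \<xi> t) u - f' (?x u v \<xi> 0) u)"
      by (rule MVT2[OF t(1)]) (intro DERIV_diff d1, auto)
    then obtain \<xi> where \<xi>: "\<xi> > 0" "\<xi> < t" "f (?x u v t t) - f (x + t *\<^sub>R u) - f (x + t *\<^sub>R v) + f x
      = t * (f' (?x u v \<xi> t) u - f' (?x u v \<xi> 0) u)" by auto
    have "\<exists>\<eta>. \<eta> > 0 \<and> \<eta> < t \<and> f' (?x u v \<xi> t) u - f' (?x u v \<xi> 0) u = (t - 0) * fu (?x u v \<xi> \<eta>) v"
    proof (rule MVT2[OF t(1)])
      fix s assume s: "0 \<le> s" "s \<le> t"
      have U: "?x u v \<xi> s \<in> U" by (intro inU) (use s t \<xi> in auto)
      have "((\<lambda>s. ?x u v \<xi> s) has_derivative (\<lambda>s. s *\<^sub>R v)) (at s)" by (auto intro!: derivative_eq_intros)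
      from has_derivative_compose[OF this fu[OF U]]
      show "((\<lambda>s. f' (?x u v \<xi> s) u) has_real_derivative fu (?x u v \<xi> s) v) (at s)"
        using bounded_linear.linear[OF linu[OF U]]
        by (simp add: has_field_derivative_def linear_scale mult_commute_abs)
    qed
    with \<xi> show ?thesis by auto
  qed
  have "dist (fu x v) (fv x u) \<le> e" if e: "e > 0" for e
  proof -
    obtain d1 where d1: "d1 > 0" "\<And>y. dist y x < d1 \<Longrightarrow> dist (fu y v) (fu x v) < e/2"
      using cont(1)[unfolded continuous_at_eps_delta, rule_format, of "e/2"] e by auto
    obtain d2 where d2: "d2 > 0" "\<And>y. dist y x < d2 \<Longrightarrow> dist (fv y u) (fv x u) < e/2"
      using cont(2)[unfolded continuous_at_eps_delta, rule_format, of "e/2"] e by auto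
    define d where "d = min d1 d2"
    \<comment> \<open>h/2 keeps t below h; the other bound brings the intermediate points of both
      expansions within d of x.\<close>
    define t where "t = min (h/2) (d / (1 + norm u + norm v))"
    have d: "d > 0" using d1 d2 by (simp add: d_def)
    have t: "0 < t" "t < h" using h d pos by (auto simp: t_def)
    have near: "dist (?x u v a b) x < d" if "0 < a" "a < t" "0 < b" "b < t" for a b
    proof -
      have "norm (a *\<^sub>R u + b *\<^sub>R v) \<le> a * norm u + b * norm v"
        using norm_triangle_ineq[of "a *\<^sub>R u" "b *\<^sub>R v"] that by simp
      also have "\<dots> \<le> t * norm u + t * norm v" using that by (intro add_mono mult_right_mono) auto
      also have "\<dots> < t * (1 + norm u + norm v)" using t by (simp add: algebra_simps)
      also have "\<dots> \<le> d / (1 + norm u + norm v) * (1 + norm u + norm v)"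
        using pos by (intro mult_right_mono) (auto simp: t_def)
      also have "\<dots> = d" using pos by simp
      finally show ?thesis by (simp add: dist_norm add.assoc)
    qed
    obtain \<xi> \<eta> where 1: "0 < \<xi>" "\<xi> < t" "0 < \<eta>" "\<eta> < t"
      "f (?x u v t t) - f (x + t *\<^sub>R u) - f (x + t *\<^sub>R v) + f x = t * (t * fu (?x u v \<xi> \<eta>) v)"
      using key[OF t inU fu] by auto
    have inU': "0 \<le> s \<Longrightarrow> s < h \<Longrightarrow> 0 \<le> t \<Longrightarrow> t < h \<Longrightarrow> ?x v u s t \<in> U" for s t
      using inU[of t s] by (simp add: algebra_simps)
    obtain \<xi>' \<eta>' where 2: "0 < \<xi>'" "\<xi>' < t" "0 < \<eta>'" "\<eta>' < t"
      "f (?x v u t t) - f (x + t *\<^sub>R v) - f (x + t *\<^sub>R u) + f x = t * (t * fv (?x v u \<xi>' \<eta>') u)"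
      using key[OF t inU' fv] by auto
    have "t * (t * fu (?x u v \<xi> \<eta>) v) = t * (t * fv (?x v u \<xi>' \<eta>') u)"
      using 1(5) 2(5) by (simp add: algebra_simps)
    then have "fu (?x u v \<xi> \<eta>) v = fv (?x v u \<xi>' \<eta>') u" using t by simp
    moreover have "dist (fu (?x u v \<xi> \<eta>) v) (fu x v) < e/2"
      by (rule d1(2)) (use near[OF 1(1-4)] in \<open>simp add: d_def\<close>)
    moreover have "dist (fv (?x v u \<xi>' \<eta>') u) (fv x u) < e/2"
      by (rule d2(2)) (use near[OF 2(3,4,1,2)] in \<open>simp add: d_def add_ac\<close>)
    ultimately show ?thesis using dist_triangle_half_r[of "fv (?x v u \<xi>' \<eta>') u" "fu x v" e "fv x u"] by simp
  qed
  then have "dist (fu x v) (fv x u) \<le> 0" using field_le_epsilon[of "dist (fu x v) (fv x u)" 0] by simp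
  then show ?thesis by simp
qed

lemma pd_commute_real:
  fixes f :: "real^'n::{finite,linorder} \<Rightarrow> real"
  assumes "open U" "smooth_on U f" "x \<in> U"
  shows "pd i (pd j f) x = pd j (pd i f) x"
proof -
  have "\<forall>x\<in>U. \<exists>F. (f has_derivative F) (at x)"
    using smooth_on_imp_differentiable[OF assms(1,2)] unfolding differentiable_def by blast
  from bchoice[OF this] obtain f' where f': "\<And>x. x \<in> U \<Longrightarrow> (f has_derivative f' x) (at x)" by blast
  have *: "pd j f y = f' y (axis (ix j) 1)" if "y \<in> U" for y j using pd_eq[OF f'[OF that]] .
  have "\<forall>j. \<exists>F. \<forall>y\<in>U. ((\<lambda>z. f' z (axis (ix j) 1)) has_derivative F y) (at y)"
  proof
    fix j
    have "\<forall>y\<in>U. \<exists>F. (pd j f has_derivative F) (at y)"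
      using smooth_on_imp_differentiable[OF assms(1) smooth_on_pd[OF assms(1,2)]] unfolding differentiable_def by blast
    from bchoice[OF this] obtain F where "\<forall>y\<in>U. (pd j f has_derivative F y) (at y)" by blast
    moreover have "((\<lambda>z. f' z (axis (ix j) 1)) has_derivative F y) (at y)"
      if "(pd j f has_derivative F y) (at y)" "y \<in> U" for y
      by (rule has_derivative_transform_within_open[OF that(1) assms(1) that(2) *])
    ultimately show "\<exists>F. \<forall>y\<in>U. ((\<lambda>z. f' z (axis (ix j) 1)) has_derivative F y) (at y)" by blast
  qed
  from choice[OF this] obtain F where F: "\<And>j y. y\<in>U \<Longrightarrow> ((\<lambda>z. f' z (axis (ix j) 1)) has_derivative F j y) (at y)" by blast
  have pp: "pd i (pd j f) y = F j y (axis (ix i) 1)" if "y \<in> U" for y i j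
    using pd_eq[OF F[OF that]] pd_cong[OF assms(1) that *[of _ j]] by simp
  have cont: "isCont (\<lambda>y. F j y (axis (ix i) 1)) x" for i j
  proof -
    have "continuous_on U (pd i (pd j f))"
      by (intro smooth_on_imp_continuous_on smooth_on_pd assms)
    then have "continuous_on U (\<lambda>y. F j y (axis (ix i) 1))" using pp continuous_on_cong[of U U "pd i (pd j f)"] by simp
    then show ?thesis using assms(3) continuous_on_eq_continuous_at[OF assms(1)] by blast
  qed
  show ?thesis
    using mixed_partials_real[OF assms(1,3) f' F[of _ j] F[of _ i] cont cont] pp[OF assms(3)] by simp
qed

lemma pd_commute:
  fixes f :: "real^'n::{finite,linorder} \<Rightarrow> 'b::euclidean_space"
  assumes "open U" "smooth_on U f" "x \<in> U"
  shows "pd i (pd j f) x = pd j (pd i f) x"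
proof (rule euclidean_eqI)
  fix b :: 'b assume "b \<in> Basis"
  have "pd i (pd j f) x \<bullet> b = pd i (pd j (\<lambda>y. f y \<bullet> b)) x" for i j
  proof -
    have "pd i (pd j f) x \<bullet> b = pd i (\<lambda>y. pd j f y \<bullet> b) x"
      by (rule bounded_linear.pd_linear[OF bounded_linear_inner_left assms(1) smooth_on_pd[OF assms(1,2)] assms(3), symmetric])
    also have "\<dots> = pd i (pd j (\<lambda>y. f y \<bullet> b)) x"
      by (rule pd_cong[OF assms(1,3)])
        (rule bounded_linear.pd_linear[OF bounded_linear_inner_left assms(1,2), symmetric])
    finally show ?thesis .
  qed
  moreover have "smooth_on U (\<lambda>y. f y \<bullet> b)"
    using bounded_linear.smooth_on_linear[OF bounded_linear_inner_left assms(1,2)] .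
  ultimately show "pd i (pd j f) x \<bullet> b = pd j (pd i f) x \<bullet> b"
    using pd_commute_real[OF assms(1) _ assms(3)] by simp
qed

section \<open>Closed forms on simply connected sets\<close>

text \<open>A form that is only known to have primitives on balls. It is integrated along merely
  continuous maps by continuation of local primitives, so homotopies never have to be
  smoothed.\<close>

locale local_primitives =
  fixes D :: "'a::euclidean_space set" and P :: "'a \<Rightarrow> 'a \<Rightarrow> real" and \<rho> :: "'a \<Rightarrow> real"
    and a :: "'a \<Rightarrow> 'a \<Rightarrow> real"
  assumes radius_pos: "x \<in> D \<Longrightarrow> \<rho> x > 0"
    and ball_subset: "x \<in> D \<Longrightarrow> ball x (\<rho> x) \<subseteq> D"
    and primitive: "x \<in> D \<Longrightarrow> y \<in> ball x (\<rho> x) \<Longrightarrow> (P x has_derivative a y) (at y)"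
begin

text \<open>Two balls meet in a convex set, and there the difference of the two primitives has
  derivative zero.\<close>

lemma primitive_diff_const:
  assumes "x \<in> D" "y \<in> D" "z \<in> ball x (\<rho> x) \<inter> ball y (\<rho> y)" "w \<in> ball x (\<rho> x) \<inter> ball y (\<rho> y)"
  shows "P x z - P y z = P x w - P y w"
proof -
  have "((\<lambda>z. P x z - P y z) has_derivative (\<lambda>h. 0)) (at u within ball x (\<rho> x) \<inter> ball y (\<rho> y))"
    if "u \<in> ball x (\<rho> x) \<inter> ball y (\<rho> y)" for u
    using has_derivative_diff[OF primitive[of x u] primitive[of y u]] that assms
    by (auto intro: has_derivative_at_withinI)
  then have "\<exists>c. \<forall>u\<in>ball x (\<rho> x) \<inter> ball y (\<rho> y). P x u - P y u = c"
    by (rule has_derivative_zero_constant[OF convex_Int[OF convex_ball convex_ball]])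
  with assms(3,4) show ?thesis by auto
qed

text \<open>\<open>G\<close> integrates the form along the merely continuous map \<open>h\<close>.\<close>

definition compatible :: "('c \<Rightarrow> 'a) \<Rightarrow> ('c \<Rightarrow> real) \<Rightarrow> 'c \<Rightarrow> 'c \<Rightarrow> bool" where
  "compatible h G z w \<longleftrightarrow> dist (h z) (h w) < \<rho> (h z) \<and> G w - P (h z) (h w) = G z - P (h z) (h z)"

text \<open>All neighbourhoods are relative to R, so lifts can be restricted to, and glued along,
  closed pieces of a parameter square.\<close>

definition lifts :: "('c::metric_space \<Rightarrow> 'a) \<Rightarrow> 'c set \<Rightarrow> ('c \<Rightarrow> real) \<Rightarrow> bool" where
  "lifts h R G \<longleftrightarrow> (\<forall>z\<in>R. \<exists>d>0. \<forall>w\<in>R. dist w z < d \<longrightarrow> compatible h G z w)"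

lemma lifts_cong:
  assumes "lifts h R G" "\<And>z. z \<in> R \<Longrightarrow> h z = h' z"
  shows "lifts h' R G"
  using assms unfolding lifts_def compatible_def by simp

text \<open>Near each point both lifts have the increments of the same local primitive, so their
  difference is locally constant.\<close>

lemma lifts_unique:
  assumes "connected R" "lifts h R G" "lifts h R G'" "z \<in> R" "w \<in> R"
  shows "G w - G z = G' w - G' z"
proof -
  have "(\<lambda>z. G z - G' z) constant_on R"
  proof (rule locally_constant_imp_constant[OF assms(1)])
    fix z assume z: "z \<in> R"
    from assms(2) z obtain d where d: "d > 0" "\<And>w. w \<in> R \<Longrightarrow> dist w z < d \<Longrightarrow> compatible h G z w"
      unfolding lifts_def by blast
    from assms(3) z obtain d' where d': "d' > 0" "\<And>w. w \<in> R \<Longrightarrow> dist w z < d' \<Longrightarrow> compatible h G' z w"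
      unfolding lifts_def by blast
    have "G w - G' w = G z - G' z" if "w \<in> R \<inter> ball z (min d d')" for w
      using d(2)[of w] d'(2)[of w] that by (simp add: dist_commute compatible_def)
    moreover have "z \<in> R \<inter> ball z (min d d')" using z d d' by simp
    moreover have "openin (top_of_set R) (R \<inter> ball z (min d d'))" by (simp add: openin_open_Int)
    ultimately show "\<exists>T. openin (top_of_set R) T \<and> z \<in> T \<and> (\<forall>x\<in>T. G x - G' x = G z - G' z)" by blast
  qed
  then have "G z - G' z = G w - G' w" using assms(4,5) unfolding constant_on_def by auto
  then show ?thesis by simp
qed

lemma lifts_small:
  assumes "x \<in> D" "continuous_on R h" "h ` R \<subseteq> ball x (\<rho> x)"
  shows "lifts h R (P x \<circ> h)"
proof (unfold lifts_def, rule ballI)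
  fix z assume z: "z \<in> R"
  have hz: "h z \<in> D" using assms ball_subset z by blast
  from assms(2) z radius_pos[OF hz] obtain d where d: "d > 0" "\<And>w. w \<in> R \<Longrightarrow> dist w z < d \<Longrightarrow> dist (h w) (h z) < \<rho> (h z)"
    unfolding continuous_on_iff by blast
  have "compatible h (P x \<circ> h) z w"
    if w: "w \<in> R" "dist w z < d" for w
  proof -
    have "dist (h z) (h w) < \<rho> (h z)" using d(2)[OF w] by (simp add: dist_commute)
    moreover have "P x (h w) - P (h z) (h w) = P x (h z) - P (h z) (h z)"
      using w z assms(3) radius_pos[OF hz] calculation by (intro primitive_diff_const assms(1) hz) auto
    ultimately show ?thesis by (simp add: compatible_def)
  qed
  with d(1) show "\<exists>d>0. \<forall>w\<in>R. dist w z < d \<longrightarrow> compatible h (P x \<circ> h) z w" by blast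
qed

lemma lifts_subset: "lifts h R G \<Longrightarrow> R' \<subseteq> R \<Longrightarrow> lifts h R' G"
  unfolding lifts_def by (meson subsetD)

text \<open>If z lies outside the closed set X, no w of X is near z and the claim is vacuous. Gluing
  can thus treat all positions of z alike.\<close>

lemma lifts_near_closed:
  assumes "closed X" "lifts h X G"
  shows "\<exists>d>0. \<forall>w\<in>X. dist w z < d \<longrightarrow> z \<in> X \<and> compatible h G z w"
proof (cases "z \<in> X")
  case True
  with assms(2) show ?thesis unfolding lifts_def by blast
next
  case False
  then obtain d where "d > 0" "ball z d \<subseteq> - X"
    using openE[of "- X" z] assms(1) by (auto simp: open_Compl)
  then have "\<forall>w\<in>X. \<not> dist w z < d" by (auto simp: dist_commute subset_iff)
  with \<open>d > 0\<close> show ?thesis by blast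
qed

text \<open>On the connected overlap the two lifts differ by a constant \<open>\<kappa>\<close>;
  adding it to the second one makes them agree.\<close>

lemma lifts_glue:
  assumes "closed X" "closed Y" "connected (X \<inter> Y)" "lifts h X G" "lifts h Y G'"
  shows "\<exists>H. lifts h (X \<union> Y) H"
proof -
  obtain \<kappa> where \<kappa>: "\<And>z. z \<in> X \<inter> Y \<Longrightarrow> G z = G' z + \<kappa>"
  proof (cases "X \<inter> Y = {}")
    case False
    then obtain z0 where z0: "z0 \<in> X \<inter> Y" by blast
    have "G z = G' z + (G z0 - G' z0)" if "z \<in> X \<inter> Y" for z
      using lifts_unique[OF assms(3) lifts_subset[OF assms(4)] lifts_subset[OF assms(5)] z0 that] by simp
    with that show ?thesis by blast
  qed (use that in blast)
  define H where "H z = (if z \<in> X then G z else G' z + \<kappa>)" for z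
  have HX: "H z = G z" if "z \<in> X" for z using that by (simp add: H_def)
  have HY: "H z = G' z + \<kappa>" if "z \<in> Y" for z using that \<kappa> by (simp add: H_def)
  have "lifts h (X \<union> Y) H"
  proof (unfold lifts_def, rule ballI)
    fix z
    from lifts_near_closed[OF assms(1,4), of z] obtain d where d: "d > 0"
      "\<And>w. w \<in> X \<Longrightarrow> dist w z < d \<Longrightarrow> z \<in> X \<and> compatible h G z w"
      by blast
    from lifts_near_closed[OF assms(2,5), of z] obtain d' where d': "d' > 0"
      "\<And>w. w \<in> Y \<Longrightarrow> dist w z < d' \<Longrightarrow> z \<in> Y \<and> compatible h G' z w"
      by blast
    have "compatible h H z w"
      if "w \<in> X \<union> Y" "dist w z < min d d'" for w
      using that(1)
    proof
      assume "w \<in> X"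
      with d(2)[of w] HX that(2) show ?thesis by (simp add: compatible_def)
    next
      assume "w \<in> Y"
      with d'(2)[of w] HY that(2) show ?thesis by (simp add: compatible_def)
    qed
    then show "\<exists>d>0. \<forall>w\<in>X \<union> Y. dist w z < d \<longrightarrow> compatible h H z w"
      using d(1) d'(1) by (intro exI[of _ "min d d'"]) simp
  qed
  then show ?thesis by blast
qed

lemma lifts_compose:
  assumes "lifts h R G" "continuous_on R' c" "c ` R' \<subseteq> R"
  shows "lifts (h \<circ> c) R' (G \<circ> c)"
proof (unfold lifts_def, rule ballI)
  fix z assume z: "z \<in> R'"
  then have "c z \<in> R" using assms(3) by blast
  with assms(1) obtain d where d: "d > 0" "\<And>w. w \<in> R \<Longrightarrow> dist w (c z) < d \<Longrightarrow> compatible h G (c z) w"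
    unfolding lifts_def by blast
  from assms(2) z d(1) obtain e where "e > 0" "\<And>w. w \<in> R' \<Longrightarrow> dist w z < e \<Longrightarrow> dist (c w) (c z) < d"
    unfolding continuous_on_iff by blast
  with d assms(3) show "\<exists>d>0. \<forall>w\<in>R'. dist w z < d \<longrightarrow> compatible (h \<circ> c) (G \<circ> c) z w"
    by (intro exI[of _ e]) (simp add: image_subset_iff compatible_def)
qed

text \<open>Bisection in place of a Lebesgue number: for fixed s0, bisecting in t gives a strip of
  positive width around s0 that admits a lift; bisecting in s then joins the strips.\<close>

lemma lifts_square:
  fixes h :: "real \<times> real \<Rightarrow> 'a"
  assumes "continuous_on ({0..1} \<times> {0..1}) h" "h ` ({0..1} \<times> {0..1}) \<subseteq> D"
  shows "\<exists>G. lifts h ({0..1} \<times> {0..1}) G"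
proof -
  let ?S = "{0..1} \<times> {0..1} :: (real \<times> real) set"
  \<comment> \<open>Cut down to the square, because the small intervals around a point that
    \<open>Bolzano\<close> offers may reach beyond [0,1].\<close>
  define B where "B s s' t t' = ?S \<inter> ({s..s'} \<times> {t..t'})" for s s' t t' :: real
  define L where "L X = (\<exists>G. lifts h X G)" for X
  have B: "closed (B s s' t t')" "convex (B s s' t t')" for s s' t t'
    unfolding B_def by (auto intro!: closed_Int closed_Times convex_Int convex_Times)
  have glue: "L (X \<union> Y)" if "L X" "L Y" "closed X" "closed Y" "connected (X \<inter> Y)" for X Y
    using that lifts_glue unfolding L_def by meson
  have strip: "\<exists>\<delta>>0. \<forall>s s'. s \<le> s0 \<and> s0 \<le> s' \<and> s' - s < \<delta> \<longrightarrow> L (B s s' 0 1)" if s0: "0 \<le> s0" "s0 \<le> 1" for s0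
  proof -
    have "(0::real) \<le> 1" by simp
    then show ?thesis
    proof (rule Bolzano[where P="\<lambda>t t'. \<exists>\<delta>>0. \<forall>s s'. s \<le> s0 \<and> s0 \<le> s' \<and> s' - s < \<delta> \<longrightarrow> L (B s s' t t')"])
      fix t t' t'' :: real
      assume 1: "\<exists>\<delta>>0. \<forall>s s'. s \<le> s0 \<and> s0 \<le> s' \<and> s' - s < \<delta> \<longrightarrow> L (B s s' t t')"
        and 2: "\<exists>\<delta>>0. \<forall>s s'. s \<le> s0 \<and> s0 \<le> s' \<and> s' - s < \<delta> \<longrightarrow> L (B s s' t' t'')"
        and le: "t \<le> t'" "t' \<le> t''"
      from 1 obtain d where d: "d > 0" "\<And>s s'. s \<le> s0 \<Longrightarrow> s0 \<le> s' \<Longrightarrow> s' - s < d \<Longrightarrow> L (B s s' t t')" by blast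
      from 2 obtain d' where d': "d' > 0" "\<And>s s'. s \<le> s0 \<Longrightarrow> s0 \<le> s' \<Longrightarrow> s' - s < d' \<Longrightarrow> L (B s s' t' t'')" by blast
      have "L (B s s' t t'')" if "s \<le> s0" "s0 \<le> s'" "s' - s < min d d'" for s s'
      proof -
        have "B s s' t t'' = B s s' t t' \<union> B s s' t' t''" using le by (auto simp: B_def)
        moreover have "connected (B s s' t t' \<inter> B s s' t' t'')"
          by (intro convex_connected convex_Int B)
        ultimately show ?thesis using glue[OF d(2) d'(2) B(1) B(1)] that by simp
      qed
      with d(1) d'(1) show "\<exists>\<delta>>0. \<forall>s s'. s \<le> s0 \<and> s0 \<le> s' \<and> s' - s < \<delta> \<longrightarrow> L (B s s' t t'')"
        by (intro exI[of _ "min d d'"]) simp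
    next
      fix t0 :: real assume t0: "0 \<le> t0" "t0 \<le> 1"
      have S: "(s0,t0) \<in> ?S" using s0 t0 by simp
      then have hD: "h (s0,t0) \<in> D" using assms(2) by blast
      from assms(1) S radius_pos[OF hD] obtain d where d: "d > 0"
        "\<And>w. w \<in> ?S \<Longrightarrow> dist w (s0,t0) < d \<Longrightarrow> dist (h w) (h (s0,t0)) < \<rho> (h (s0,t0))"
        unfolding continuous_on_iff by blast
      have "L (B s s' t t')" if "s \<le> s0" "s0 \<le> s'" "s' - s < d/2" "t \<le> t0" "t0 \<le> t'" "t' - t < d/2" for s s' t t'
      proof -
        have "h ` B s s' t t' \<subseteq> ball (h (s0,t0)) (\<rho> (h (s0,t0)))"
        proof
          fix y assume "y \<in> h ` B s s' t t'"
          then obtain u v where uv: "(u,v) \<in> ?S" "s \<le> u" "u \<le> s'" "t \<le> v" "v \<le> t'" "y = h (u,v)"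
            unfolding B_def by auto
          have "dist (u,v) (s0,t0) \<le> \<bar>u - s0\<bar> + \<bar>v - t0\<bar>"
            unfolding dist_Pair_Pair dist_real_def using sqrt_sum_squares_le_sum_abs by simp
          also have "\<dots> < d" using uv that by linarith
          finally show "y \<in> ball (h (s0,t0)) (\<rho> (h (s0,t0)))"
            using d(2)[OF uv(1)] uv(6) by (simp add: dist_commute)
        qed
        moreover have "continuous_on (B s s' t t') h"
          by (rule continuous_on_subset[OF assms(1)]) (simp add: B_def)
        ultimately show ?thesis using lifts_small[OF hD] unfolding L_def by blast
      qed
      with d(1) show "\<exists>d>0. \<forall>t t'. t \<le> t0 \<and> t0 \<le> t' \<and> t' - t < d \<longrightarrow>
          (\<exists>\<delta>>0. \<forall>s s'. s \<le> s0 \<and> s0 \<le> s' \<and> s' - s < \<delta> \<longrightarrow> L (B s s' t t'))"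
        by (meson half_gt_zero)
    qed
  qed
  have "(0::real) \<le> 1" by simp
  then have "L (B 0 1 0 1)"
  proof (rule Bolzano[where P="\<lambda>s s'. L (B s s' 0 1)"])
    fix s s' s'' :: real
    assume L: "L (B s s' 0 1)" "L (B s' s'' 0 1)" and le: "s \<le> s'" "s' \<le> s''"
    have "B s s'' 0 1 = B s s' 0 1 \<union> B s' s'' 0 1" using le by (auto simp: B_def)
    moreover have "connected (B s s' 0 1 \<inter> B s' s'' 0 1)" by (intro convex_connected convex_Int B)
    ultimately show "L (B s s'' 0 1)" using glue[OF L B(1) B(1)] by simp
  qed (rule strip)
  then show ?thesis by (simp add: L_def B_def)
qed

definition path_value :: "(real \<Rightarrow> 'a) \<Rightarrow> real \<Rightarrow> bool" where
  "path_value p v \<longleftrightarrow> (\<exists>G. lifts p {0..1} G \<and> v = G 1 - G 0)"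

lemma path_lifts:
  assumes "path p" "path_image p \<subseteq> D"
  shows "\<exists>G. lifts p {0..1} G"
proof -
  \<comment> \<open>The path is viewed as a square that is constant in its first variable, so
    \<open>lifts_square\<close> covers it.\<close>
  have "continuous_on ({0..1} \<times> {0..1}) (p \<circ> snd :: real \<times> real \<Rightarrow> 'a)"
    using assms(1) unfolding path_def
    by (intro continuous_on_compose continuous_on_snd continuous_on_id) (auto elim: continuous_on_subset)
  moreover have "(p \<circ> snd) ` ({0..1::real} \<times> {0..1}) \<subseteq> D" using assms(2) unfolding path_image_def by auto
  ultimately obtain G where "lifts (p \<circ> snd) ({0..1::real} \<times> {0..1}) G"
    using lifts_square by blast
  then have "lifts (p \<circ> snd \<circ> Pair (0::real)) {0..1} (G \<circ> Pair (0::real))"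
    by (rule lifts_compose) (auto intro!: continuous_intros)
  then show ?thesis by (auto simp: comp_def)
qed

text \<open>The lift of the whole homotopy restricts to lifts of both paths. It cannot change along
  the two sides where the endpoints stay fixed, so both increments agree.\<close>

lemma path_value_homotopic:
  assumes "homotopic_paths D p q" "path_value p v" "path_value q w"
  shows "v = w"
proof -
  from assms(1) obtain h where "continuous_on ({0..1} \<times> {0..1}) h" "h \<in> {0..1} \<times> {0..1} \<rightarrow> D"
    "\<forall>x\<in>{0..1}. h (0,x) = p x" "\<forall>x\<in>{0..1}. h (1,x) = q x"
    "\<forall>t\<in>{0..1::real}. h (t,0) = p 0 \<and> h (t,1) = p 1"
    unfolding homotopic_paths by (auto simp: pathstart_def pathfinish_def)
  then have h: "continuous_on ({0..1} \<times> {0..1}) h" "h ` ({0..1} \<times> {0..1}) \<subseteq> D"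
    "\<And>x. x \<in> {0..1} \<Longrightarrow> h (0,x) = p x" "\<And>x. x \<in> {0..1} \<Longrightarrow> h (1,x) = q x"
    "\<And>t. t \<in> {0..1::real} \<Longrightarrow> h (t,0) = p 0" "\<And>t. t \<in> {0..1::real} \<Longrightarrow> h (t,1) = p 1"
    by auto
  obtain G where G: "lifts h ({0..1} \<times> {0..1}) G" using lifts_square[OF h(1,2)] by blast
  have 0: "lifts (h \<circ> Pair 0) {0..1} (G \<circ> Pair 0)" "lifts (h \<circ> Pair 1) {0..1} (G \<circ> Pair 1)"
    by (rule lifts_compose[OF G]; auto intro!: continuous_intros)+
  have "lifts p {0..1} (G \<circ> Pair 0)" by (rule lifts_cong[OF 0(1)]) (simp add: h(3))
  moreover have "lifts q {0..1} (G \<circ> Pair 1)" by (rule lifts_cong[OF 0(2)]) (simp add: h(4))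
  \<comment> \<open>The homotopy is constant on this side, where zero is another lift; uniqueness
    forces G to be constant as well.\<close>
  moreover have "G (1,c) = G (0,c)" if c: "c \<in> {0,1}" for c
  proof -
    have "lifts (h \<circ> (\<lambda>s. (s,c))) {0..1} (G \<circ> (\<lambda>s. (s,c)))"
      by (rule lifts_compose[OF G]) (use c in \<open>auto intro!: continuous_intros\<close>)
    then have 1: "lifts (\<lambda>_. p c) {0..1::real} (G \<circ> (\<lambda>s. (s,c)))"
      by (rule lifts_cong) (use h(5,6) c in auto)
    have "(0::real,c) \<in> {0..1} \<times> {0..1}" "c \<in> {0..1}" using c by auto
    then have "p c \<in> D" using h(2) h(3)[of c] by (metis image_subset_iff)
    then have 2: "lifts (\<lambda>_. p c) {0..1::real} (\<lambda>_. 0)"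
      using radius_pos[of "p c"] by (simp add: lifts_def compatible_def) (auto intro: exI[of _ 1])
    show ?thesis using lifts_unique[OF _ 1 2, of 0 1] by simp
  qed
  moreover from assms(2) obtain Gp where "lifts p {0..1} Gp" "v = Gp 1 - Gp 0" unfolding path_value_def by blast
  moreover from assms(3) obtain Gq where "lifts q {0..1} Gq" "w = Gq 1 - Gq 0" unfolding path_value_def by blast
  ultimately show ?thesis
    using lifts_unique[of "{0..1}" p Gp "G \<circ> Pair 0" 0 1] lifts_unique[of "{0..1}" q Gq "G \<circ> Pair 1" 0 1] by simp
qed

text \<open>This determines the increments of the global primitive near x: they are those of the
  local primitive \<open>P x\<close>. A lift of the joined path is read off on its two
  halves.\<close>

lemma path_value_join_segment:
  assumes "path p" "path_image p \<subseteq> D" "path_value p v" "pathfinish p = x" "y \<in> ball x (\<rho> x)"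
  shows "path_value (p +++ linepath x y) (v + (P x y - P x x))"
proof -
  let ?r = "p +++ linepath x y"
  have x: "x \<in> D" using assms(2,4) pathfinish_in_path_image[of p] by blast
  have seg: "path_image (linepath x y) \<subseteq> ball x (\<rho> x)"
    using assms(5) radius_pos[OF x] by (simp add: closed_segment_subset)
  have "path ?r" "path_image ?r \<subseteq> D"
    using assms seg ball_subset[OF x] by (auto simp: path_image_join)
  then obtain K where K: "lifts ?r {0..1} K" using path_lifts by blast
  have "lifts (?r \<circ> (\<lambda>t. t / 2)) {0..1} (K \<circ> (\<lambda>t. t / 2))"
    by (rule lifts_compose[OF K]) (auto intro!: continuous_intros)
  then have 1: "lifts p {0..1} (K \<circ> (\<lambda>t. t / 2))"
    by (rule lifts_cong) (simp add: joinpaths_def)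
  have "lifts (?r \<circ> (\<lambda>t. 1 / 2 + t / 2)) {0..1} (K \<circ> (\<lambda>t. 1 / 2 + t / 2))"
    by (rule lifts_compose[OF K]) (auto intro!: continuous_intros)
  then have 2: "lifts (linepath x y) {0..1} (K \<circ> (\<lambda>t. 1 / 2 + t / 2))"
  proof (rule lifts_cong)
    fix t :: real assume "t \<in> {0..1}"
    then show "(?r \<circ> (\<lambda>t. 1 / 2 + t / 2)) t = linepath x y t"
      \<comment> \<open>At t = 0 the parameter 1/2 still belongs to the first branch of
        \<open>+++\<close>, so the end point of p enters.\<close>
      using assms(4) by (cases "t = 0") (auto simp: joinpaths_def pathfinish_def linepath_def)
  qed
  have 3: "lifts (linepath x y) {0..1} (P x \<circ> linepath x y)"
    by (rule lifts_small[OF x]) (use seg in \<open>auto simp: path_image_def continuous_on_linepath\<close>)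
  from assms(3) obtain G where "lifts p {0..1} G" "v = G 1 - G 0" unfolding path_value_def by blast
  then have "v = K (1/2) - K 0" using lifts_unique[OF _ 1, of G 0 1] by simp
  moreover have "K 1 - K (1/2) = P x y - P x x"
    using lifts_unique[OF _ 2 3, of 0 1] by (simp add: linepath_def)
  ultimately have "v + (P x y - P x x) = K 1 - K 0" by simp
  with K show ?thesis unfolding path_value_def by blast
qed

text \<open>The value at x is the integral along an arbitrarily chosen path from x0; homotopy
  invariance makes the choices fit together.\<close>

lemma global_primitive:
  assumes "simply_connected D"
  obtains \<phi> where "\<And>x. x \<in> D \<Longrightarrow> (\<phi> has_derivative a x) (at x)"
proof (cases "D = {}")
  case False
  then obtain x0 where x0: "x0 \<in> D" by blast
  have "path_connected D" and homotopic: "\<And>p q. path p \<Longrightarrow> path_image p \<subseteq> D \<Longrightarrow> path q \<Longrightarrow> path_image q \<subseteq> D \<Longrightarrow>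
      pathstart q = pathstart p \<Longrightarrow> pathfinish q = pathfinish p \<Longrightarrow> homotopic_paths D p q"
    using assms unfolding simply_connected_eq_homotopic_paths by blast+
  have "\<forall>x\<in>D. \<exists>\<phi>. \<exists>p. path p \<and> path_image p \<subseteq> D \<and> pathstart p = x0 \<and> pathfinish p = x \<and> path_value p \<phi>"
  proof
    fix x assume "x \<in> D"
    with \<open>path_connected D\<close> x0 obtain p where "path p" "path_image p \<subseteq> D" "pathstart p = x0" "pathfinish p = x"
      unfolding path_connected_def by blast
    with path_lifts show "\<exists>\<phi>. \<exists>p. path p \<and> path_image p \<subseteq> D \<and> pathstart p = x0 \<and> pathfinish p = x \<and> path_value p \<phi>"
      unfolding path_value_def by blast
  qed
  from bchoice[OF this] obtain \<phi> where \<phi>: "\<And>x. x \<in> D \<Longrightarrow>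
    \<exists>p. path p \<and> path_image p \<subseteq> D \<and> pathstart p = x0 \<and> pathfinish p = x \<and> path_value p (\<phi> x)" by blast
  have "(\<phi> has_derivative a x) (at x)" if x: "x \<in> D" for x
  proof -
    from \<phi>[OF x] obtain p where p: "path p" "path_image p \<subseteq> D" "pathstart p = x0" "pathfinish p = x" "path_value p (\<phi> x)"
      by blast
    have "\<phi> x + (P x y - P x x) = \<phi> y" if y: "y \<in> ball x (\<rho> x)" for y
    proof -
      have "y \<in> D" using y ball_subset[OF x] by blast
      from \<phi>[OF this] obtain q where q: "path q" "path_image q \<subseteq> D" "pathstart q = x0" "pathfinish q = y" "path_value q (\<phi> y)"
        by blast
      let ?r = "p +++ linepath x y"
      have "path_image (linepath x y) \<subseteq> ball x (\<rho> x)"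
        using y radius_pos[OF x] by (simp add: closed_segment_subset)
      then have "path ?r" "path_image ?r \<subseteq> D"
        using p ball_subset[OF x] by (auto simp: path_image_join)
      \<comment> \<open>The path chosen for y need not pass through x, but simple connectivity
        deforms it into the path to x followed by the segment.\<close>
      then have "homotopic_paths D ?r q" using p q by (intro homotopic) auto
      then show ?thesis
        using path_value_homotopic path_value_join_segment[OF p(1,2,5,4) y] q(5) by blast
    qed
    moreover have "((\<lambda>y. \<phi> x + (P x y - P x x)) has_derivative a x) (at x)"
      using primitive[OF x, of x] radius_pos[OF x] by (auto intro!: derivative_eq_intros)
    ultimately show ?thesis
      using has_derivative_transform_within_open[of "\<lambda>y. \<phi> x + (P x y - P x x)" "a x" x UNIV "ball x (\<rho> x)" \<phi>]
        radius_pos[OF x] by simp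
  qed
  with that show ?thesis by blast
qed (use that in blast)

end

text \<open>Poincare lemma on a ball: P x is the integral of v . (x - c) along the radius. By
  Leibniz its gradient is the integral of \<open>w x t\<close>, which telescopes to v x.\<close>

lemma gradient_primitive_ball:
  fixes v :: "'a::euclidean_space \<Rightarrow> 'a"
  assumes "ball c r \<subseteq> U" "r > 0"
    and v: "\<And>x. x \<in> U \<Longrightarrow> (v has_derivative v' x) (at x)"
    and sym: "\<And>x s t. x \<in> U \<Longrightarrow> v' x s \<bullet> t = v' x t \<bullet> s"
    and cont: "\<And>b. b \<in> Basis \<Longrightarrow> continuous_on U (\<lambda>x. v' x b)"
  shows "\<exists>P. \<forall>x\<in>ball c r. (P has_derivative (\<lambda>h. v x \<bullet> h)) (at x)"
proof -
  let ?B = "ball c r"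
  define seg where "seg x t = c + t *\<^sub>R (x - c)" for x and t :: real
  have seg_in: "seg x t \<in> ?B" if "x \<in> ?B" "t \<in> {0..1}" for x t
  proof -
    have "norm (t *\<^sub>R (x - c)) \<le> norm (x - c)" using that by (simp add: mult_left_le_one_le)
    then show ?thesis using that by (simp add: seg_def dist_norm norm_minus_commute)
  qed
  have seg_U: "seg x t \<in> U" if "x \<in> ?B" "t \<in> {0..1}" for x t using seg_in[OF that] assms(1) by blast
  have lin: "linear (v' x)" if "x \<in> U" for x using v[OF that] by (rule has_derivative_linear)
  have contv: "continuous_on U v"
    using v by (intro continuous_at_imp_continuous_on ballI) (rule has_derivative_continuous)
  \<comment> \<open>It has two roles: by symmetry of \<open>v'\<close> it is the x-gradient of the
    integrand, and it is the t-derivative of t v(seg x t).\<close>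
  define w where "w x t = v (seg x t) + t *\<^sub>R v' (seg x t) (x - c)" for x t
  \<comment> \<open>Continuity is given for fixed basis directions only, whereas \<open>w\<close>
    applies \<open>v'\<close> in the varying direction x - c.\<close>
  have expand: "v' y h = (\<Sum>b\<in>Basis. (h \<bullet> b) *\<^sub>R v' y b)" if "y \<in> U" for y h
  proof -
    interpret linear "v' y" using lin[OF that] .
    have "v' y h = v' y (\<Sum>b\<in>Basis. (h \<bullet> b) *\<^sub>R b)" by (simp add: euclidean_representation)
    then show ?thesis by (simp add: sum scale)
  qed
  have cont_seg: "continuous_on (?B \<times> {0..1}) (\<lambda>z. g (seg (fst z) (snd z)))" if "continuous_on U g" for g :: "'a \<Rightarrow> 'a"
    by (rule continuous_on_compose2[OF that]) (auto simp: seg_def[abs_def] intro!: continuous_intros seg_U[unfolded seg_def])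
  have cont_w: "continuous_on (?B \<times> {0..1}) (\<lambda>z. w (fst z) (snd z))"
  proof -
    have "continuous_on (?B \<times> {0..1}) (\<lambda>z. v (seg (fst z) (snd z)) +
        snd z *\<^sub>R (\<Sum>b\<in>Basis. ((fst z - c) \<bullet> b) *\<^sub>R v' (seg (fst z) (snd z)) b))"
      by (intro continuous_intros cont_seg contv cont)
    then show ?thesis
      by (rule continuous_on_eq) (auto simp: w_def expand[OF seg_U])
  qed
  have deriv: "((\<lambda>x. v (seg x t) \<bullet> (x - c)) has_derivative blinfun_inner_right (w x t)) (at x within ?B)"
    if x: "x \<in> ?B" and t: "t \<in> cbox 0 1" for x and t :: real
  proof -
    have tI: "t \<in> {0..1}" using t by simp
    note U = seg_U[OF x tI]
    have "((\<lambda>x. seg x t) has_derivative (\<lambda>h. t *\<^sub>R h)) (at x)"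
      unfolding seg_def by (auto intro!: derivative_eq_intros)
    from has_derivative_compose[OF this v[OF U]]
    have "((\<lambda>x. v (seg x t)) has_derivative (\<lambda>h. v' (seg x t) (t *\<^sub>R h))) (at x)" .
    from has_derivative_inner[OF this has_derivative_diff[OF has_derivative_ident has_derivative_const[of c]]]
    have "((\<lambda>x. v (seg x t) \<bullet> (x - c)) has_derivative
        (\<lambda>h. v (seg x t) \<bullet> (h - 0) + v' (seg x t) (t *\<^sub>R h) \<bullet> (x - c))) (at x)" .
    moreover have "v' (seg x t) (t *\<^sub>R h) \<bullet> (x - c) = t *\<^sub>R v' (seg x t) (x - c) \<bullet> h" for h
      using sym[OF U, of h "x - c"] linear_scale[OF lin[OF U], of t h] by simp
    ultimately have "((\<lambda>x. v (seg x t) \<bullet> (x - c)) has_derivative (\<lambda>h. w x t \<bullet> h)) (at x)"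
      by (simp add: w_def inner_add_left)
    then show ?thesis
      by (simp add: blinfun_inner_right.rep_eq has_derivative_at_withinI)
  qed
  have int_w: "(w x has_integral v x) {0..1}" if x: "x \<in> ?B" for x
  proof -
    have "((\<lambda>t. t *\<^sub>R v (seg x t)) has_vector_derivative w x t) (at t within {0..1})" if t: "t \<in> {0..1}" for t
    proof -
      note U = seg_U[OF x t]
      have "((\<lambda>t. seg x t) has_derivative (\<lambda>h. h *\<^sub>R (x - c))) (at t)"
        unfolding seg_def by (auto intro!: derivative_eq_intros)
      from has_derivative_compose[OF this v[OF U]]
      have "((\<lambda>t. v (seg x t)) has_derivative (\<lambda>h. v' (seg x t) (h *\<^sub>R (x - c)))) (at t)" .
      from has_derivative_scaleR[OF has_derivative_ident this]
      have "((\<lambda>t. t *\<^sub>R v (seg x t)) has_derivative (\<lambda>h. t *\<^sub>R v' (seg x t) (h *\<^sub>R (x - c)) + h *\<^sub>R v (seg x t))) (at t)" .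
      then show ?thesis
        using linear_scale[OF lin[OF U]] unfolding has_vector_derivative_def
        by (simp add: w_def scaleR_add_right add.commute mult.commute has_derivative_at_withinI)
    qed
    from fundamental_theorem_of_calculus[OF _ this]
    show ?thesis by (simp add: seg_def)
  qed
  have "((\<lambda>x. integral (cbox 0 1) (\<lambda>t. v (seg x t) \<bullet> (x - c))) has_derivative (\<lambda>h. v x \<bullet> h)) (at x)"
    if x: "x \<in> ?B" for x
  proof -
    have "((\<lambda>x. integral (cbox 0 1) (\<lambda>t. v (seg x t) \<bullet> (x - c))) has_derivative
        blinfun_apply (integral (cbox 0 1) (\<lambda>t. blinfun_inner_right (w x t)))) (at x within ?B)"
    proof (rule leibniz_rule[OF deriv _ _ x convex_ball])
      fix y assume y: "y \<in> ?B"
      have "continuous_on {0..1} (\<lambda>t. v (seg y t))"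
        by (rule continuous_on_compose2[OF contv]) (auto simp: seg_def[abs_def] y intro!: continuous_intros seg_U[OF y, unfolded seg_def])
      then show "(\<lambda>t. v (seg y t) \<bullet> (y - c)) integrable_on cbox 0 1"
        by (intro integrable_continuous) (auto intro!: continuous_intros)
    next
      show "continuous_on (?B \<times> cbox 0 1) (\<lambda>(x, t). blinfun_inner_right (w x t))"
        using bounded_linear.continuous_on[OF bounded_linear_blinfun_inner_right cont_w] by (simp add: case_prod_unfold)
    qed
    moreover have "integral (cbox 0 1) (\<lambda>t. blinfun_inner_right (w x t)) = blinfun_inner_right (v x)"
      using has_integral_linear[OF int_w[OF x] bounded_linear_blinfun_inner_right]
      by (intro integral_unique) (simp add: comp_def)
    ultimately show ?thesis using at_within_open[OF x open_ball] by (simp add: blinfun_inner_right.rep_eq)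
  qed
  then show ?thesis by blast
qed

lemma closed_form_exact:
  fixes v :: "'a::euclidean_space \<Rightarrow> 'a"
  assumes "open U" "simply_connected U"
    and v: "\<And>x. x \<in> U \<Longrightarrow> (v has_derivative v' x) (at x)"
    and sym: "\<And>x s t. x \<in> U \<Longrightarrow> v' x s \<bullet> t = v' x t \<bullet> s"
    and cont: "\<And>b. b \<in> Basis \<Longrightarrow> continuous_on U (\<lambda>x. v' x b)"
  obtains \<phi> where "\<And>x. x \<in> U \<Longrightarrow> (\<phi> has_derivative (\<lambda>h. v x \<bullet> h)) (at x)"
proof -
  have "\<forall>c\<in>U. \<exists>q. snd q > 0 \<and> ball c (snd q) \<subseteq> U \<and> (\<forall>x\<in>ball c (snd q). (fst q has_derivative (\<lambda>h. v x \<bullet> h)) (at x))"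
  proof
    fix c assume "c \<in> U"
    from openE[OF assms(1) this] obtain r where r: "r > 0" "ball c r \<subseteq> U" .
    obtain P where "\<forall>x\<in>ball c r. (P has_derivative (\<lambda>h. v x \<bullet> h)) (at x)"
      using gradient_primitive_ball[OF r(2,1) v sym cont] by blast
    with r show "\<exists>q. snd q > 0 \<and> ball c (snd q) \<subseteq> U \<and> (\<forall>x\<in>ball c (snd q). (fst q has_derivative (\<lambda>h. v x \<bullet> h)) (at x))"
      by (intro exI[of _ "(P, r)"]) simp
  qed
  from bchoice[OF this] obtain q where q: "\<forall>c\<in>U. snd (q c) > 0 \<and> ball c (snd (q c)) \<subseteq> U \<and>
    (\<forall>x\<in>ball c (snd (q c)). (fst (q c) has_derivative (\<lambda>h. v x \<bullet> h)) (at x))" by blast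
  interpret local_primitives U "\<lambda>c. fst (q c)" "\<lambda>c. snd (q c)" "\<lambda>x h. v x \<bullet> h"
    by unfold_locales (use q in blast)+
  from global_primitive[OF assms(2)] that show ?thesis by blast
qed

text \<open>For the vector field v with components p, equality of the cross derivatives is symmetry
  of the derivative of v. Subtracting the value at x0 normalises the potential.\<close>

lemma exists_potential:
  fixes p :: "nat \<Rightarrow> real^'n::{finite,linorder} \<Rightarrow> real"
  assumes "open U" "simply_connected U" "x0 \<in> U"
    and smooth: "\<And>j. j < CARD('n) \<Longrightarrow> smooth_on U (p j)"
    and closed: "\<And>x i j. x \<in> U \<Longrightarrow> i < CARD('n) \<Longrightarrow> j < CARD('n) \<Longrightarrow> pd i (p j) x = pd j (p i) x"
  shows "\<exists>\<phi>. smooth_on U \<phi> \<and> \<phi> x0 = 0 \<and> (\<forall>x\<in>U. \<forall>j<CARD('n). pd j \<phi> x = p j x)"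
proof -
  let ?n = "CARD('n)"
  define v where "v x = (\<Sum>j<?n. p j x *\<^sub>R (axis (ix j) 1 :: (real,'n) vec))" for x
  have v_smooth: "smooth_on U v"
    unfolding v_def using assms(1) smooth by (intro smooth_on_sum smooth_on_scaleR smooth_on_const) auto
  define v' where "v' x h = (\<Sum>i<?n. (h $ ix i) *\<^sub>R pd i v x)" for x and h :: "(real,'n) vec"
  have v': "(v has_derivative v' x) (at x)" if "x \<in> U" for x
    unfolding v'_def using has_derivative_pd[OF assms(1) v_smooth that] .
  have pdv: "pd i v x = (\<Sum>j<?n. pd i (p j) x *\<^sub>R (axis (ix j) 1 :: (real,'n) vec))" if x: "x \<in> U" for i x
  proof -
    have "pd i v x = (\<Sum>j<?n. pd i (\<lambda>x. p j x *\<^sub>R (axis (ix j) 1 :: (real,'n) vec)) x)"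
      unfolding v_def using assms(1) smooth x by (intro pd_sum smooth_on_scaleR smooth_on_const) auto
    also have "\<dots> = (\<Sum>j<?n. pd i (p j) x *\<^sub>R (axis (ix j) 1 :: (real,'n) vec))"
      using assms(1) smooth x by (intro sum.cong refl) (simp add: pd_scaleR)
    finally show ?thesis .
  qed
  have inner_axis: "(\<Sum>j<?n. c j *\<^sub>R (axis (ix j) 1 :: (real,'n) vec)) \<bullet> t = (\<Sum>j<?n. c j * t $ ix j)" for c and t :: "(real,'n) vec"
    by (simp add: inner_sum_left inner_axis')
  have sym: "v' x s \<bullet> t = v' x t \<bullet> s" if x: "x \<in> U" for x s t
  proof -
    have eq: "v' x s \<bullet> t = (\<Sum>i<?n. \<Sum>j<?n. s $ ix i * t $ ix j * pd i (p j) x)" for s t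
      by (simp add: v'_def inner_sum_left pdv[OF x] inner_axis' sum_distrib_left mult_ac)
    show ?thesis
      unfolding eq by (subst sum.swap) (use closed[OF x] in \<open>auto intro!: sum.cong simp: mult_ac\<close>)
  qed
  have cont: "continuous_on U (\<lambda>x. v' x b)" for b
    unfolding v'_def
    by (intro continuous_intros smooth_on_imp_continuous_on smooth_on_pd assms(1) v_smooth)
  obtain \<phi> where \<phi>: "\<And>x. x \<in> U \<Longrightarrow> (\<phi> has_derivative (\<lambda>h. v x \<bullet> h)) (at x)"
    using closed_form_exact[OF assms(1,2) v' sym cont] by blast
  define \<psi> where "\<psi> x = \<phi> x - \<phi> x0" for x
  have \<psi>: "(\<psi> has_derivative (\<lambda>h. \<Sum>j<?n. h $ ix j *\<^sub>R p j x)) (at x)" if "x \<in> U" for x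
  proof -
    have "((\<lambda>x. \<phi> x - \<phi> x0) has_derivative (\<lambda>h. v x \<bullet> h - 0)) (at x)"
      by (intro has_derivative_diff \<phi> that has_derivative_const)
    moreover have "v x \<bullet> h - 0 = (\<Sum>j<?n. h $ ix j *\<^sub>R p j x)" for h
      by (simp add: v_def inner_axis mult.commute)
    ultimately show ?thesis by (simp add: \<psi>_def[abs_def])
  qed
  have "smooth_on U \<psi>" by (rule smooth_on_pdI[OF assms(1) \<psi> smooth])
  moreover have "pd j \<psi> x = p j x" if "x \<in> U" "j < ?n" for x j
  proof -
    have "pd j \<psi> x = (\<Sum>i<?n. if i = j then p i x else 0)"
      unfolding pd_eq[OF \<psi>[OF that(1)]] using that(2) by (intro sum.cong refl) (simp add: axis_def ix_eq_iff)
    then show ?thesis using that(2) by simp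
  qed
  ultimately show ?thesis by (intro exI[of _ \<psi>]) (simp add: \<psi>_def)
qed

section \<open>The equation dX = l X \<alpha> with commuting coefficients\<close>

text \<open>The majorant M bounds the operators \<open>f' n x\<close> uniformly on S, so the tails
  of the differentiated series are uniformly small there.\<close>

lemma has_derivative_suminf:
  fixes f :: "nat \<Rightarrow> 'a::real_normed_vector \<Rightarrow> 'b::banach"
  assumes "convex S" "open S"
    and f': "\<And>n x. x \<in> S \<Longrightarrow> (f n has_derivative f' n x) (at x)"
    and M: "\<And>n x h. x \<in> S \<Longrightarrow> norm (f' n x h) \<le> M n * norm h" "summable M"
    and f: "\<And>x. x \<in> S \<Longrightarrow> summable (\<lambda>n. f n x)"
    and x: "x \<in> S"
  shows "((\<lambda>x. \<Sum>n. f n x) has_derivative (\<lambda>h. \<Sum>n. f' n x h)) (at x)"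
proof -
  have sf': "summable (\<lambda>n. f' n x h)" if "x \<in> S" for x h
    by (rule summable_comparison_test'[OF summable_mult2[OF M(2)]]) (rule M(1)[OF that])
  have "\<exists>g. \<forall>x\<in>S. (\<lambda>n. f n x) sums (g x) \<and> (g has_derivative (\<lambda>h. \<Sum>n. f' n x h)) (at x within S)"
  proof (rule has_derivative_series[where f=f and f'=f' and g'="\<lambda>x h. \<Sum>n. f' n x h", OF assms(1) _ _ x summable_sums[OF f[OF x]]])
    fix e :: real assume e: "e > 0"
    from suminf_exist_split[OF e M(2)] obtain n0 where n0: "\<And>n. n \<ge> n0 \<Longrightarrow> norm (\<Sum>i. M (i + n)) < e" by blast
    have "norm (sum (\<lambda>i. f' i x h) {..<n} - (\<Sum>n. f' n x h)) \<le> e * norm h" if n: "n \<ge> n0" and x: "x \<in> S" for n x h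
    proof -
      have "norm (sum (\<lambda>i. f' i x h) {..<n} - (\<Sum>n. f' n x h)) = norm (\<Sum>i. f' (i + n) x h)"
        using suminf_split_initial_segment[OF sf'[OF x], of h n] by (simp add: norm_minus_commute)
      also have "\<dots> \<le> (\<Sum>i. M (i + n) * norm h)"
        by (rule norm_suminf_le) (rule M(1)[OF x], rule summable_mult2, simp add: summable_iff_shift M(2))
      also have "\<dots> = (\<Sum>i. M (i + n)) * norm h"
        by (rule suminf_mult2[symmetric]) (simp add: summable_iff_shift M(2))
      also have "\<dots> \<le> e * norm h" using n0[OF n] by (intro mult_right_mono) auto
      finally show ?thesis .
    qed
    then show "\<forall>\<^sub>F n in sequentially. \<forall>x\<in>S. \<forall>h. norm (sum (\<lambda>i. f' i x h) {..<n} - (\<Sum>n. f' n x h)) \<le> e * norm h"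
      unfolding eventually_sequentially by blast
  qed (use f' has_derivative_at_withinI in blast)
  then obtain g where g: "\<And>x. x \<in> S \<Longrightarrow> (\<lambda>n. f n x) sums (g x)"
    "\<And>x. x \<in> S \<Longrightarrow> (g has_derivative (\<lambda>h. \<Sum>n. f' n x h)) (at x within S)" by blast
  have "(g has_derivative (\<lambda>h. \<Sum>n. f' n x h)) (at x)" using g(2)[OF x] at_within_open[OF x assms(2)] by simp
  then show ?thesis
    by (rule has_derivative_transform_within_open[OF _ assms(2) x]) (use g(1) sums_unique in blast)
qed

text \<open>Commuting coefficients mean that the wedge of \<open>\<alpha>\<close> with itself
  vanishes. Together with closedness this is the integrability condition of dX = l X
  \<open>\<alpha>\<close> for every l, and it keeps all iterated integrals closed.\<close>

locale commuting_form =
  fixes D :: "(real^('n::{finite,linorder})) set" and N :: nat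
    and \<alpha> :: "nat \<Rightarrow> (real,'n) vec \<Rightarrow> nat \<Rightarrow> nat \<Rightarrow> real" and x0 :: "(real,'n) vec"
  assumes D: "open D" "simply_connected D" "x0 \<in> D"
    and \<alpha>_smooth: "j < CARD('n) \<Longrightarrow> a < N \<Longrightarrow> b < N \<Longrightarrow> smooth_on D (\<lambda>x. \<alpha> j x a b)"
    and \<alpha>_closed: "x \<in> D \<Longrightarrow> i < CARD('n) \<Longrightarrow> j < CARD('n) \<Longrightarrow> a < N \<Longrightarrow> b < N \<Longrightarrow>
      pd i (\<lambda>x. \<alpha> j x a b) x = pd j (\<lambda>x. \<alpha> i x a b) x"
    and \<alpha>_commute: "x \<in> D \<Longrightarrow> i < CARD('n) \<Longrightarrow> j < CARD('n) \<Longrightarrow> a < N \<Longrightarrow> b < N \<Longrightarrow>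
      (\<Sum>c<N. \<alpha> i x a c * \<alpha> j x c b) = (\<Sum>c<N. \<alpha> j x a c * \<alpha> i x c b)"
begin

lemma connected_D: "connected D"
  using D(2) simply_connected_imp_connected by blast

text \<open>The second clause says that the wedge of dX and \<open>\<alpha>\<close> vanishes, which
  for closed \<open>\<alpha>\<close> is closedness of X \<open>\<alpha>\<close>. It is the invariant
  of the iteration.\<close>

definition integrable_mat :: "((real,'n) vec \<Rightarrow> nat \<Rightarrow> nat \<Rightarrow> real) \<Rightarrow> bool" where
  "integrable_mat X \<longleftrightarrow> (\<forall>a<N. \<forall>b<N. smooth_on D (\<lambda>x. X x a b)) \<and>
    (\<forall>x\<in>D. \<forall>i<CARD('n). \<forall>j<CARD('n). \<forall>a<N. \<forall>b<N.
      (\<Sum>c<N. pd i (\<lambda>y. X y a c) x * \<alpha> j x c b) = (\<Sum>c<N. pd j (\<lambda>y. X y a c) x * \<alpha> i x c b))"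

definition integral_of :: "((real,'n) vec \<Rightarrow> nat \<Rightarrow> nat \<Rightarrow> real) \<Rightarrow> ((real,'n) vec \<Rightarrow> nat \<Rightarrow> nat \<Rightarrow> real) \<Rightarrow> bool" where
  "integral_of X Y \<longleftrightarrow> (\<forall>a<N. \<forall>b<N. Y x0 a b = 0 \<and>
    (\<forall>x\<in>D. \<forall>j<CARD('n). pd j (\<lambda>y. Y y a b) x = (\<Sum>c<N. X x a c * \<alpha> j x c b)))"

text \<open>The invariant makes X \<open>\<alpha>\<close> exact, which yields Y. It passes on to Y
  because the wedge of dY and \<open>\<alpha>\<close> is X times the wedge of
  \<open>\<alpha>\<close> with itself, hence zero.\<close>

lemma integrable_mat_step:
  assumes "integrable_mat X"
  shows "\<exists>Y. integrable_mat Y \<and> integral_of X Y"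
proof -
  have X: "\<And>a b. a < N \<Longrightarrow> b < N \<Longrightarrow> smooth_on D (\<lambda>x. X x a b)"
    "\<And>x i j a b. x \<in> D \<Longrightarrow> i < CARD('n) \<Longrightarrow> j < CARD('n) \<Longrightarrow> a < N \<Longrightarrow> b < N \<Longrightarrow>
      (\<Sum>c<N. pd i (\<lambda>y. X y a c) x * \<alpha> j x c b) = (\<Sum>c<N. pd j (\<lambda>y. X y a c) x * \<alpha> i x c b)"
    using assms unfolding integrable_mat_def by blast+
  have sm: "smooth_on D (\<lambda>x. \<Sum>c<N. X x a c * \<alpha> j x c b)" if "a < N" "b < N" "j < CARD('n)" for a b j
    using that D(1) by (intro smooth_on_sum smooth_on_mult X(1) \<alpha>_smooth) auto
  have pdX: "pd i (\<lambda>x. \<Sum>c<N. X x a c * \<alpha> j x c b) x =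
      (\<Sum>c<N. X x a c * pd i (\<lambda>x. \<alpha> j x c b) x) + (\<Sum>c<N. pd i (\<lambda>y. X y a c) x * \<alpha> j x c b)"
    if "x \<in> D" "a < N" "b < N" "j < CARD('n)" for x a b i j
  proof -
    have "pd i (\<lambda>x. \<Sum>c<N. X x a c * \<alpha> j x c b) x = (\<Sum>c<N. pd i (\<lambda>x. X x a c * \<alpha> j x c b) x)"
      using that D(1) by (intro pd_sum smooth_on_mult) (auto intro!: X(1) \<alpha>_smooth)
    also have "\<dots> = (\<Sum>c<N. X x a c * pd i (\<lambda>x. \<alpha> j x c b) x + pd i (\<lambda>y. X y a c) x * \<alpha> j x c b)"
      using that by (intro sum.cong refl pd_mult[OF D(1)] X(1) \<alpha>_smooth) auto
    finally show ?thesis by (simp add: sum.distrib)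
  qed
  define R where "R a b \<phi> \<longleftrightarrow> smooth_on D \<phi> \<and> \<phi> x0 = 0 \<and>
    (\<forall>x\<in>D. \<forall>j<CARD('n). pd j \<phi> x = (\<Sum>c<N. X x a c * \<alpha> j x c b))" for a b \<phi>
  have "\<exists>\<phi>. R a b \<phi>" if ab: "a < N" "b < N" for a b
    unfolding R_def
  proof (rule exists_potential[OF D sm[OF ab]])
    fix x :: "(real,'n) vec" and i j assume *: "x \<in> D" "i < CARD('n)" "j < CARD('n)"
    show "pd i (\<lambda>x. \<Sum>c<N. X x a c * \<alpha> j x c b) x = pd j (\<lambda>x. \<Sum>c<N. X x a c * \<alpha> i x c b) x"
      using * ab \<alpha>_closed[OF *] X(2)[OF * ab] by (simp add: pdX)
  qed
  then obtain Y where R: "\<And>a b. a < N \<Longrightarrow> b < N \<Longrightarrow> R a b (Y a b)" by metis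
  have Y: "\<And>a b. a < N \<Longrightarrow> b < N \<Longrightarrow> smooth_on D (Y a b)" "\<And>a b. a < N \<Longrightarrow> b < N \<Longrightarrow> Y a b x0 = 0"
    "\<And>a b x j. a < N \<Longrightarrow> b < N \<Longrightarrow> x \<in> D \<Longrightarrow> j < CARD('n) \<Longrightarrow> pd j (Y a b) x = (\<Sum>c<N. X x a c * \<alpha> j x c b)"
    using R unfolding R_def by blast+
  have swap: "(\<Sum>c<N. (\<Sum>d<N. X x a d * \<alpha> i x d c) * \<alpha> j x c b) = (\<Sum>d<N. X x a d * (\<Sum>c<N. \<alpha> i x d c * \<alpha> j x c b))"
    for x a b i j
    by (simp add: sum_distrib_left sum_distrib_right mult.assoc) (rule sum.swap)
  have "integrable_mat (\<lambda>x a b. Y a b x)"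
    unfolding integrable_mat_def
  proof (intro conjI allI ballI impI)
    show "smooth_on D (\<lambda>x. Y a b x)" if "a < N" "b < N" for a b using Y(1)[OF that] .
    fix x i j a b assume *: "x \<in> D" "i < CARD('n)" "j < CARD('n)" and ab: "a < N" "b < N"
    have "(\<Sum>c<N. pd i (\<lambda>y. Y a c y) x * \<alpha> j x c b) = (\<Sum>d<N. X x a d * (\<Sum>c<N. \<alpha> i x d c * \<alpha> j x c b))"
      using Y(3)[OF ab(1) _ *(1,2)] by (simp flip: swap)
    also have "\<dots> = (\<Sum>d<N. X x a d * (\<Sum>c<N. \<alpha> j x d c * \<alpha> i x c b))"
      using \<alpha>_commute[OF * _ ab(2)] by simp
    also have "\<dots> = (\<Sum>c<N. pd j (\<lambda>y. Y a c y) x * \<alpha> i x c b)"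
      using Y(3)[OF ab(1) _ *(1,3)] by (simp flip: swap)
    finally show "(\<Sum>c<N. pd i (\<lambda>y. Y a c y) x * \<alpha> j x c b) = (\<Sum>c<N. pd j (\<lambda>y. Y a c y) x * \<alpha> i x c b)" .
  qed
  moreover have "integral_of X (\<lambda>x a b. Y a b x)" using Y by (simp add: integral_of_def)
  ultimately show ?thesis by blast
qed

text \<open>The conditional clause at m = 0 carries the initial value, the identity, through
  dependent choice.\<close>

lemma exists_iterated_integrals:
  "\<exists>H. \<forall>m. (integrable_mat (H m) \<and> (m = 0 \<longrightarrow> H m = (\<lambda>x a b. if a = b then 1 else 0))) \<and> integral_of (H m) (H (Suc m))"
proof (rule dependent_nat_choice)
  show "\<exists>X. integrable_mat X \<and> (0 = (0::nat) \<longrightarrow> X = (\<lambda>x a b. if a = b then 1 else 0))"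
    using D(1) by (simp add: integrable_mat_def)
qed (use integrable_mat_step in auto)

text \<open>\<open>\<Sum>m. l ^ m * H m\<close> is the normalised solution of \<open>dX = l X \<alpha>\<close>.\<close>

definition H :: "nat \<Rightarrow> (real,'n) vec \<Rightarrow> nat \<Rightarrow> nat \<Rightarrow> real" where
  "H = (SOME H. \<forall>m. (integrable_mat (H m) \<and> (m = 0 \<longrightarrow> H m = (\<lambda>x a b. if a = b then 1 else 0))) \<and> integral_of (H m) (H (Suc m)))"

lemma H: "(integrable_mat (H m) \<and> (m = 0 \<longrightarrow> H m = (\<lambda>x a b. if a = b then 1 else 0))) \<and> integral_of (H m) (H (Suc m))"
  using someI_ex[OF exists_iterated_integrals] unfolding H_def[symmetric] by (rule spec)

lemma H_0: "H 0 x a b = (if a = b then 1 else 0)"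
  using H[of 0] by simp

lemma H_smooth: "a < N \<Longrightarrow> b < N \<Longrightarrow> smooth_on D (\<lambda>x. H m x a b)"
  using H[of m] by (simp add: integrable_mat_def)

lemma H_Suc_x0: "a < N \<Longrightarrow> b < N \<Longrightarrow> H (Suc m) x0 a b = 0"
  and pd_H_Suc: "a < N \<Longrightarrow> b < N \<Longrightarrow> x \<in> D \<Longrightarrow> j < CARD('n) \<Longrightarrow>
    pd j (\<lambda>y. H (Suc m) y a b) x = (\<Sum>c<N. H m x a c * \<alpha> j x c b)"
  using H[of m] by (simp_all add: integral_of_def)

lemma pd_H_0: "pd j (\<lambda>y. H 0 y a b) x = 0"
  by (simp add: H_0)

section \<open>Factorial bounds for the iterated integrals\<close>

lemma \<alpha>_locally_bounded:
  assumes "z \<in> D"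
  shows "\<exists>r>0. \<exists>A\<ge>0. ball z r \<subseteq> D \<and> (\<forall>y\<in>ball z r. \<forall>j<CARD('n). \<forall>a<N. \<forall>b<N. \<bar>\<alpha> j y a b\<bar> \<le> A)"
proof -
  obtain r where r: "r > 0" "cball z r \<subseteq> D" using open_contains_cball[of D] D(1) assms by blast
  define s where "s y = (\<Sum>j<CARD('n). \<Sum>a<N. \<Sum>b<N. \<bar>\<alpha> j y a b\<bar>)" for y
  have "continuous_on (cball z r) s"
    unfolding s_def
    by (intro continuous_intros continuous_on_subset[OF smooth_on_imp_continuous_on r(2)] D(1) \<alpha>_smooth) auto
  then have "bounded (s ` cball z r)" by (intro compact_imp_bounded compact_continuous_image compact_cball)
  then obtain A where A: "\<And>y. y \<in> cball z r \<Longrightarrow> norm (s y) \<le> A" unfolding bounded_iff by blast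
  have "\<bar>\<alpha> j y a b\<bar> \<le> A" if "y \<in> ball z r" "j < CARD('n)" "a < N" "b < N" for y j a b
  proof -
    have "\<bar>\<alpha> j y a b\<bar> \<le> (\<Sum>b<N. \<bar>\<alpha> j y a b\<bar>)" using that by (intro member_le_sum) auto
    also have "\<dots> \<le> (\<Sum>a<N. \<Sum>b<N. \<bar>\<alpha> j y a b\<bar>)"
      using that by (intro member_le_sum[of a "{..<N}" "\<lambda>a. \<Sum>b<N. \<bar>\<alpha> j y a b\<bar>"]) (auto intro: sum_nonneg)
    also have "\<dots> \<le> s y"
      unfolding s_def using that
      by (intro member_le_sum[of j "{..<CARD('n)}" "\<lambda>j. \<Sum>a<N. \<Sum>b<N. \<bar>\<alpha> j y a b\<bar>"]) (auto intro!: sum_nonneg)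
    also have "\<dots> \<le> A" using A[of y] that by auto
    finally show ?thesis .
  qed
  moreover have "ball z r \<subseteq> D" using r ball_subset_cball by blast
  moreover have "A \<ge> 0" using A[of z] r norm_ge_zero[of "s z"] by (meson centre_in_cball less_imp_le order_trans)
  ultimately show ?thesis using r(1) by blast
qed

text \<open>The terms of an exponential series, with K depending on the point: enough for the series
  in l to be entire.\<close>

definition H_bounded :: "real \<Rightarrow> (real,'n) vec \<Rightarrow> bool" where
  "H_bounded K y \<longleftrightarrow> (\<forall>m. \<forall>a<N. \<forall>b<N. \<bar>H m y a b\<bar> \<le> K ^ m / fact m)"

text \<open>On the segment from w to y the bound grows to (K + t L)^m / m!. Its t-derivative at
  order m + 1 is L times the bound at order m, which dominates the derivative of
  \<open>H (Suc m)\<close>.\<close>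

lemma H_bounded_propagate:
  assumes ball: "ball z r \<subseteq> D" and r: "r > 0" "A \<ge> 0"
    and A: "\<And>y j a b. y \<in> ball z r \<Longrightarrow> j < CARD('n) \<Longrightarrow> a < N \<Longrightarrow> b < N \<Longrightarrow> \<bar>\<alpha> j y a b\<bar> \<le> A"
    and w: "w \<in> ball z r" "H_bounded K w" "K \<ge> 1" and y: "y \<in> ball z r"
  shows "H_bounded (K + 2 * r * CARD('n) * N * A) y"
proof -
  \<comment> \<open>2 r bounds the coordinates of y - w, CARD('n) counts the directions, N the terms
    of a matrix product, and A bounds the entries of \<open>\<alpha>\<close>.\<close>
  define L where "L = 2 * r * CARD('n) * N * A"
  define g where "g t = w + t *\<^sub>R (y - w)" for t
  have L: "L \<ge> 0" using r by (simp add: L_def)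
  have g_in: "g t \<in> ball z r" if "0 \<le> t" "t \<le> 1" for t
  proof -
    have "(1 - t) *\<^sub>R w + t *\<^sub>R y \<in> ball z r" using convexD_alt[OF convex_ball w(1) y that] .
    then show ?thesis by (simp add: g_def algebra_simps)
  qed
  have dist_wy: "norm (y - w) \<le> 2 * r"
    using w(1) y dist_triangle2[of y w z] by (simp add: dist_norm[symmetric] dist_commute)
  have bound: "\<forall>t\<in>{0..1}. \<forall>a<N. \<forall>b<N. \<bar>H m (g t) a b\<bar> \<le> (K + t * L) ^ m / fact m" for m
  proof (induction m)
    case (Suc m)
    show ?case
    proof (intro ballI allI impI)
      fix t a b assume t: "t \<in> {0..1::real}" and ab: "a < N" "b < N"
      define \<phi> where "\<phi> s = (K + s * L) ^ Suc m / fact (Suc m)" for s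
      define d where "d s = (\<Sum>j<CARD('n). (y - w) $ ix j * (\<Sum>c<N. H m (g s) a c * \<alpha> j (g s) c b))" for s
      have \<phi>: "(\<phi> has_real_derivative L * ((K + s * L) ^ m / fact m)) (at s)" for s
      proof -
        have "((\<lambda>s. K + s * L) has_real_derivative L) (at s)" by (auto intro!: derivative_eq_intros)
        note deriv = DERIV_cdivide[OF DERIV_power_Suc[OF this], of m "fact (Suc m)"]
        have fact: "(fact (Suc m) :: real) = (1 + real m) * fact m" by (simp add: algebra_simps)
        have "1 + real m \<noteq> 0" using of_nat_0_le_iff[of m] by linarith
        with deriv show ?thesis unfolding \<phi>_def fact by simp
      qed
      have deriv: "((\<lambda>s. H (Suc m) (g s) a b) has_real_derivative d s) (at s)" if s: "0 \<le> s" "s \<le> t" for s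
      proof -
        have gD: "g s \<in> D" using g_in[of s] s t ball by auto
        have "(g has_derivative (\<lambda>h. h *\<^sub>R (y - w))) (at s)"
          unfolding g_def by (auto intro!: derivative_eq_intros)
        from has_derivative_compose[OF this has_derivative_pd[OF D(1) H_smooth[OF ab] gD]]
        have "((\<lambda>s. H (Suc m) (g s) a b) has_derivative
          (\<lambda>h. \<Sum>j<CARD('n). (h *\<^sub>R (y - w)) $ ix j *\<^sub>R pd j (\<lambda>x. H (Suc m) x a b) (g s))) (at s)" .
        moreover have "(\<Sum>j<CARD('n). (h *\<^sub>R (y - w)) $ ix j *\<^sub>R pd j (\<lambda>x. H (Suc m) x a b) (g s)) = d s * h" for h
          using ab gD by (simp add: d_def pd_H_Suc sum_distrib_left sum_distrib_right mult_ac)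
        ultimately show ?thesis by (simp add: has_field_derivative_def)
      qed
      have d_bound: "\<bar>d s\<bar> \<le> L * ((K + s * L) ^ m / fact m)" if s: "0 \<le> s" "s \<le> t" for s
      proof -
        let ?q = "(K + s * L) ^ m / fact m"
        have q: "?q \<ge> 0" using w(3) s L by (intro divide_nonneg_nonneg zero_le_power add_nonneg_nonneg mult_nonneg_nonneg) auto
        have "\<bar>d s\<bar> \<le> (\<Sum>j<CARD('n). \<bar>(y - w) $ ix j * (\<Sum>c<N. H m (g s) a c * \<alpha> j (g s) c b)\<bar>)"
          unfolding d_def by (rule sum_abs)
        also have "\<dots> \<le> (\<Sum>j<CARD('n). 2 * r * (N * (?q * A)))"
        proof (rule sum_mono)
          fix j assume j: "j \<in> {..<CARD('n)}"
          have "\<bar>\<Sum>c<N. H m (g s) a c * \<alpha> j (g s) c b\<bar> \<le> (\<Sum>c<N. \<bar>H m (g s) a c * \<alpha> j (g s) c b\<bar>)" by (rule sum_abs)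
          also have "\<dots> \<le> (\<Sum>c<N. ?q * A)"
          proof (rule sum_mono)
            fix c assume "c \<in> {..<N}"
            then show "\<bar>H m (g s) a c * \<alpha> j (g s) c b\<bar> \<le> ?q * A"
              unfolding abs_mult using Suc.IH s t ab j g_in[of s] q by (intro mult_mono A) auto
          qed
          also have "\<dots> = N * (?q * A)" by simp
          finally have 1: "\<bar>\<Sum>c<N. H m (g s) a c * \<alpha> j (g s) c b\<bar> \<le> N * (?q * A)" .
          have 2: "\<bar>(y - w) $ ix j\<bar> \<le> 2 * r" using component_le_norm_cart[of "y - w" "ix j"] dist_wy by linarith
          show "\<bar>(y - w) $ ix j * (\<Sum>c<N. H m (g s) a c * \<alpha> j (g s) c b)\<bar> \<le> 2 * r * (N * (?q * A))"
            unfolding abs_mult using r by (intro mult_mono 1 2) auto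
        qed
        also have "\<dots> = L * ?q" by (simp add: L_def)
        finally show ?thesis .
      qed
      have t0: "0 \<le> t" using t by simp
      \<comment> \<open>The two-sided bound is proved as monotonicity in t of \<open>\<phi>\<close>
        minus, and below of \<open>\<phi>\<close> plus, the entry.\<close>
      have up: "\<phi> 0 - H (Suc m) (g 0) a b \<le> \<phi> t - H (Suc m) (g t) a b"
      proof (rule DERIV_nonneg_imp_nondecreasing[OF t0])
        fix s assume s: "0 \<le> s" "s \<le> t"
        show "\<exists>e. ((\<lambda>s. \<phi> s - H (Suc m) (g s) a b) has_real_derivative e) (at s) \<and> 0 \<le> e"
          using DERIV_diff[OF \<phi> deriv[OF s]] d_bound[OF s] by (intro exI conjI) (assumption, linarith)
      qed
      have lo: "\<phi> 0 + H (Suc m) (g 0) a b \<le> \<phi> t + H (Suc m) (g t) a b"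
      proof (rule DERIV_nonneg_imp_nondecreasing[OF t0])
        fix s assume s: "0 \<le> s" "s \<le> t"
        show "\<exists>e. ((\<lambda>s. \<phi> s + H (Suc m) (g s) a b) has_real_derivative e) (at s) \<and> 0 \<le> e"
          using DERIV_add[OF \<phi> deriv[OF s]] d_bound[OF s] by (intro exI conjI) (assumption, linarith)
      qed
      have "g 0 = w" by (simp add: g_def)
      then have "\<bar>H (Suc m) (g 0) a b\<bar> \<le> \<phi> 0"
        using w(2) ab unfolding H_bounded_def \<phi>_def by (auto simp del: fact_Suc power_Suc)
      with up lo have "\<bar>H (Suc m) (g t) a b\<bar> \<le> \<phi> t" by linarith
      then show "\<bar>H (Suc m) (g t) a b\<bar> \<le> (K + t * L) ^ Suc m / fact (Suc m)" by (simp only: \<phi>_def)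
    qed
  qed (simp add: H_0)
  have "g 1 = y" by (simp add: g_def)
  with bound[THEN bspec, of 1] show ?thesis by (simp add: H_bounded_def L_def)
qed

lemma H_locally_bounded:
  assumes "x \<in> D"
  shows "\<exists>r>0. \<exists>A\<ge>0. \<exists>K\<ge>1. ball x r \<subseteq> D \<and>
    (\<forall>y\<in>ball x r. H_bounded K y \<and> (\<forall>j<CARD('n). \<forall>a<N. \<forall>b<N. \<bar>\<alpha> j y a b\<bar> \<le> A))"
proof -
  have step: "\<exists>r>0. \<exists>A\<ge>0. ball z r \<subseteq> D \<and> (\<forall>y\<in>ball z r. \<forall>j<CARD('n). \<forall>a<N. \<forall>b<N. \<bar>\<alpha> j y a b\<bar> \<le> A) \<and>
    (\<forall>w\<in>ball z r. \<forall>K\<ge>1. H_bounded K w \<longrightarrow> (\<exists>K'\<ge>1. \<forall>y\<in>ball z r. H_bounded K' y))" if z: "z \<in> D" for z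
  proof -
    from \<alpha>_locally_bounded[OF z] obtain r A where r: "r > 0" "A \<ge> 0" "ball z r \<subseteq> D"
      and A: "\<And>y j a b. y \<in> ball z r \<Longrightarrow> j < CARD('n) \<Longrightarrow> a < N \<Longrightarrow> b < N \<Longrightarrow> \<bar>\<alpha> j y a b\<bar> \<le> A" by blast
    have "\<exists>K'\<ge>1. \<forall>y\<in>ball z r. H_bounded K' y" if "w \<in> ball z r" "K \<ge> 1" "H_bounded K w" for w K
    proof (intro exI[of _ "K + 2 * r * CARD('n) * N * A"] conjI ballI)
      show "K + 2 * r * CARD('n) * N * A \<ge> 1" using that(2) r by (simp add: add_increasing2)
    qed (use H_bounded_propagate[OF r(3,1,2) A that(1,3,2)] in blast)
    with r A show ?thesis by blast
  qed
  \<comment> \<open>No K need serve all of D. Existence of some K holds at x0, where only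
    \<open>H 0\<close> survives, and spreads from ball to ball by connectedness.\<close>
  have "\<exists>K\<ge>1. H_bounded K x"
  proof (rule connected_induction_simple[OF connected_D D(3) assms, where P="\<lambda>x. \<exists>K\<ge>1. H_bounded K x"])
    have "\<bar>H m x0 a b\<bar> \<le> 1 ^ m / fact m" if "a < N" "b < N" for m a b
      using that by (cases m) (auto simp: H_0 H_Suc_x0)
    then have "H_bounded 1 x0" unfolding H_bounded_def by blast
    then show "\<exists>K\<ge>1. H_bounded K x0" by (intro exI[of _ 1]) simp
  next
    fix z assume "z \<in> D"
    from step[OF this] obtain r where r: "r > 0" "ball z r \<subseteq> D"
      "\<And>w K. w\<in>ball z r \<Longrightarrow> K\<ge>1 \<Longrightarrow> H_bounded K w \<Longrightarrow> (\<exists>K'\<ge>1. \<forall>y\<in>ball z r. H_bounded K' y)" by blast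
    have "openin (top_of_set D) (ball z r)" using r(2) by (simp add: open_subset)
    moreover have "z \<in> ball z r" using r(1) by simp
    ultimately show "\<exists>T. openin (top_of_set D) T \<and> z \<in> T \<and>
      (\<forall>x\<in>T. \<forall>y\<in>T. (\<exists>K\<ge>1. H_bounded K x) \<longrightarrow> (\<exists>K\<ge>1. H_bounded K y))"
      using r(3) by (intro exI[of _ "ball z r"]) blast
  qed
  then obtain K where K: "K \<ge> 1" "H_bounded K x" by blast
  \<comment> \<open>So far the bound holds at x alone; propagating once more from x gives a common
    constant on a ball.\<close>
  from step[OF assms] obtain r A where r: "r > 0" "A \<ge> 0" "ball x r \<subseteq> D"
    "\<And>y j a b. y\<in>ball x r \<Longrightarrow> j<CARD('n) \<Longrightarrow> a<N \<Longrightarrow> b<N \<Longrightarrow> \<bar>\<alpha> j y a b\<bar> \<le> A"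
    "\<And>w K. w\<in>ball x r \<Longrightarrow> K\<ge>1 \<Longrightarrow> H_bounded K w \<Longrightarrow> (\<exists>K'\<ge>1. \<forall>y\<in>ball x r. H_bounded K' y)" by blast
  from r(5)[of x K] K r(1) obtain K' where "K' \<ge> 1" "\<forall>y\<in>ball x r. H_bounded K' y" by auto
  with r show ?thesis by blast
qed

text \<open>The family of series below is closed under all partial derivatives in \<open>(x, l)\<close>.\<close>

definition series :: "(nat \<Rightarrow> real) \<Rightarrow> nat \<Rightarrow> nat \<Rightarrow> nat \<Rightarrow> (real,'n) vec \<Rightarrow> complex \<Rightarrow> complex" where
  "series c r a b x l = (\<Sum>m. of_real (c m * H (m + r) x a b) * l ^ m)"

text \<open>A class of coefficients stable under shifting and \<open>dcoeff\<close>, the two changes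
  that partial derivatives cause. The exponent \<open>Suc m\<close> leaves c 0 free to exceed
  1.\<close>

definition geometric_growth :: "(nat \<Rightarrow> real) \<Rightarrow> bool" where
  "geometric_growth c \<longleftrightarrow> (\<exists>C\<ge>1. \<forall>m. \<bar>c m\<bar> \<le> C ^ Suc m)"

definition dcoeff :: "(nat \<Rightarrow> real) \<Rightarrow> nat \<Rightarrow> real" where
  "dcoeff c m = real (Suc m) * c (Suc m)"

lemma geometric_growth_shift:
  assumes "geometric_growth c"
  shows "geometric_growth (\<lambda>m. c (Suc m))"
proof -
  from assms obtain C where C: "C \<ge> 1" "\<And>m. \<bar>c m\<bar> \<le> C ^ Suc m" unfolding geometric_growth_def by blast
  \<comment> \<open>The shift costs one more factor C, absorbed by squaring: m + 2 is at most 2 (m +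
    1).\<close>
  have "\<bar>c (Suc m)\<bar> \<le> (C\<^sup>2) ^ Suc m" for m
  proof -
    have "C ^ Suc (Suc m) \<le> C ^ (2 * Suc m)" by (rule power_increasing[OF _ C(1)]) simp
    with C(2)[of "Suc m"] have "\<bar>c (Suc m)\<bar> \<le> C ^ (2 * Suc m)" by linarith
    then show ?thesis by (simp only: power_mult)
  qed
  moreover have "C\<^sup>2 \<ge> 1" using C(1) by simp
  ultimately show ?thesis unfolding geometric_growth_def by blast
qed

lemma geometric_growth_dcoeff:
  assumes "geometric_growth c"
  shows "geometric_growth (dcoeff c)"
proof -
  from geometric_growth_shift[OF assms] obtain C where C: "C \<ge> 1" "\<And>m. \<bar>c (Suc m)\<bar> \<le> C ^ Suc m"
    unfolding geometric_growth_def by blast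
  have "\<bar>dcoeff c m\<bar> \<le> (2 * C) ^ Suc m" for m
  proof -
    have "real (Suc m) \<le> 2 ^ Suc m" by (rule less_imp_le[OF of_nat_less_two_power])
    then have "real (Suc m) * \<bar>c (Suc m)\<bar> \<le> 2 ^ Suc m * C ^ Suc m" by (intro mult_mono C) auto
    then show ?thesis by (simp add: dcoeff_def abs_mult power_mult_distrib mult_ac)
  qed
  with C(1) show ?thesis unfolding geometric_growth_def by (intro exI[of _ "2 * C"]) simp
qed

definition dx_term :: "(nat \<Rightarrow> real) \<Rightarrow> nat \<Rightarrow> nat \<Rightarrow> nat \<Rightarrow> nat \<Rightarrow> nat \<Rightarrow> (real,'n) vec \<Rightarrow> complex \<Rightarrow> complex" where
  "dx_term c r a b j m x l = of_real (c m * pd j (\<lambda>y. H (m + r) y a b) x) * l ^ m"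

text \<open>At m = 0 the truncated exponent m - 1 is harmless, since the factor
  \<open>of_nat m\<close> vanishes.\<close>

definition dl_term :: "(nat \<Rightarrow> real) \<Rightarrow> nat \<Rightarrow> nat \<Rightarrow> nat \<Rightarrow> nat \<Rightarrow> (real,'n) vec \<Rightarrow> complex \<Rightarrow> complex" where
  "dl_term c r a b m x l = of_real (c m * H (m + r) x a b) * (of_nat m * l ^ (m - 1))"

lemma term_derivative:
  assumes "a < N" "b < N" "x \<in> D"
  shows "((\<lambda>p. of_real (c m * H (m + r) (fst p) a b) * snd p ^ m) has_derivative
    (\<lambda>h. (\<Sum>j<CARD('n). (fst h $ ix j) *\<^sub>R dx_term c r a b j m x l) + snd h * dl_term c r a b m x l)) (at (x,l))"
proof -
  have "((\<lambda>p. H (m + r) (fst p) a b) has_derivative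
    (\<lambda>h. \<Sum>j<CARD('n). (fst h $ ix j) *\<^sub>R pd j (\<lambda>y. H (m + r) y a b) x)) (at (x,l))"
  proof (rule has_derivative_compose[OF has_derivative_fst[OF has_derivative_ident]])
    show "((\<lambda>y. H (m + r) y a b) has_derivative (\<lambda>v. \<Sum>j<CARD('n). (v $ ix j) *\<^sub>R pd j (\<lambda>y. H (m + r) y a b) x)) (at (fst (x,l)))"
      using has_derivative_pd[OF D(1) H_smooth[OF assms(1,2)] assms(3)] by simp
  qed
  then have 1: "((\<lambda>p. complex_of_real (c m * H (m + r) (fst p) a b)) has_derivative
    (\<lambda>h. of_real (c m * (\<Sum>j<CARD('n). (fst h $ ix j) *\<^sub>R pd j (\<lambda>y. H (m + r) y a b) x)))) (at (x,l))"
    by (intro has_derivative_of_real has_derivative_mult_right)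
  have 2: "((\<lambda>p. snd p ^ m) has_derivative (\<lambda>h. of_nat m * snd h * l ^ (m - 1))) (at (x,l :: complex))"
    by (rule has_derivative_eq_rhs[OF has_derivative_power[OF has_derivative_snd[OF has_derivative_ident]]]) simp
  have "((\<lambda>p. of_real (c m * H (m + r) (fst p) a b) * snd p ^ m) has_derivative
    (\<lambda>h. of_real (c m * H (m + r) x a b) * (of_nat m * snd h * l ^ (m - 1)) +
     of_real (c m * (\<Sum>j<CARD('n). (fst h $ ix j) *\<^sub>R pd j (\<lambda>y. H (m + r) y a b) x)) * l ^ m)) (at (x,l))"
    using has_derivative_mult[OF 1 2] by simp
  then show ?thesis
    by (rule has_derivative_eq_rhs)
      (simp add: dx_term_def dl_term_def fun_eq_iff sum_distrib_left sum_distrib_right scaleR_conv_of_real mult_ac add.commute)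
qed

text \<open>A single majorant for the terms and for their derivatives in x and in l, uniform near x
  and for bounded l, as termwise differentiation requires.\<close>

lemma term_bounds:
  assumes "x \<in> D" "a < N" "b < N" "geometric_growth c" "R \<ge> 1"
  shows "\<exists>\<epsilon>>0. \<exists>M. ball x \<epsilon> \<subseteq> D \<and> summable M \<and> (\<forall>y\<in>ball x \<epsilon>. \<forall>l\<in>ball 0 R. \<forall>m.
    norm (of_real (c m * H (m + r) y a b) * l ^ m) \<le> M m \<and> norm (dl_term c r a b m y l) \<le> M m \<and>
    (\<forall>j<CARD('n). norm (dx_term c r a b j m y l) \<le> M m))"
proof -
  from H_locally_bounded[OF assms(1)] obtain \<epsilon> A K where \<epsilon>: "\<epsilon> > 0" "A \<ge> 0" "K \<ge> 1" "ball x \<epsilon> \<subseteq> D"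
    and K: "\<And>y. y \<in> ball x \<epsilon> \<Longrightarrow> H_bounded K y"
    and A: "\<And>y j a b. y \<in> ball x \<epsilon> \<Longrightarrow> j < CARD('n) \<Longrightarrow> a < N \<Longrightarrow> b < N \<Longrightarrow> \<bar>\<alpha> j y a b\<bar> \<le> A" by blast
  from assms(4) obtain C where C: "C \<ge> 1" "\<And>m. \<bar>c m\<bar> \<le> C ^ Suc m" unfolding geometric_growth_def by blast
  \<comment> \<open>N A is the cost of one factor \<open>\<alpha>\<close> after an x-derivative;
    adding 1 gives Q at least 1, so that undifferentiated terms are covered too.\<close>
  define Q where "Q = N * A + 1"
  have Q: "Q \<ge> 1" using \<epsilon>(2) by (simp add: Q_def)
  \<comment> \<open>The power of 2 absorbs the linear factors m and m + r coming from the
    l-derivative and from comparing factorials. Using m! instead of (m + r)! makes this a multiple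
    of an exponential series.\<close>
  define M0 where "M0 m = C ^ Suc m * (Q * (K ^ (m + r) / fact m) * 2 ^ (m + r)) * R ^ m" for m
  have Kle: "K ^ s / fact s \<le> K ^ s / fact m" if "m \<le> s" for s m
    using that \<epsilon>(3) by (intro divide_left_mono fact_mono) auto
  have M0: "M0 m = C * Q * (2 * K) ^ r * (inverse (fact m) * (C * K * 2 * R) ^ m)" for m
    by (simp add: M0_def power_add power_mult_distrib field_simps)
  have two: "real s \<le> 2 ^ s" for s by (rule less_imp_le[OF of_nat_less_two_power])
  have "norm (of_real (c m * H (m + r) y a b) * l ^ m) \<le> M0 m \<and> norm (dl_term c r a b m y l) \<le> M0 m \<and>
    (\<forall>j<CARD('n). norm (dx_term c r a b j m y l) \<le> M0 m)" if y: "y \<in> ball x \<epsilon>" and l: "l \<in> ball 0 R" for y l m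
  proof (intro conjI allI impI)
    have l1: "norm l ^ m \<le> R ^ m" using l by (intro power_mono) auto
    have R1: "R ^ (m - 1) \<le> R ^ m" using assms(5) by (intro power_increasing) auto
    have l2: "norm l ^ (m - 1) \<le> R ^ m" using l by (intro order_trans[OF power_mono R1]) auto
    have Hb: "\<bar>H s y a b\<bar> \<le> K ^ s / fact s" if "a < N" "b < N" for s a b
      using K[OF y] that unfolding H_bounded_def by blast
    have h1: "\<bar>H (m + r) y a b\<bar> \<le> K ^ (m + r) / fact m"
      using Hb[OF assms(2,3), of "m + r"] Kle[of m "m + r"] by linarith
    have K0: "0 \<le> K ^ (m + r) / fact m" using \<epsilon>(3) by simp
    have Q1: "K ^ (m + r) / fact m \<le> Q * (K ^ (m + r) / fact m)"
      using mult_right_mono[OF Q K0] by simp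
    have "0 \<le> Q * (K ^ (m + r) / fact m)" using K0 Q by (intro mult_nonneg_nonneg) auto
    from mult_left_mono[OF _ this, of 1 "2 ^ (m + r)"]
    have Q2: "Q * (K ^ (m + r) / fact m) \<le> Q * (K ^ (m + r) / fact m) * 2 ^ (m + r)" by simp
    have C0: "0 \<le> C ^ Suc m" using C(1) by simp
    have X0: "0 \<le> Q * (K ^ (m + r) / fact m) * 2 ^ (m + r)"
      using \<open>0 \<le> Q * (K ^ (m + r) / fact m)\<close> Q2 by (rule order_trans)
    have CX: "0 \<le> C ^ Suc m * (Q * (K ^ (m + r) / fact m) * 2 ^ (m + r))" by (rule mult_nonneg_nonneg[OF C0 X0])
    have M0_bound: "\<bar>c m\<bar> * p * q \<le> M0 m"
      if "p \<le> Q * (K ^ (m + r) / fact m) * 2 ^ (m + r)" "0 \<le> p" "q \<le> R ^ m" "0 \<le> q" for p q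
      unfolding M0_def by (rule mult_mono[OF mult_mono[OF C(2) that(1) C0 that(2)] that(3) CX that(4)])
    have "norm (of_real (c m * H (m + r) y a b) * l ^ m) = \<bar>c m\<bar> * \<bar>H (m + r) y a b\<bar> * norm l ^ m"
      by (simp add: norm_mult norm_power abs_mult)
    also have "\<dots> \<le> M0 m"
      using l1 by (intro M0_bound order_trans[OF h1 order_trans[OF Q1 Q2]]) auto
    finally show "norm (of_real (c m * H (m + r) y a b) * l ^ m) \<le> M0 m" .
    have "norm (dl_term c r a b m y l) = \<bar>c m\<bar> * (\<bar>H (m + r) y a b\<bar> * real m) * norm l ^ (m - 1)"
      by (simp add: dl_term_def norm_mult norm_power abs_mult mult_ac)
    also have "\<dots> \<le> M0 m"
    proof -
      have "real m \<le> 2 ^ (m + r)" by (rule order_trans[OF _ two]) simp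
      then have "\<bar>H (m + r) y a b\<bar> * real m \<le> Q * (K ^ (m + r) / fact m) * 2 ^ (m + r)"
        using order_trans[OF h1 Q1] \<open>0 \<le> Q * (K ^ (m + r) / fact m)\<close> by (intro mult_mono[of "\<bar>H (m + r) y a b\<bar>"]) auto
      with l2 show ?thesis by (intro M0_bound) auto
    qed
    finally show "norm (dl_term c r a b m y l) \<le> M0 m" .
    fix j assume j: "j < CARD('n)"
    have yD: "y \<in> D" using y \<epsilon>(4) by blast
    have "\<bar>pd j (\<lambda>y. H (m + r) y a b) y\<bar> \<le> Q * (K ^ (m + r) / fact m) * 2 ^ (m + r)"
    proof (cases "m + r")
      case 0
      then show ?thesis using pd_H_0 K0 Q by simp
    next
      case (Suc s)
      have "\<bar>pd j (\<lambda>y. H (m + r) y a b) y\<bar> = \<bar>\<Sum>c<N. H s y a c * \<alpha> j y c b\<bar>"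
        using pd_H_Suc[OF assms(2,3) yD j] Suc by simp
      also have "\<dots> \<le> (\<Sum>c<N. \<bar>H s y a c * \<alpha> j y c b\<bar>)" by (rule sum_abs)
      also have "\<dots> \<le> (\<Sum>c<N. K ^ s / fact s * A)"
        unfolding abs_mult using assms(2,3) y j \<epsilon> by (intro sum_mono mult_mono Hb A) auto
      also have "\<dots> = (N * A) * (K ^ s / fact s)" by simp
      also have "\<dots> \<le> Q * (K ^ s / fact s)" using \<epsilon> by (intro mult_right_mono) (auto simp: Q_def)
      also have "\<dots> \<le> Q * (K ^ Suc s / fact s)"
        using Q \<epsilon>(3) by (intro mult_left_mono divide_right_mono power_increasing) auto
      also have "K ^ Suc s / fact s = K ^ Suc s / fact (Suc s) * real (Suc s)"
        unfolding fact_Suc by (simp add: field_simps del: of_nat_Suc)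
      also have "Q * (K ^ Suc s / fact (Suc s) * real (Suc s)) = Q * (K ^ (m + r) / fact (m + r)) * real (m + r)"
        by (simp only: Suc mult.assoc)
      also have "\<dots> \<le> Q * (K ^ (m + r) / fact m) * 2 ^ (m + r)"
        using Q \<open>0 \<le> Q * (K ^ (m + r) / fact m)\<close> by (intro mult_mono[OF mult_left_mono[OF Kle] two]) auto
      finally show ?thesis .
    qed
    then have "\<bar>c m\<bar> * \<bar>pd j (\<lambda>y. H (m + r) y a b) y\<bar> * norm l ^ m \<le> M0 m"
      using l1 by (intro M0_bound) auto
    then show "norm (dx_term c r a b j m y l) \<le> M0 m"
      by (simp add: dx_term_def norm_mult norm_power abs_mult)
  qed
  moreover have "summable M0" unfolding M0 by (intro summable_mult summable_exp)
  ultimately show ?thesis using \<epsilon>(1,4) by blast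
qed

lemma
  assumes "x \<in> D" "a < N" "b < N" "geometric_growth c"
  shows summable_series: "summable (\<lambda>m. of_real (c m * H (m + r) x a b) * l ^ m)"
    and summable_dl: "summable (\<lambda>m. dl_term c r a b m x l)"
    and summable_dx: "j < CARD('n) \<Longrightarrow> summable (\<lambda>m. dx_term c r a b j m x l)"
proof -
  have "norm l + 1 \<ge> 1" by simp
  from term_bounds[OF assms this, of r] obtain \<epsilon> M where M: "\<epsilon> > 0" "summable M"
    "\<forall>y\<in>ball x \<epsilon>. \<forall>l'\<in>ball 0 (norm l + 1). \<forall>m.
    norm (of_real (c m * H (m + r) y a b) * l' ^ m) \<le> M m \<and> norm (dl_term c r a b m y l') \<le> M m \<and>
    (\<forall>j<CARD('n). norm (dx_term c r a b j m y l') \<le> M m)" by blast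
  have "x \<in> ball x \<epsilon>" "l \<in> ball 0 (norm l + 1)" using M(1) by auto
  with M(3) have *: "norm (of_real (c m * H (m + r) x a b) * l ^ m) \<le> M m \<and> norm (dl_term c r a b m x l) \<le> M m \<and>
    (\<forall>j<CARD('n). norm (dx_term c r a b j m x l) \<le> M m)" for m by blast
  show "summable (\<lambda>m. of_real (c m * H (m + r) x a b) * l ^ m)"
    by (rule summable_comparison_test'[OF M(2)]) (use * in blast)
  show "summable (\<lambda>m. dl_term c r a b m x l)"
    by (rule summable_comparison_test'[OF M(2)]) (use * in blast)
  show "summable (\<lambda>m. dx_term c r a b j m x l)" if "j < CARD('n)"
    by (rule summable_comparison_test'[OF M(2)]) (use * that in blast)
qed

lemma dl_series:
  assumes "x \<in> D" "a < N" "b < N" "geometric_growth c"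
  shows "(\<Sum>m. dl_term c r a b m x l) = series (dcoeff c) (Suc r) a b x l"
proof -
  have "(\<Sum>m. dl_term c r a b m x l) = (\<Sum>m. dl_term c r a b (Suc m) x l)"
    using suminf_split_head[OF summable_dl[OF assms]] by (simp add: dl_term_def)
  also have "\<dots> = series (dcoeff c) (Suc r) a b x l"
    unfolding series_def by (rule suminf_cong) (simp add: dl_term_def dcoeff_def)
  finally show ?thesis .
qed

text \<open>One x-derivative turns each \<open>H (m + Suc r)\<close> into \<open>H (m + r)\<close>
  times \<open>\<alpha>\<close>: r drops by one and the coefficients c stay.\<close>

lemma dx_series_Suc:
  assumes "x \<in> D" "a < N" "b < N" "geometric_growth c" "j < CARD('n)"
  shows "(\<Sum>m. dx_term c (Suc r) a b j m x l) = (\<Sum>d<N. series c r a d x l * of_real (\<alpha> j x d b))"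
proof -
  have "(\<Sum>d<N. series c r a d x l * of_real (\<alpha> j x d b)) =
      (\<Sum>m. \<Sum>d<N. of_real (c m * H (m + r) x a d) * l ^ m * of_real (\<alpha> j x d b))"
    unfolding series_def using assms
    by (subst suminf_sum) (auto intro!: sum.cong suminf_mult2 summable_mult2 summable_series simp del: of_real_mult)
  also have "\<dots> = (\<Sum>m. dx_term c (Suc r) a b j m x l)"
    using pd_H_Suc[OF assms(2,3,1,5)]
    by (intro suminf_cong) (simp add: dx_term_def sum_distrib_left sum_distrib_right mult_ac)
  finally show ?thesis by simp
qed

text \<open>With r = 0 there is no index left to lower. The term m = 0 is constant in x and drops
  out, so a factor l can be extracted and c is shifted.\<close>

lemma dx_series_0:
  assumes "x \<in> D" "a < N" "b < N" "geometric_growth c" "j < CARD('n)"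
  shows "(\<Sum>m. dx_term c 0 a b j m x l) = l * (\<Sum>d<N. series (\<lambda>m. c (Suc m)) 0 a d x l * of_real (\<alpha> j x d b))"
proof -
  have eq: "dx_term c 0 a b j (Suc m) x l = l * dx_term (\<lambda>m. c (Suc m)) (Suc 0) a b j m x l" for m
    by (simp add: dx_term_def)
  have "(\<Sum>m. dx_term c 0 a b j m x l) = (\<Sum>m. dx_term c 0 a b j (Suc m) x l)"
    using suminf_split_head[OF summable_dx[OF assms, of 0 l]] by (simp add: pd_H_0 dx_term_def[of c 0 a b j 0])
  also have "\<dots> = l * (\<Sum>m. dx_term (\<lambda>m. c (Suc m)) (Suc 0) a b j m x l)"
    unfolding eq using assms by (intro suminf_mult summable_dx geometric_growth_shift)
  finally show ?thesis using dx_series_Suc[OF assms(1-3) geometric_growth_shift[OF assms(4)] assms(5)] by simp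
qed

lemma series_derivative:
  assumes "x \<in> D" "a < N" "b < N" "geometric_growth c"
  shows "((\<lambda>p. series c r a b (fst p) (snd p)) has_derivative
    (\<lambda>h. (\<Sum>j<CARD('n). (fst h $ ix j) *\<^sub>R (\<Sum>m. dx_term c r a b j m x l)) + snd h * series (dcoeff c) (Suc r) a b x l)) (at (x,l))"
proof -
  have "norm l + 1 \<ge> 1" by simp
  from term_bounds[OF assms this, of r] obtain \<epsilon> M where M: "\<epsilon> > 0" "ball x \<epsilon> \<subseteq> D" "summable M"
    "\<forall>y\<in>ball x \<epsilon>. \<forall>l'\<in>ball 0 (norm l + 1). \<forall>m.
    norm (of_real (c m * H (m + r) y a b) * l' ^ m) \<le> M m \<and> norm (dl_term c r a b m y l') \<le> M m \<and>
    (\<forall>j<CARD('n). norm (dx_term c r a b j m y l') \<le> M m)" by blast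
  let ?S = "ball x \<epsilon> \<times> ball (0::complex) (norm l + 1)"
  let ?f' = "\<lambda>m p h. (\<Sum>j<CARD('n). (fst h $ ix j) *\<^sub>R dx_term c r a b j m (fst p) (snd p)) + snd h * dl_term c r a b m (fst p) (snd p)"
  have "((\<lambda>p. \<Sum>m. of_real (c m * H (m + r) (fst p) a b) * snd p ^ m) has_derivative (\<lambda>h. \<Sum>m. ?f' m (x,l) h)) (at (x,l))"
  \<comment> \<open>The factor CARD('n) + 1 counts the partial derivatives: one for each coordinate
    of x and one for l.\<close>
  proof (rule has_derivative_suminf[where S = ?S and M = "\<lambda>m. M m * (CARD('n) + 1)" and f' = ?f' and
      f = "\<lambda>m p. of_real (c m * H (m + r) (fst p) a b) * snd p ^ m"])
    show "convex ?S" by (intro convex_Times convex_ball)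
    show "open ?S" by (intro open_Times open_ball)
    show "(x,l) \<in> ?S" using M(1) by simp
    show "summable (\<lambda>m. M m * (CARD('n) + 1))" by (intro summable_mult2 M(3))
    fix p assume p: "p \<in> ?S"
    then have pD: "fst p \<in> D" using M(2) by auto
    show "((\<lambda>p. of_real (c m * H (m + r) (fst p) a b) * snd p ^ m) has_derivative ?f' m p) (at p)" for m
      using term_derivative[OF assms(2,3) pD, of c m r "snd p"] by simp
    show "summable (\<lambda>m. of_real (c m * H (m + r) (fst p) a b) * snd p ^ m)"
      by (rule summable_series[OF pD assms(2-4)])
    fix m h
    have b: "norm (dl_term c r a b m (fst p) (snd p)) \<le> M m" "\<And>j. j < CARD('n) \<Longrightarrow> norm (dx_term c r a b j m (fst p) (snd p)) \<le> M m"
      using M(4) p by (auto simp: mem_Times_iff)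
    have "norm (?f' m p h) \<le> (\<Sum>j<CARD('n). norm ((fst h $ ix j) *\<^sub>R dx_term c r a b j m (fst p) (snd p))) + norm (snd h * dl_term c r a b m (fst p) (snd p))"
      by (rule order_trans[OF norm_triangle_ineq]) (intro add_right_mono norm_sum)
    also have "\<dots> \<le> (\<Sum>j<CARD('n). norm h * M m) + norm h * M m"
    proof (intro add_mono sum_mono)
      fix j assume j: "j \<in> {..<CARD('n)}"
      have "norm (fst h $ ix j) \<le> norm h"
        using component_le_norm_cart[of "fst h" "ix j"] norm_fst_le[of "fst h" "snd h"] by simp
      then show "norm ((fst h $ ix j) *\<^sub>R dx_term c r a b j m (fst p) (snd p)) \<le> norm h * M m"
        unfolding norm_scaleR using b(2)[of j] j by (intro mult_mono) auto
    next
      show "norm (snd h * dl_term c r a b m (fst p) (snd p)) \<le> norm h * M m"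
        unfolding norm_mult using norm_snd_le[of "snd h" "fst h"] by (intro mult_mono b(1)) auto
    qed
    also have "\<dots> = M m * (CARD('n) + 1) * norm h" by (simp add: algebra_simps)
    finally show "norm (?f' m p h) \<le> M m * (CARD('n) + 1) * norm h" .
  qed
  moreover have "(\<Sum>m. ?f' m (x,l) h) =
    (\<Sum>j<CARD('n). (fst h $ ix j) *\<^sub>R (\<Sum>m. dx_term c r a b j m x l)) + snd h * series (dcoeff c) (Suc r) a b x l" for h
  proof -
    have "(\<Sum>m. ?f' m (x,l) h) = (\<Sum>m. \<Sum>j<CARD('n). (fst h $ ix j) *\<^sub>R dx_term c r a b j m x l) + (\<Sum>m. snd h * dl_term c r a b m x l)"
      unfolding fst_conv snd_conv using assms by (intro suminf_add[symmetric] summable_sum summable_scaleR_right summable_dx summable_mult summable_dl) auto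
    also have "(\<Sum>m. \<Sum>j<CARD('n). (fst h $ ix j) *\<^sub>R dx_term c r a b j m x l) =
        (\<Sum>j<CARD('n). (fst h $ ix j) *\<^sub>R (\<Sum>m. dx_term c r a b j m x l))"
      using assms by (subst suminf_sum) (auto simp: summable_scaleR_right summable_dx suminf_scaleR_right)
    also have "(\<Sum>m. snd h * dl_term c r a b m x l) = snd h * series (dcoeff c) (Suc r) a b x l"
      using suminf_mult[OF summable_dl[OF assms]] dl_series[OF assms] by simp
    finally show ?thesis .
  qed
  ultimately show ?thesis unfolding series_def[of c r a b]
    by (rule has_derivative_eq_rhs[OF _ ext])
qed

text \<open>The induction runs over all c, r, a, b together: an l-derivative passes to
  \<open>dcoeff c\<close> and r + 1, an x-derivative lowers r or, for r = 0, shifts c and multiplies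
  by l.\<close>

lemma Ck_series:
  assumes "a < N" "b < N" "geometric_growth c"
  shows "Ck n (D \<times> UNIV) (\<lambda>p. series c r a b (fst p) (snd p))"
  using assms
proof (induction n arbitrary: c r a b)
  case (Suc n)
  have bl: "Ck n (D \<times> UNIV) (\<lambda>p. complex_of_real (\<alpha> j (fst p) d b))" if "j < CARD('n)" "d < N" for j d
    using \<alpha>_smooth[OF that Suc.prems(2)] D(1)
    by (intro bounded_linear.Ck_linear[OF bounded_linear_of_real] Ck_compose_linear[OF bounded_linear_fst, of _ D])
      (auto simp: smooth_on_Ck)
  have snd: "Ck n (D \<times> UNIV) (\<lambda>p. snd p :: complex)"
  proof -
    have "Ck k UNIV (\<lambda>l::complex. l)" for k
      by (cases k) (auto intro!: exI[of _ "\<lambda>x h. h"] Ck_const)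
    from Ck_compose_linear[OF bounded_linear_snd _ this, of "D \<times> UNIV"] show ?thesis by simp
  qed
  show ?case
  proof (rule Ck_SucI)
    fix p :: "(real,'n) vec \<times> complex" assume "p \<in> D \<times> UNIV"
    then show "((\<lambda>p. series c r a b (fst p) (snd p)) has_derivative
      (\<lambda>h. (\<Sum>j<CARD('n). (fst h $ ix j) *\<^sub>R (\<Sum>m. dx_term c r a b j m (fst p) (snd p))) +
        snd h * series (dcoeff c) (Suc r) a b (fst p) (snd p))) (at p)"
      using series_derivative[OF _ Suc.prems, of "fst p" r "snd p"] by (simp add: mem_Times_iff)
  next
    fix h :: "(real,'n) vec \<times> complex"
    have "Ck n (D \<times> UNIV) (\<lambda>p. \<Sum>m. dx_term c r a b j m (fst p) (snd p))" if j: "j < CARD('n)" for j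
    proof (cases r)
      case 0
      have "Ck n (D \<times> UNIV) (\<lambda>p. snd p * (\<Sum>d<N. series (\<lambda>m. c (Suc m)) 0 a d (fst p) (snd p) * of_real (\<alpha> j (fst p) d b)))"
        using Suc.prems j by (intro Ck_mult snd Ck_sum Suc.IH bl geometric_growth_shift) auto
      then show ?thesis
        by (rule Ck_cong[rotated]) (use dx_series_0[OF _ Suc.prems j] 0 D(1) in \<open>auto simp: open_Times\<close>)
    next
      case (Suc r')
      have "Ck n (D \<times> UNIV) (\<lambda>p. \<Sum>d<N. series c r' a d (fst p) (snd p) * of_real (\<alpha> j (fst p) d b))"
        using Suc.prems j by (intro Ck_mult Ck_sum Suc.IH bl) auto
      then show ?thesis
        by (rule Ck_cong[rotated]) (use dx_series_Suc[OF _ Suc.prems j] Suc D(1) in \<open>auto simp: open_Times\<close>)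
    qed
    then show "Ck n (D \<times> UNIV) (\<lambda>p. (\<Sum>j<CARD('n). (fst h $ ix j) *\<^sub>R (\<Sum>m. dx_term c r a b j m (fst p) (snd p))) +
        snd h * series (dcoeff c) (Suc r) a b (fst p) (snd p))"
      using Suc.prems
      by (intro Ck_add Ck_sum bounded_linear.Ck_linear[OF bounded_linear_scaleR_right] Ck_mult Ck_const Suc.IH geometric_growth_dcoeff) auto
  qed
qed simp

section \<open>The normalised solution of the linear system\<close>

definition sol :: "(real,'n) vec \<Rightarrow> complex \<Rightarrow> nat \<Rightarrow> nat \<Rightarrow> complex" where
  "sol x l a b = series (\<lambda>_. 1) 0 a b x l"

lemma geometric_growth_1 [simp]: "geometric_growth (\<lambda>_. 1)"
  unfolding geometric_growth_def by (intro exI[of _ 1]) simp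

lemma sol_smooth: "a < N \<Longrightarrow> b < N \<Longrightarrow> smooth_on (D \<times> UNIV) (\<lambda>p. sol (fst p) (snd p) a b)"
  unfolding sol_def using Ck_series D(1) by (subst smooth_on_Ck) (auto simp: open_Times)

lemma pd_sol:
  assumes "x \<in> D" "a < N" "b < N" "j < CARD('n)"
  shows "pd j (\<lambda>y. sol y l a b) x = l * (\<Sum>d<N. sol x l a d * of_real (\<alpha> j x d b))"
proof -
  have "((\<lambda>y. (y, l)) has_derivative (\<lambda>h. (h, 0))) (at x)"
    by (auto intro!: derivative_eq_intros)
  from has_derivative_compose[OF this series_derivative[OF assms(1-3) geometric_growth_1, of 0 l]]
  have "((\<lambda>y. sol y l a b) has_derivative (\<lambda>h. \<Sum>i<CARD('n). (h $ ix i) *\<^sub>R (\<Sum>m. dx_term (\<lambda>_. 1) 0 a b i m x l))) (at x)"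
    by (simp add: sol_def)
  from pd_eq[OF this, of j]
  have "pd j (\<lambda>y. sol y l a b) x = (\<Sum>i<CARD('n). ((axis (ix j) 1 :: (real,'n) vec) $ ix i) *\<^sub>R (\<Sum>m. dx_term (\<lambda>_. 1) 0 a b i m x l))" .
  also have "\<dots> = (\<Sum>i<CARD('n). if i = j then \<Sum>m. dx_term (\<lambda>_. 1) 0 a b i m x l else 0)"
    by (intro sum.cong refl) (use assms(4) in \<open>auto simp: axis_def ix_eq_iff\<close>)
  finally have "pd j (\<lambda>y. sol y l a b) x = (\<Sum>i<CARD('n). if i = j then \<Sum>m. dx_term (\<lambda>_. 1) 0 a b i m x l else 0)" .
  then show ?thesis
    using assms(4) dx_series_0[OF assms(1-3) geometric_growth_1 assms(4)] by (simp add: sol_def)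
qed

lemma sol_has_field_derivative:
  assumes "x \<in> D" "a < N" "b < N"
  shows "((\<lambda>l. sol x l a b) has_field_derivative series (dcoeff (\<lambda>_. 1)) (Suc 0) a b x l) (at l)"
proof -
  have "((\<lambda>l. (x, l)) has_derivative (\<lambda>h. (0, h))) (at l)"
    by (auto intro!: derivative_eq_intros)
  from has_derivative_compose[OF this series_derivative[OF assms geometric_growth_1, of 0 l]]
  show ?thesis by (simp add: sol_def has_field_derivative_def mult_commute_abs)
qed

lemma sol_at_0: "sol x 0 a b = (if a = b then 1 else 0)"
  by (simp add: sol_def series_def H_0 powser_zero)

lemma deriv_sol_0:
  assumes "x \<in> D" "a < N" "b < N"
  shows "deriv (\<lambda>l. sol x l a b) 0 = of_real (H 1 x a b)"
proof -
  have "series (dcoeff (\<lambda>_. 1)) (Suc 0) a b x 0 = of_real (dcoeff (\<lambda>_. 1) 0 * H (0 + Suc 0) x a b)"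
    unfolding series_def by (rule powser_zero)
  then show ?thesis using DERIV_imp_deriv[OF sol_has_field_derivative[OF assms, of 0]] by (simp add: dcoeff_def)
qed

lemma sol_x0: "a < N \<Longrightarrow> b < N \<Longrightarrow> sol x0 l a b = (if a = b then 1 else 0)"
proof -
  assume ab: "a < N" "b < N"
  have "(\<lambda>m. complex_of_real (1 * H (m + 0) x0 a b) * l ^ m) = (\<lambda>m. of_real (if m = 0 then H 0 x0 a b else 0) * l ^ m)"
    using ab H_Suc_x0 by (auto simp: fun_eq_iff gr0_conv_Suc)
  then have "sol x0 l a b = (\<Sum>m. of_real (if m = 0 then H 0 x0 a b else 0) * l ^ m)" by (simp add: sol_def series_def)
  also have "\<dots> = (\<Sum>m\<in>{0}. of_real (if m = 0 then H 0 x0 a b else 0) * l ^ m)"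
    by (rule suminf_finite) auto
  finally show ?thesis by (simp add: H_0)
qed

lemma cnj_sol:
  assumes "x \<in> D" "a < N" "b < N"
  shows "cnj (sol x (cnj l) a b) = sol x l a b"
  unfolding sol_def series_def
  using bounded_linear.suminf[OF bounded_linear_cnj summable_series[OF assms geometric_growth_1, of 0 "cnj l"]]
  by simp

end

section \<open>Extended frames\<close>

text \<open>The bijection e labels rows and columns by a finite type with N elements, so that the
  statement becomes one about square matrices of type \<open>'a^'k^'k\<close>.\<close>

lemma left_inverse_imp_right_inverse:
  fixes A B :: "nat \<Rightarrow> nat \<Rightarrow> 'a::field" and e :: "nat \<Rightarrow> 'k::finite"
  assumes e: "bij_betw e {..<N} UNIV"
    and AB: "\<And>a b. a < N \<Longrightarrow> b < N \<Longrightarrow> (\<Sum>c<N. A a c * B c b) = (if a = b then 1 else 0)"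
    and ab: "a < N" "b < N"
  shows "(\<Sum>c<N. B a c * A c b) = (if a = b then 1 else 0)"
proof -
  define d where "d = inv_into {..<N} e"
  have d: "bij_betw d UNIV {..<N}" unfolding d_def by (rule bij_betw_inv_into[OF e])
  have dN: "d i < N" for i using bij_betwE[OF d] by auto
  have inj: "d i = d j \<longleftrightarrow> i = j" for i j using d unfolding bij_betw_def by (auto dest: injD)
  have de: "d (e c) = c" if "c < N" for c using bij_betw_inv_into_left[OF e] that by (simp add: d_def)
  define MA :: "'a^'k^'k" where "MA = (\<chi> i j. A (d i) (d j))"
  define MB :: "'a^'k^'k" where "MB = (\<chi> i j. B (d i) (d j))"
  have reindex: "(\<Sum>i\<in>UNIV. g (d i)) = (\<Sum>c<N. g c)" for g :: "nat \<Rightarrow> 'a"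
    by (rule sum.reindex_bij_betw[OF d])
  have "(MA ** MB) $ i $ j = mat 1 $ i $ j" for i j
    using reindex[of "\<lambda>c. A (d i) c * B c (d j)"] AB[OF dN dN, of i j]
    by (simp add: MA_def MB_def matrix_matrix_mult_def mat_def inj)
  then have "MA ** MB = mat 1" by (simp add: vec_eq_iff)
  then have "MB ** MA = mat 1" by (rule matrix_left_right_inverse1)
  have "(\<Sum>c<N. B a c * A c b) = (\<Sum>i\<in>UNIV. B a (d i) * A (d i) b)" by (rule reindex[symmetric])
  also have "\<dots> = (MB ** MA) $ e a $ e b" by (simp add: MA_def MB_def matrix_matrix_mult_def de ab)
  also have "\<dots> = (if e a = e b then 1 else 0)" by (simp add: \<open>MB ** MA = mat 1\<close> mat_def)
  also have "e a = e b \<longleftrightarrow> a = b" using de[OF ab(1)] de[OF ab(2)] by metis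
  finally show ?thesis .
qed

lemma lin_indep_imp_inverse:
  fixes U :: "nat \<Rightarrow> nat \<Rightarrow> real" and e :: "nat \<Rightarrow> 'k::finite"
  assumes e: "bij_betw e {..<n} UNIV" and "lin_indep n U"
  shows "\<exists>Q. \<forall>a<n. \<forall>b<n. (\<Sum>l<n. Q a l * U l b) = (if a = b then 1 else 0)"
proof -
  define d where "d = inv_into {..<n} e"
  have d: "bij_betw d UNIV {..<n}" unfolding d_def by (rule bij_betw_inv_into[OF e])
  have dn: "d i < n" for i using bij_betwE[OF d] by auto
  have de: "d (e c) = c" if "c < n" for c using bij_betw_inv_into_left[OF e] that by (simp add: d_def)
  have ed: "e (d i) = i" for i unfolding d_def by (rule bij_betw_inv_into_right[OF e]) simp
  have inj: "e a = e b \<longleftrightarrow> a = b" if "a < n" "b < n" for a b using de that by metis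
  \<comment> \<open>The transpose of U: its kernel consists of the linear relations between the
    rows, so independence makes it injective.\<close>
  define M :: "real^'k^'k" where "M = (\<chi> i j. U (d j) (d i))"
  have reindex: "(\<Sum>i\<in>UNIV. g (d i)) = (\<Sum>c<n. g c)" for g :: "nat \<Rightarrow> real"
    by (rule sum.reindex_bij_betw[OF d])
  have "x = 0" if "M *v x = 0" for x
  proof -
    have "(\<Sum>i<n. x $ e i * U i b) = 0" if "b < n" for b
    proof -
      have "(\<Sum>i<n. x $ e i * U i b) = (\<Sum>j\<in>UNIV. x $ e (d j) * U (d j) b)" by (rule reindex[symmetric])
      also have "\<dots> = (M *v x) $ e b" using de[OF that] by (simp add: M_def matrix_vector_mult_def ed mult.commute)
      finally show ?thesis using \<open>M *v x = 0\<close> by simp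
    qed
    with assms(2) have "\<forall>i<n. x $ e i = 0" unfolding lin_indep_def by (elim allE[of _ "\<lambda>i. x $ e i"]) simp
    then show "x = 0" using ed dn by (metis vec_eq_iff zero_index)
  qed
  then obtain P where "P ** M = mat 1" using matrix_left_invertible_ker[of M] by blast
  then have MP: "M ** P = mat 1" by (rule matrix_left_right_inverse1)
  have "(\<Sum>l<n. P $ e l $ e a * U l b) = (if a = b then 1 else 0)" if "a < n" "b < n" for a b
  proof -
    have "(\<Sum>l<n. P $ e l $ e a * U l b) = (\<Sum>j\<in>UNIV. P $ e (d j) $ e a * U (d j) b)" by (rule reindex[symmetric])
    also have "\<dots> = (M ** P) $ e b $ e a" using de[OF that(2)] by (simp add: M_def matrix_matrix_mult_def ed mult.commute)
    also have "\<dots> = (if a = b then 1 else 0)" using inj[OF that] by (auto simp: MP mat_def)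
    finally show ?thesis .
  qed
  then show ?thesis by (intro exI[of _ "\<lambda>a l. P $ e l $ e a"]) blast
qed

lemma sum_delta_mult:
  fixes g :: "nat \<Rightarrow> 'a::comm_ring_1"
  assumes "a < n"
  shows "(\<Sum>c<n. (if a = c then 1 else 0) * g c) = g a" "(\<Sum>c<n. (if c = a then 1 else 0) * g c) = g a"
    "(\<Sum>c<n. g c * (if a = c then 1 else 0)) = g a" "(\<Sum>c<n. g c * (if c = a then 1 else 0)) = g a"
  using assms by (simp_all add: if_distrib[of "\<lambda>t. t * _"] if_distrib[of "\<lambda>t. _ * t"] cong: if_cong)

text \<open>If dM = M A, the equality of mixed derivatives of M reads M (dA + A wedge A) = 0, and
  the left inverse L cancels M.\<close>

lemma flat_onI:
  fixes M :: "real^('n::{finite,linorder}) \<Rightarrow> nat \<Rightarrow> nat \<Rightarrow> real"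
  assumes D: "open D"
    and M: "\<And>a b. a < m \<Longrightarrow> b < m \<Longrightarrow> smooth_on D (\<lambda>x. M x a b)"
    and A: "\<And>j a b. j < CARD('n) \<Longrightarrow> a < m \<Longrightarrow> b < m \<Longrightarrow> smooth_on D (\<lambda>x. A x j a b)"
    and pdM: "\<And>x j a b. x \<in> D \<Longrightarrow> j < CARD('n) \<Longrightarrow> a < m \<Longrightarrow> b < m \<Longrightarrow> pd j (\<lambda>y. M y a b) x = (\<Sum>c<m. M x a c * A x j c b)"
    and L: "\<And>x a b. x \<in> D \<Longrightarrow> a < m \<Longrightarrow> b < m \<Longrightarrow> (\<Sum>c<m. L x a c * M x c b) = (if a = b then 1 else 0)"
  shows "flat_on D m A"
  unfolding flat_on_def
proof (intro ballI allI impI)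
  fix x i j a b assume x: "x \<in> D" and ij: "i < CARD('n)" "j < CARD('n)" and ab: "a < m" "b < m"
  define R where "R c = pd i (\<lambda>y. A y j c b) x - pd j (\<lambda>y. A y i c b) x + (\<Sum>d<m. A x i c d * A x j d b - A x j c d * A x i d b)" for c
  have second: "pd i (pd j (\<lambda>y. M y a b)) x = (\<Sum>c<m. M x a c * (pd i (\<lambda>y. A y j c b) x + (\<Sum>d<m. A x i c d * A x j d b)))"
    if "a < m" "i < CARD('n)" "j < CARD('n)" for a i j
  proof -
    have "pd i (pd j (\<lambda>y. M y a b)) x = pd i (\<lambda>y. \<Sum>c<m. M y a c * A y j c b) x"
      by (rule pd_cong[OF D x]) (rule pdM, use that ab in auto)
    also have "\<dots> = (\<Sum>c<m. pd i (\<lambda>y. M y a c * A y j c b) x)"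
      using that ab by (intro pd_sum[OF D _ x] smooth_on_mult[OF D] M A) auto
    also have "\<dots> = (\<Sum>c<m. M x a c * pd i (\<lambda>y. A y j c b) x + (\<Sum>d<m. M x a d * A x i d c) * A x j c b)"
    proof (rule sum.cong[OF refl])
      fix c assume "c \<in> {..<m}"
      then have c: "c < m" by simp
      show "pd i (\<lambda>y. M y a c * A y j c b) x = M x a c * pd i (\<lambda>y. A y j c b) x + (\<Sum>d<m. M x a d * A x i d c) * A x j c b"
        using pd_mult[OF D M[OF that(1) c] A[OF that(3) c ab(2)] x, of i] pdM[OF x that(2,1) c] by simp
    qed
    also have "\<dots> = (\<Sum>c<m. M x a c * pd i (\<lambda>y. A y j c b) x) + (\<Sum>c<m. \<Sum>d<m. M x a d * A x i d c * A x j c b)"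
      by (simp add: sum.distrib sum_distrib_right)
    also have "(\<Sum>c<m. \<Sum>d<m. M x a d * A x i d c * A x j c b) = (\<Sum>d<m. \<Sum>c<m. M x a d * A x i d c * A x j c b)"
      by (rule sum.swap)
    also have "(\<Sum>c<m. M x a c * pd i (\<lambda>y. A y j c b) x) + \<dots> = (\<Sum>c<m. M x a c * (pd i (\<lambda>y. A y j c b) x + (\<Sum>d<m. A x i c d * A x j d b)))"
      by (simp add: sum.distrib distrib_left sum_distrib_left mult.assoc)
    finally show ?thesis .
  qed
  have R: "R c = (pd i (\<lambda>y. A y j c b) x + (\<Sum>d<m. A x i c d * A x j d b)) - (pd j (\<lambda>y. A y i c b) x + (\<Sum>d<m. A x j c d * A x i d b))" for c
    by (simp add: R_def sum_subtractf)
  have MR: "(\<Sum>c<m. M x d c * R c) = 0" if "d < m" for d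
  proof -
    have "(\<Sum>c<m. M x d c * R c) = pd i (pd j (\<lambda>y. M y d b)) x - pd j (pd i (\<lambda>y. M y d b)) x"
      unfolding second[OF that ij] second[OF that ij(2,1)] R right_diff_distrib sum_subtractf ..
    then show ?thesis using pd_commute[OF D M[OF that ab(2)] x, of i j] by simp
  qed
  have "R a = (\<Sum>c<m. (\<Sum>d<m. L x a d * M x d c) * R c)"
    using ab L[OF x] by (simp add: sum_delta_mult)
  also have "\<dots> = (\<Sum>d<m. L x a d * (\<Sum>c<m. M x d c * R c))"
    by (simp add: sum_distrib_left sum_distrib_right mult.assoc) (rule sum.swap)
  finally show "pd i (\<lambda>y. A y j a b) x - pd j (\<lambda>y. A y i a b) x + (\<Sum>c<m. A x i a c * A x j c b - A x j a c * A x i c b) = 0"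
    using MR by (simp add: R_def)
qed

lemma sum_blocks: "(\<Sum>c<2*n+1. f c) = (\<Sum>c<n+1. f c) + (\<Sum>c<n. f (n+1+c))" for f :: "nat \<Rightarrow> 'a::comm_monoid_add"
proof -
  have "{..<2*n+1} = {..<n+1} \<union> {n+1..<n+1+n}" by auto
  then have "(\<Sum>c<2*n+1. f c) = (\<Sum>c<n+1. f c) + (\<Sum>c\<in>{n+1..<n+1+n}. f c)"
    by (metis sum.union_disjoint finite_lessThan finite_atLeastLessThan ivl_disj_int_one(2))
  also have "(\<Sum>c\<in>{n+1..<n+1+n}. f c) = (\<Sum>c<n. f (n+1+c))"
    by (rule sum.reindex_bij_witness[of _ "\<lambda>c. n+1+c" "\<lambda>c. c-(n+1)"]) auto
  finally show ?thesis .
qed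

lemma block_cases:
  fixes a n :: nat
  assumes "a < 2*n+1"
  obtains "a < n+1" | a' where "a = n+1+a'" "a' < n"
  using assms by (cases "a < n+1") (auto intro: that(2)[of "a-(n+1)"])

lemma eps_square [simp]: "eps n k a * eps n k a = 1"
  by (simp add: eps_def)

lemma eps_square' [simp]: "eps n k a * (eps n k a * t) = t"
  by (simp add: eps_def)

lemma eps_nz [simp]: "eps n k a \<noteq> 0"
  by (simp add: eps_def)

lemma Gd_square: "Gd n k a * Gd n k a = 1"
  by (simp add: Gd_def flip: of_real_mult)

lemma smooth_on_if:
  "(c \<Longrightarrow> smooth_on U f) \<Longrightarrow> (\<not> c \<Longrightarrow> smooth_on U g) \<Longrightarrow> smooth_on U (\<lambda>x. if c then f x else g x)"
  by (cases c) simp_all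

text \<open>A and B are parallel frames of omega and tau. The orthogonality assumptions give A^-1 =
  A^T and B^-1 = J B^T J, and \<open>pd_Y\<close> is the upper right block of Phi eta Phi^-1 written
  with this inverse.\<close>

locale moving_frame =
  fixes D :: "(real^('n::{finite,linorder})) set" and k :: nat and x0 :: "(real,'n) vec"
    and A B :: "(real,'n) vec \<Rightarrow> nat \<Rightarrow> nat \<Rightarrow> real"
    and F :: "(real,'n) vec \<Rightarrow> nat \<Rightarrow> nat \<Rightarrow> real" and g :: "(real,'n) vec \<Rightarrow> nat \<Rightarrow> real"
    and Y :: "(real,'n) vec \<Rightarrow> nat \<Rightarrow> nat \<Rightarrow> real" and n N :: nat
  assumes n: "n = CARD('n)" and N: "N = 2*n+1"
    and D: "open D" "simply_connected D" "x0 \<in> D"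
    and A_smooth: "a < n+1 \<Longrightarrow> b < n+1 \<Longrightarrow> smooth_on D (\<lambda>x. A x a b)"
    and B_smooth: "a < n \<Longrightarrow> b < n \<Longrightarrow> smooth_on D (\<lambda>x. B x a b)"
    and Y_smooth: "a < n+1 \<Longrightarrow> b < n \<Longrightarrow> smooth_on D (\<lambda>x. Y x a b)"
    and A_orth: "x \<in> D \<Longrightarrow> a < n+1 \<Longrightarrow> b < n+1 \<Longrightarrow> (\<Sum>c<n+1. A x c a * A x c b) = (if a = b then 1 else 0)"
    and B_orth: "x \<in> D \<Longrightarrow> a < n \<Longrightarrow> b < n \<Longrightarrow> (\<Sum>c<n. eps n k c * (B x c a * B x c b)) = (if a = b then eps n k a else 0)"
    and pd_A: "x \<in> D \<Longrightarrow> j < n \<Longrightarrow> a < n+1 \<Longrightarrow> b < n+1 \<Longrightarrow> pd j (\<lambda>y. A y a b) x = (\<Sum>c<n+1. A x a c * omega n k (F x) (g x) j c b)"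
    and pd_B: "x \<in> D \<Longrightarrow> j < n \<Longrightarrow> a < n \<Longrightarrow> b < n \<Longrightarrow> pd j (\<lambda>y. B y a b) x = (\<Sum>c<n. B x a c * tau n k (F x) j c b)"
    and pd_Y: "x \<in> D \<Longrightarrow> j < n \<Longrightarrow> a < n+1 \<Longrightarrow> b < n \<Longrightarrow> pd j (\<lambda>y. Y y a b) x = - (A x a j * B x b j * eps n k b)"
    and Y_x0: "a < n+1 \<Longrightarrow> b < n \<Longrightarrow> Y x0 a b = 0"
begin

section \<open>The exact form dZ and the symmetries of its solution\<close>

lemma sum_N: "(\<Sum>c<N. f c) = (\<Sum>c<n+1. f c) + (\<Sum>c<n. f (n+1+c))" for f :: "nat \<Rightarrow> 'b::comm_monoid_add"
  unfolding N by (rule sum_blocks)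

lemma N_cases:
  fixes a :: nat
  assumes "a < N"
  obtains "a < n+1" | a' where "a = n+1+a'" "a' < n"
  using block_cases[of a n] assms N by auto

definition Z :: "(real,'n) vec \<Rightarrow> nat \<Rightarrow> nat \<Rightarrow> real" where
  "Z x a b = (if a < n+1 then (if b < n+1 then 0 else Y x a (b-(n+1)))
    else (if b < n+1 then - eps n k (a-(n+1)) * Y x b (a-(n+1)) else 0))"

definition dZ :: "nat \<Rightarrow> (real,'n) vec \<Rightarrow> nat \<Rightarrow> nat \<Rightarrow> real" where
  "dZ j x a b = (if a < n+1 then (if b < n+1 then 0 else - (A x a j * B x (b-(n+1)) j * eps n k (b-(n+1))))
    else (if b < n+1 then B x (a-(n+1)) j * A x b j else 0))"

lemma Z_smooth: "a < N \<Longrightarrow> b < N \<Longrightarrow> smooth_on D (\<lambda>x. Z x a b)"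
  unfolding Z_def using D(1)
  by (intro smooth_on_if smooth_on_mult smooth_on_const Y_smooth) (auto simp: N)

lemma dZ_smooth: "j < n \<Longrightarrow> a < N \<Longrightarrow> b < N \<Longrightarrow> smooth_on D (\<lambda>x. dZ j x a b)"
  unfolding dZ_def using D(1)
  by (intro smooth_on_if smooth_on_uminus smooth_on_mult smooth_on_const A_smooth B_smooth) (auto simp: N)

lemma pd_Z:
  assumes "x \<in> D" "j < n" "a < N" "b < N"
  shows "pd j (\<lambda>x. Z x a b) x = dZ j x a b"
proof (cases "a < n+1")
  case a: True
  show ?thesis
  proof (cases "b < n+1")
    case True
    with a show ?thesis by (simp add: Z_def dZ_def)
  next
    case False
    then have "b-(n+1) < n" using assms by (auto simp: N)
    with a False show ?thesis using pd_Y[OF assms(1,2) a, of "b-(n+1)"] by (simp add: Z_def dZ_def)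
  qed
next
  case a: False
  then have a': "a-(n+1) < n" using assms by (auto simp: N)
  show ?thesis
  proof (cases "b < n+1")
    case True
    have "pd j (\<lambda>x. - eps n k (a-(n+1)) * Y x b (a-(n+1))) x = - eps n k (a-(n+1)) * pd j (\<lambda>x. Y x b (a-(n+1))) x"
      by (rule pd_cmult[OF D(1) Y_smooth[OF True a'] assms(1)])
    with a True show ?thesis using pd_Y[OF assms(1,2) True a'] by (simp add: Z_def dZ_def mult_ac)
  next
    case False
    with a show ?thesis by (simp add: Z_def dZ_def)
  qed
qed

definition dZ_square :: "nat \<Rightarrow> (real,'n) vec \<Rightarrow> nat \<Rightarrow> nat \<Rightarrow> real" where
  "dZ_square i x a b = (if a < n+1 then (if b < n+1 then - (A x a i * A x b i * eps n k i) else 0)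
    else (if b < n+1 then 0 else - (B x (a-(n+1)) i * B x (b-(n+1)) i * eps n k (b-(n+1)))))"

text \<open>Each block of \<open>dZ i\<close> is the outer product of the i-th columns of A and B,
  up to J. In a product of two coefficients the summed index leaves the inner product of columns i
  and j, Lorentzian for B and Euclidean for A.\<close>

lemma dZ_mult:
  assumes "x \<in> D" "i < n" "j < n" "a < N" "b < N"
  shows "(\<Sum>c<N. dZ i x a c * dZ j x c b) = (if i = j then dZ_square i x a b else 0)"
proof (cases rule: N_cases[OF assms(4), case_names 1 2])
  case a: 1
  show ?thesis
  proof (cases rule: N_cases[OF assms(5), case_names 1 2])
    case b: 1
    have "(\<Sum>c<N. dZ i x a c * dZ j x c b) = (\<Sum>c<n. - (A x a i * A x b j) * (eps n k c * (B x c i * B x c j)))"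
      unfolding sum_N using a b by (simp add: dZ_def mult_ac)
    also have "\<dots> = - (A x a i * A x b j) * (if i = j then eps n k i else 0)"
      unfolding sum_distrib_left[symmetric] B_orth[OF assms(1-3)] ..
    finally show ?thesis using a b by (auto simp: dZ_square_def)
  next
    case (2 b')
    with a show ?thesis unfolding sum_N by (simp add: dZ_def dZ_square_def)
  qed
next
  case a: (2 a')
  show ?thesis
  proof (cases rule: N_cases[OF assms(5), case_names 1 2])
    case b: 1
    with a show ?thesis unfolding sum_N by (simp add: dZ_def dZ_square_def)
  next
    case b: (2 b')
    have "(\<Sum>c<N. dZ i x a c * dZ j x c b) = (\<Sum>c<n+1. - (B x a' i * B x b' j * eps n k b') * (A x c i * A x c j))"
      unfolding sum_N using a b by (simp add: dZ_def mult_ac del: sum.lessThan_Suc)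
    also have "\<dots> = - (B x a' i * B x b' j * eps n k b') * (if i = j then 1 else 0)"
      unfolding sum_distrib_left[symmetric] using assms(2,3) by (subst A_orth[OF assms(1)]) auto
    finally show ?thesis using a b by (auto simp: dZ_square_def)
  qed
qed

text \<open>Closedness holds because the coefficients are partial derivatives of Z; they commute
  because distinct ones multiply to zero in either order.\<close>

sublocale commuting_form D "N" dZ x0
proof
  fix x i j a b assume *: "x \<in> D" "i < CARD('n)" "j < CARD('n)" "a < N" "b < N"
  then have ij: "i < n" "j < n" by (simp_all add: n)
  have "pd i (\<lambda>x. dZ j x a b) x = pd i (pd j (\<lambda>x. Z x a b)) x"
    by (rule pd_cong[OF D(1) *(1)]) (rule pd_Z[symmetric, OF _ ij(2) *(4,5)])
  also have "\<dots> = pd j (pd i (\<lambda>x. Z x a b)) x" by (rule pd_commute[OF D(1) Z_smooth[OF *(4,5)] *(1)])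
  also have "\<dots> = pd j (\<lambda>x. dZ i x a b) x"
    by (rule pd_cong[OF D(1) *(1)]) (rule pd_Z[OF _ ij(1) *(4,5)])
  finally show "pd i (\<lambda>x. dZ j x a b) x = pd j (\<lambda>x. dZ i x a b) x" .
  show "(\<Sum>c<N. dZ i x a c * dZ j x c b) = (\<Sum>c<N. dZ j x a c * dZ i x c b)"
    unfolding dZ_mult[OF *(1) ij(1,2) *(4,5)] dZ_mult[OF *(1) ij(2,1) *(4,5)] by simp
qed (use D dZ_smooth n in auto)

text \<open>As \<open>H 0\<close> is the identity, both sides have partial derivatives
  \<open>dZ\<close>; both vanish at x0.\<close>

lemma H_1:
  assumes "x \<in> D" "a < N" "b < N"
  shows "H 1 x a b = Z x a b"
proof -
  have "H 1 x a b - Z x a b = H 1 x0 a b - Z x0 a b"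
  proof (rule pd_zero_imp_constant[OF D(1) connected_D _ _ assms(1) D(3)])
    show "smooth_on D (\<lambda>x. H 1 x a b - Z x a b)"
      by (intro smooth_on_diff D(1) H_smooth Z_smooth assms)
    fix j x assume j: "j < CARD('n)" and x: "x \<in> D"
    have "pd j (\<lambda>x. H 1 x a b + - Z x a b) x = pd j (\<lambda>x. H 1 x a b) x + pd j (\<lambda>x. - Z x a b) x"
      by (intro pd_add[OF D(1)] H_smooth smooth_on_uminus D(1) Z_smooth assms x)
    also have "pd j (\<lambda>x. H 1 x a b) x = dZ j x a b"
      using pd_H_Suc[OF assms(2,3) x j, of 0] assms by (simp add: H_0 sum_delta_mult)
    also have "pd j (\<lambda>x. - Z x a b) x = - pd j (\<lambda>x. Z x a b) x"
      by (rule pd_uminus[OF D(1) Z_smooth[OF assms(2,3)] x])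
    also have "pd j (\<lambda>x. Z x a b) x = dZ j x a b" using pd_Z[OF x _ assms(2,3)] j n by simp
    finally show "pd j (\<lambda>x. H 1 x a b - Z x a b) x = 0" by simp
  qed
  moreover have "H 1 x0 a b = 0" using H_Suc_x0[OF assms(2,3), of 0] by simp
  moreover have "Z x0 a b = 0" using assms by (auto simp: Z_def N intro!: Y_x0)
  ultimately show ?thesis by simp
qed

text \<open>Multiplying by \<open>dZ\<close> exchanges the two blocks, so even iterated integrals
  are block diagonal and odd ones block off-diagonal. This is what makes the solution respect l to
  -l.\<close>

lemma H_parity:
  assumes "x \<in> D" "a < N" "b < N" "odd m \<longleftrightarrow> (a < n+1 \<longleftrightarrow> b < n+1)"
  shows "H m x a b = 0"
  using assms
proof (induction m arbitrary: x b)
  case 0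
  then show ?case by (auto simp: H_0)
next
  case (Suc m)
  have "H (Suc m) x a b = H (Suc m) x0 a b"
  proof (rule pd_zero_imp_constant[OF D(1) connected_D H_smooth[OF Suc.prems(2,3)] _ Suc.prems(1) D(3)])
    fix j x assume j: "j < CARD('n)" and x: "x \<in> D"
    have "H m x a c * dZ j x c b = 0" if "c < N" for c
    proof (cases "c < n+1 \<longleftrightarrow> b < n+1")
      case True
      then show ?thesis by (auto simp: dZ_def)
    next
      case False
      then show ?thesis using Suc.IH[OF x Suc.prems(2) that] Suc.prems(4) by auto
    qed
    then have "(\<Sum>c<N. H m x a c * dZ j x c b) = 0" by (intro sum.neutral) blast
    then show "pd j (\<lambda>x. H (Suc m) x a b) x = 0" using pd_H_Suc[OF Suc.prems(2,3) x j] by simp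
  qed
  then show ?case using H_Suc_x0[OF Suc.prems(2,3)] by simp
qed

lemma sg_sol:
  assumes "x \<in> D" "a < N" "b < N"
  shows "sg n a * sol x (-l) a b * sg n b = sol x l a b"
proof -
  note summ = summable_series[OF assms geometric_growth_1, of 0 "-l"]
  have "sg n a * sol x (-l) a b * sg n b = (\<Sum>m. sg n a * (of_real (1 * H (m + 0) x a b) * (-l) ^ m) * sg n b)"
    unfolding sol_def series_def suminf_mult[OF summ, symmetric] by (rule suminf_mult2[OF summable_mult[OF summ]])
  also have "\<dots> = (\<Sum>m. of_real (1 * H (m + 0) x a b) * l ^ m)"
  proof (rule suminf_cong)
    fix m
    show "sg n a * (of_real (1 * H (m + 0) x a b) * (-l) ^ m) * sg n b = of_real (1 * H (m + 0) x a b) * l ^ m"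
      using H_parity[OF assms, of m] by (cases "a < n+1"; cases "b < n+1"; cases "even m") (auto simp: sg_def)
  qed
  finally show ?thesis by (simp add: sol_def series_def)
qed

lemma sol_smooth_fixed:
  assumes "a < N" "b < N"
  shows "smooth_on D (\<lambda>x. sol x l a b)"
proof -
  have "((\<lambda>x::(real,'n) vec. (x, l)) has_derivative (\<lambda>h. (h, 0))) (at x)" for x
    by (auto intro!: derivative_eq_intros)
  from smooth_on_compose_affine[OF _ D(1) this _ sol_smooth[OF assms]] show ?thesis
    using D(1) by (auto simp: open_Times)
qed

text \<open>The condition dZ G + G dZ^T = 0, by which dZ takes values in the Lie algebra of the
  group that preserves G, as G = G^-1.\<close>

lemma dZ_skew:
  assumes "a < N" "b < N"
  shows "of_real (dZ j x a b) * Gd n k b + Gd n k a * of_real (dZ j x b a) = 0"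
  using assms by (auto simp: dZ_def Gd_def not_less_eq_eq simp flip: of_real_mult of_real_add)

text \<open>Since dZ acts on the right of X, the derivative of X G X^T contains dZ G + G dZ^T in the
  middle and vanishes. Hence rows come first; the condition on columns follows by inverting.\<close>

lemma sol_orth_rows:
  assumes "x \<in> D" "a < N" "b < N"
  shows "(\<Sum>c<N. sol x l a c * Gd n k c * sol x l b c) = (if a = b then Gd n k a else 0)"
proof -
  let ?N = N
  let ?P = "\<lambda>x. \<Sum>c<?N. Gd n k c * (sol x l a c * sol x l b c)"
  have "?P x = ?P x0"
  proof (rule pd_zero_imp_constant[OF D(1) connected_D _ _ assms(1) D(3)])
    show "smooth_on D ?P"
      using assms D(1) by (intro smooth_on_sum smooth_on_mult smooth_on_const sol_smooth_fixed) auto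
    fix j x assume j: "j < CARD('n)" and x: "x \<in> D"
    let ?s = "\<lambda>a b. sol x l a b" and ?w = "\<lambda>a b. complex_of_real (dZ j x a b)"
    have "pd j ?P x = (\<Sum>c<?N. pd j (\<lambda>x. Gd n k c * (sol x l a c * sol x l b c)) x)"
      using assms D(1) x by (intro pd_sum smooth_on_mult smooth_on_const) (auto intro!: sol_smooth_fixed)
    also have "\<dots> = (\<Sum>c<?N. Gd n k c * (?s a c * (l * (\<Sum>d<?N. ?s b d * ?w d c)) + l * (\<Sum>d<?N. ?s a d * ?w d c) * ?s b c))"
    proof (rule sum.cong[OF refl])
      fix c assume "c \<in> {..<?N}"
      then have c: "c < ?N" by simp
      note sm = sol_smooth_fixed[OF assms(2) c] sol_smooth_fixed[OF assms(3) c]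
      show "pd j (\<lambda>x. Gd n k c * (sol x l a c * sol x l b c)) x =
        Gd n k c * (?s a c * (l * (\<Sum>d<?N. ?s b d * ?w d c)) + l * (\<Sum>d<?N. ?s a d * ?w d c) * ?s b c)"
        using pd_cmult[OF D(1) smooth_on_mult[OF D(1) sm] x] pd_mult[OF D(1) sm x]
          pd_sol[OF x assms(2) c j] pd_sol[OF x assms(3) c j] by simp
    qed
    also have "\<dots> = l * ((\<Sum>c<?N. \<Sum>d<?N. ?s a c * ?s b d * (Gd n k c * ?w d c)) + (\<Sum>c<?N. \<Sum>d<?N. ?s a d * ?s b c * (Gd n k c * ?w d c)))"
      by (simp add: sum_distrib_left sum_distrib_right sum.distrib algebra_simps del: sum.lessThan_Suc)
    also have "(\<Sum>c<?N. \<Sum>d<?N. ?s a d * ?s b c * (Gd n k c * ?w d c)) = (\<Sum>c<?N. \<Sum>d<?N. ?s a c * ?s b d * (?w c d * Gd n k d))"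
      by (subst sum.swap) (simp add: mult.commute del: sum.lessThan_Suc)
    also have "(\<Sum>c<?N. \<Sum>d<?N. ?s a c * ?s b d * (Gd n k c * ?w d c)) + \<dots> =
        (\<Sum>c<?N. \<Sum>d<?N. ?s a c * ?s b d * (?w c d * Gd n k d + Gd n k c * ?w d c))"
      by (simp add: sum.distrib[symmetric] algebra_simps del: sum.lessThan_Suc)
    also have "\<dots> = 0" by (intro sum.neutral ballI) (simp add: dZ_skew)
    finally show "pd j ?P x = 0" by simp
  qed
  also have "?P x0 = (\<Sum>c<?N. if c = a then (if a = b then Gd n k a else 0) else 0)"
    using assms by (intro sum.cong refl) (auto simp: sol_x0)
  also have "\<dots> = (if a = b then Gd n k a else 0)" using assms by simp
  finally show ?thesis by (simp add: mult_ac del: sum.lessThan_Suc)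
qed

lemma sol_orth:
  assumes "x \<in> D" "a < N" "b < N"
  shows "(\<Sum>c<N. sol x l c a * Gd n k c * sol x l c b) = (if a = b then Gd n k a else 0)"
proof -
  let ?N = N
  \<comment> \<open>This type has exactly 2n + 1 elements. The inverse of X used below is G X^T
    G.\<close>
  obtain e :: "nat \<Rightarrow> ('n + 'n) option" where e: "bij_betw e {..<?N} UNIV"
  proof -
    have "card {..<?N} = card (UNIV :: ('n + 'n) option set)" by (simp add: N n card_UNIV_sum)
    from finite_same_card_bij[OF finite_lessThan finite this] that show ?thesis by blast
  qed
  have "(\<Sum>c<?N. sol x l a c * (Gd n k c * sol x l b c * Gd n k b)) = (if a = b then 1 else 0)" if "a < ?N" "b < ?N" for a b
  proof -
    have "(\<Sum>c<?N. sol x l a c * (Gd n k c * sol x l b c * Gd n k b)) = (\<Sum>c<?N. sol x l a c * Gd n k c * sol x l b c) * Gd n k b"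
      unfolding sum_distrib_right by (simp add: mult.assoc del: sum.lessThan_Suc)
    then show ?thesis by (simp add: sol_orth_rows[OF assms(1) that] Gd_square del: sum.lessThan_Suc)
  qed
  from left_inverse_imp_right_inverse[OF e this assms(2,3)]
  have *: "(\<Sum>c<?N. Gd n k a * sol x l c a * Gd n k c * sol x l c b) = (if a = b then 1 else 0)" .
  have "(\<Sum>c<?N. sol x l c a * Gd n k c * sol x l c b) = Gd n k a * (\<Sum>c<?N. Gd n k a * sol x l c a * Gd n k c * sol x l c b)"
    unfolding sum_distrib_left mult.assoc[symmetric] Gd_square by simp
  then show ?thesis unfolding * by simp
qed

section \<open>Assembly and verification of the extended frame\<close>

definition frame :: "(real,'n) vec \<Rightarrow> nat \<Rightarrow> nat \<Rightarrow> real" where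
  "frame x a b = (if a < n+1 then (if b < n+1 then A x a b else 0)
    else (if b < n+1 then 0 else B x (a-(n+1)) (b-(n+1))))"

definition E :: "(real,'n) vec \<Rightarrow> complex \<Rightarrow> nat \<Rightarrow> nat \<Rightarrow> complex" where
  "E x l a b = (\<Sum>c<N. sol x l a c * of_real (frame x c b))"

lemma frame_smooth: "a < N \<Longrightarrow> b < N \<Longrightarrow> smooth_on D (\<lambda>x. frame x a b)"
  unfolding frame_def using D(1) by (intro smooth_on_if smooth_on_const A_smooth B_smooth) (auto simp: N)

lemma frame_orth:
  assumes "x \<in> D" "a < N" "b < N"
  shows "(\<Sum>c<N. of_real (frame x c a) * (Gd n k c * of_real (frame x c b))) = (if a = b then Gd n k a else 0)"
proof (cases rule: N_cases[OF assms(2), case_names 1 2])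
  case a: 1
  show ?thesis
  proof (cases rule: N_cases[OF assms(3), case_names 1 2])
    case b: 1
    have "(\<Sum>c<N. of_real (frame x c a) * (Gd n k c * of_real (frame x c b))) = complex_of_real (\<Sum>c<n+1. A x c a * A x c b)"
      unfolding sum_N using a b by (simp add: frame_def Gd_def del: sum.lessThan_Suc)
    then show ?thesis unfolding A_orth[OF assms(1) a b] using a b by (auto simp: Gd_def)
  next
    case b: (2 b')
    with a show ?thesis unfolding sum_N by (simp add: frame_def)
  qed
next
  case a: (2 a')
  show ?thesis
  proof (cases rule: N_cases[OF assms(3), case_names 1 2])
    case b: 1
    with a show ?thesis unfolding sum_N by (simp add: frame_def)
  next
    case b: (2 b')
    have "(\<Sum>c<N. of_real (frame x c a) * (Gd n k c * of_real (frame x c b))) = complex_of_real (\<Sum>c<n. eps n k c * (B x c a' * B x c b'))"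
      unfolding sum_N using a b by (simp add: frame_def Gd_def mult_ac)
    then show ?thesis using B_orth[OF assms(1) a(2) b(2)] a b by (auto simp: Gd_def)
  qed
qed

text \<open>E^T G E = Phi^T (X^T G X) Phi, so X and Phi can be dealt with separately.\<close>

lemma in_Ogroup_E:
  assumes "x \<in> D"
  shows "in_Ogroup n k (E x l)"
  unfolding in_Ogroup_def N[symmetric]
proof (intro allI impI)
  fix a b assume ab: "a < N" "b < N"
  let ?N = N and ?p = "\<lambda>a b. complex_of_real (frame x a b)" and ?s = "sol x l"
  have "(\<Sum>c<?N. E x l c a * Gd n k c * E x l c b) = (\<Sum>c<?N. \<Sum>d<?N. \<Sum>e<?N. ?p d a * ?p e b * (?s c d * Gd n k c * ?s c e))"
  proof (rule sum.cong[OF refl])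
    fix c
    have "E x l c a * Gd n k c * E x l c b = Gd n k c * (E x l c a * E x l c b)" by (simp add: mult_ac)
    also have "\<dots> = (\<Sum>d<?N. \<Sum>e<?N. ?p d a * ?p e b * (?s c d * Gd n k c * ?s c e))"
      unfolding E_def sum_product unfolding sum_distrib_left by (intro sum.cong refl) (simp add: mult_ac)
    finally show "E x l c a * Gd n k c * E x l c b = (\<Sum>d<?N. \<Sum>e<?N. ?p d a * ?p e b * (?s c d * Gd n k c * ?s c e))" .
  qed
  also have "\<dots> = (\<Sum>d<?N. \<Sum>e<?N. \<Sum>c<?N. ?p d a * ?p e b * (?s c d * Gd n k c * ?s c e))"
    by (subst sum.swap) (rule sum.cong[OF refl], rule sum.swap)
  also have "\<dots> = (\<Sum>d<?N. \<Sum>e<?N. ?p d a * ?p e b * (if d = e then Gd n k d else 0))"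
    unfolding sum_distrib_left[symmetric] using sol_orth[OF assms] by (intro sum.cong refl) simp
  also have "\<dots> = (\<Sum>d<?N. ?p d a * (Gd n k d * ?p d b))"
    by (intro sum.cong refl) (simp add: if_distrib[of "\<lambda>t. _ * t"] mult_ac cong: if_cong del: sum.lessThan_Suc)
  also have "\<dots> = (if a = b then Gd n k a else 0)" by (rule frame_orth[OF assms ab])
  finally show "(\<Sum>c<?N. E x l c a * Gd n k c * E x l c b) = (if a = b then Gd n k a else 0)" .
qed

text \<open>The gauge identity l dZ Phi + dPhi = Phi theta. Its off-diagonal blocks carry the l-part
  and follow from orthogonality of A and B; its diagonal blocks are the equations
  \<open>pd_A\<close> and \<open>pd_B\<close>.\<close>

lemma frame_theta:
  assumes "x \<in> D" "j < n" "a < N" "b < N"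
  shows "l * (\<Sum>c<N. of_real (dZ j x a c) * of_real (frame x c b)) + of_real (pd j (\<lambda>x. frame x a b) x) =
    (\<Sum>c<N. of_real (frame x a c) * theta n k l (F x) (g x) j c b)"
proof (cases rule: N_cases[OF assms(3), case_names 1 2])
  case a: 1
  show ?thesis
  proof (cases rule: N_cases[OF assms(4), case_names 1 2])
    case b: 1
    have "(\<Sum>c<N. of_real (dZ j x a c) * complex_of_real (frame x c b)) = 0"
      unfolding sum_N using a b by (simp add: dZ_def frame_def)
    moreover have "(\<Sum>c<N. of_real (frame x a c) * theta n k l (F x) (g x) j c b) =
        of_real (\<Sum>c<n+1. A x a c * omega n k (F x) (g x) j c b)"
      unfolding sum_N using a b by (simp add: frame_def theta_def del: sum.lessThan_Suc)
    moreover have "(\<lambda>x. frame x a b) = (\<lambda>x. A x a b)" using a b by (simp add: frame_def)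
    ultimately show ?thesis using pd_A[OF assms(1,2) a b] by simp
  next
    case b: (2 b')
    have "(\<Sum>c<N. of_real (dZ j x a c) * complex_of_real (frame x c b)) =
        of_real (\<Sum>c<n. - A x a j * (eps n k c * (B x c j * B x c b')))"
      unfolding sum_N using a b by (simp add: dZ_def frame_def mult_ac)
    also have "(\<Sum>c<n. - A x a j * (eps n k c * (B x c j * B x c b'))) = - A x a j * (if j = b' then eps n k j else 0)"
      unfolding sum_distrib_left[symmetric] B_orth[OF assms(1,2) b(2)] ..
    finally have 1: "(\<Sum>c<N. of_real (dZ j x a c) * complex_of_real (frame x c b)) = of_real (- A x a j * (if j = b' then eps n k j else 0))" .
    have "(\<Sum>c<N. of_real (frame x a c) * theta n k l (F x) (g x) j c b) =
        (\<Sum>c<n+1. if c = j then of_real (A x a j) * (if b' = j then - l * of_real (eps n k j) else 0) else 0)"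
    proof -
      have "(\<Sum>c<n. complex_of_real (frame x a (n+1+c)) * theta n k l (F x) (g x) j (n+1+c) b) = 0"
        using a by (simp add: frame_def)
      moreover have "(\<Sum>c<n+1. complex_of_real (frame x a c) * theta n k l (F x) (g x) j c b) =
          (\<Sum>c<n+1. if c = j then of_real (A x a j) * (if b' = j then - l * of_real (eps n k j) else 0) else 0)"
        using a b by (intro sum.cong refl) (auto simp: frame_def theta_def)
      ultimately show ?thesis unfolding sum_N by simp
    qed
    also have "\<dots> = of_real (A x a j) * (if b' = j then - l * of_real (eps n k j) else 0)"
      using assms(2) by (subst sum.delta) auto
    finally show ?thesis unfolding 1 using a b by (simp add: frame_def)
  qed
next
  case a: (2 a')
  show ?thesis
  proof (cases rule: N_cases[OF assms(4), case_names 1 2])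
    case b: 1
    have "(\<Sum>c<N. of_real (dZ j x a c) * complex_of_real (frame x c b)) =
        of_real (\<Sum>c<n+1. B x a' j * (A x c j * A x c b))"
      unfolding sum_N using a b by (simp add: dZ_def frame_def mult_ac del: sum.lessThan_Suc)
    also have "(\<Sum>c<n+1. B x a' j * (A x c j * A x c b)) = B x a' j * (if j = b then 1 else 0)"
      unfolding sum_distrib_left[symmetric] using assms(2) b by (subst A_orth[OF assms(1)]) auto
    finally have 1: "(\<Sum>c<N. of_real (dZ j x a c) * complex_of_real (frame x c b)) = of_real (B x a' j * (if j = b then 1 else 0))" .
    have "(\<Sum>c<N. of_real (frame x a c) * theta n k l (F x) (g x) j c b) =
        (\<Sum>c<n. if c = j then of_real (B x a' j) * (if b = j then l else 0) else 0)"
    proof -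
      have "(\<Sum>c<n+1. complex_of_real (frame x a c) * theta n k l (F x) (g x) j c b) = 0"
        using a by (intro sum.neutral) (simp add: frame_def)
      moreover have "(\<Sum>c<n. complex_of_real (frame x a (n+1+c)) * theta n k l (F x) (g x) j (n+1+c) b) =
          (\<Sum>c<n. if c = j then of_real (B x a' j) * (if b = j then l else 0) else 0)"
        using a b by (intro sum.cong refl) (auto simp: frame_def theta_def)
      ultimately show ?thesis unfolding sum_N by simp
    qed
    also have "\<dots> = of_real (B x a' j) * (if b = j then l else 0)"
      using assms(2) by (subst sum.delta) auto
    finally show ?thesis unfolding 1 using a b by (simp add: frame_def)
  next
    case b: (2 b')
    have "(\<Sum>c<N. of_real (dZ j x a c) * complex_of_real (frame x c b)) = 0"
      unfolding sum_N using a b by (simp add: dZ_def frame_def)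
    moreover have "(\<Sum>c<N. of_real (frame x a c) * theta n k l (F x) (g x) j c b) =
        of_real (\<Sum>c<n. B x a' c * tau n k (F x) j c b')"
      unfolding sum_N using a b by (simp add: frame_def theta_def)
    moreover have "(\<lambda>x. frame x a b) = (\<lambda>x. B x a' b')" using a b by (simp add: frame_def)
    ultimately show ?thesis using pd_B[OF assms(1,2) a(2) b(2)] by simp
  qed
qed

text \<open>For E = X Phi the product rule gives l X dZ Phi + X dPhi, which
  \<open>frame_theta\<close> rewrites as X Phi theta.\<close>

lemma pd_E:
  assumes "x \<in> D" "j < n" "a < N" "b < N"
  shows "pd j (\<lambda>y. E y l a b) x = (\<Sum>c<N. E x l a c * theta n k l (F x) (g x) j c b)"
proof -
  let ?N = N
  have fs: "smooth_on D (\<lambda>x. complex_of_real (frame x c b))" if "c < ?N" for c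
    using bounded_linear.smooth_on_linear[OF bounded_linear_of_real D(1) frame_smooth[OF that assms(4)]] .
  have "pd j (\<lambda>y. E y l a b) x = (\<Sum>c<?N. pd j (\<lambda>y. sol y l a c * of_real (frame y c b)) x)"
    unfolding E_def using assms D(1) by (intro pd_sum smooth_on_mult) (auto intro!: sol_smooth_fixed fs)
  also have "\<dots> = (\<Sum>c<?N. sol x l a c * of_real (pd j (\<lambda>y. frame y c b) x) + l * (\<Sum>d<?N. sol x l a d * of_real (dZ j x d c)) * of_real (frame x c b))"
  proof (rule sum.cong[OF refl])
    fix c assume "c \<in> {..<?N}"
    then have c: "c < ?N" by simp
    show "pd j (\<lambda>y. sol y l a c * of_real (frame y c b)) x =
      sol x l a c * of_real (pd j (\<lambda>y. frame y c b) x) + l * (\<Sum>d<?N. sol x l a d * of_real (dZ j x d c)) * of_real (frame x c b)"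
      unfolding pd_mult[OF D(1) sol_smooth_fixed[OF assms(3) c] fs[OF c] assms(1)] pd_sol[OF assms(1,3) c assms(2)[unfolded n]]
        bounded_linear.pd_linear[OF bounded_linear_of_real D(1) frame_smooth[OF c assms(4)] assms(1)] ..
  qed
  also have "\<dots> = (\<Sum>c<?N. sol x l a c * of_real (pd j (\<lambda>y. frame y c b) x)) +
      (\<Sum>c<?N. \<Sum>d<?N. l * (sol x l a d * of_real (dZ j x d c) * of_real (frame x c b)))"
    by (simp add: sum.distrib sum_distrib_left sum_distrib_right mult.assoc del: sum.lessThan_Suc)
  also have "(\<Sum>c<?N. \<Sum>d<?N. l * (sol x l a d * of_real (dZ j x d c) * of_real (frame x c b))) =
      (\<Sum>d<?N. \<Sum>c<?N. l * (sol x l a d * of_real (dZ j x d c) * of_real (frame x c b)))" by (rule sum.swap)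
  also have "(\<Sum>c<?N. sol x l a c * of_real (pd j (\<lambda>y. frame y c b) x)) + \<dots> =
      (\<Sum>d<?N. sol x l a d * (l * (\<Sum>c<?N. of_real (dZ j x d c) * of_real (frame x c b)) + of_real (pd j (\<lambda>y. frame y d b) x)))"
    by (simp add: sum.distrib sum_distrib_left distrib_left mult_ac del: sum.lessThan_Suc)
  also have "\<dots> = (\<Sum>d<?N. sol x l a d * (\<Sum>c<?N. of_real (frame x d c) * theta n k l (F x) (g x) j c b))"
    by (rule sum.cong[OF refl]) (simp only: frame_theta[OF assms(1,2) _ assms(4)] lessThan_iff)
  also have "\<dots> = (\<Sum>c<?N. E x l a c * theta n k l (F x) (g x) j c b)"
    unfolding E_def sum_distrib_left sum_distrib_right mult.assoc by (rule sum.swap)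
  finally show ?thesis .
qed

lemma E_at_0: "a < N \<Longrightarrow> E x 0 a b = of_real (frame x a b)"
  unfolding E_def by (simp only: sol_at_0 sum_delta_mult)

lemma E_has_field_derivative:
  assumes "x \<in> D" "a < N"
  shows "((\<lambda>l. E x l a b) has_field_derivative (\<Sum>c<N. series (dcoeff (\<lambda>_. 1)) (Suc 0) a c x l * of_real (frame x c b))) (at l)"
  unfolding E_def using assms by (intro DERIV_sum DERIV_cmult_right sol_has_field_derivative) auto

text \<open>Phi does not depend on l and X is the identity at l = 0, so the l-derivative of E there
  is \<open>H 1\<close> times E. Multiplying by E on the right spares its inverse.\<close>

lemma deriv_E_0:
  assumes "x \<in> D" "a < N" "b < N"
  shows "(\<Sum>d<N. Mblock n k (\<lambda>a b. of_real (Y x a b)) a d * E x 0 d b) = deriv (\<lambda>l. E x l a b) 0"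
proof -
  have "deriv (\<lambda>l. E x l a b) 0 = (\<Sum>c<N. series (dcoeff (\<lambda>_. 1)) (Suc 0) a c x 0 * of_real (frame x c b))"
    by (rule DERIV_imp_deriv[OF E_has_field_derivative[OF assms(1,2)]])
  also have "\<dots> = (\<Sum>c<N. Mblock n k (\<lambda>a b. of_real (Y x a b)) a c * E x 0 c b)"
  proof (rule sum.cong[OF refl])
    fix c assume "c \<in> {..<N}"
    then have c: "c < N" by simp
    have "series (dcoeff (\<lambda>_. 1)) (Suc 0) a c x 0 = of_real (H 1 x a c)"
      using deriv_sol_0[OF assms(1,2) c] DERIV_imp_deriv[OF sol_has_field_derivative[OF assms(1,2) c, of 0]] by simp
    also have "\<dots> = Mblock n k (\<lambda>a b. of_real (Y x a b)) a c"
      unfolding H_1[OF assms(1,2) c] by (auto simp: Z_def Mblock_def)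
    finally show "series (dcoeff (\<lambda>_. 1)) (Suc 0) a c x 0 * of_real (frame x c b) = Mblock n k (\<lambda>a b. of_real (Y x a b)) a c * E x 0 c b"
      using E_at_0[OF c] by simp
  qed
  finally show ?thesis by simp
qed

lemma ext_frame_E: "ext_frame D k F g E"
  unfolding ext_frame_def Let_def n[symmetric] N[symmetric]
proof (intro conjI allI ballI impI)
  fix a b assume ab: "a < N" "b < N"
  have DU: "open (D \<times> (UNIV :: complex set))" using D(1) by (simp add: open_Times)
  have "smooth_on (D \<times> UNIV) (\<lambda>p :: (real,'n) vec \<times> complex. frame (fst p) c b)" if "c < N" for c
    by (rule smooth_on_compose_linear[OF D(1) DU bounded_linear_fst _ frame_smooth[OF that ab(2)]]) auto
  then show "smooth_on (D \<times> UNIV) (\<lambda>p. E (fst p) (snd p) a b)"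
    unfolding E_def using ab DU
    by (intro smooth_on_sum smooth_on_mult sol_smooth bounded_linear.smooth_on_linear[OF bounded_linear_of_real]) auto
next
  fix x a b assume "x \<in> D" "a < N" "b < N"
  then show "(\<lambda>l. E x l a b) holomorphic_on UNIV"
    by (subst holomorphic_on_open) (auto intro: E_has_field_derivative)
next
  fix x l a b assume x: "x \<in> D" and ab: "a < N" "b < N"
  show "cnj (E x (cnj l) a b) = E x l a b"
    unfolding E_def using cnj_sol[OF x ab(1)] by (simp add: cnj_sum del: sum.lessThan_Suc)
  \<comment> \<open>A factor \<open>sg n c\<close> squared equals 1 and is inserted between X and
    Phi; the block diagonal Phi commutes with the sign matrix.\<close>
  have "sg n a * E x (-l) a b * sg n b = (\<Sum>c<N. (sg n a * sol x (-l) a c * sg n c) * (sg n c * of_real (frame x c b) * sg n b))"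
    unfolding E_def sum_distrib_left sum_distrib_right
    by (rule sum.cong[OF refl]) (simp add: sg_def)
  also have "\<dots> = E x l a b"
    unfolding E_def
  proof (rule sum.cong[OF refl])
    fix c assume "c \<in> {..<N}"
    then have c: "c < N" by simp
    have "sg n c * of_real (frame x c b) * sg n b = of_real (frame x c b)" by (simp add: frame_def sg_def)
    then show "(sg n a * sol x (-l) a c * sg n c) * (sg n c * of_real (frame x c b) * sg n b) = sol x l a c * of_real (frame x c b)"
      using sg_sol[OF x ab(1) c] by simp
  qed
  finally show "sg n a * E x (-l) a b * sg n b = E x l a b" .
qed (use in_Ogroup_E pd_E in auto)

lemma is_solution_frame:
  assumes "\<And>a b. a < n \<Longrightarrow> b < n \<Longrightarrow> smooth_on D (\<lambda>x. F x a b)" "\<And>a. a < n \<Longrightarrow> smooth_on D (\<lambda>x. g x a)"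
    "\<And>x a. x \<in> D \<Longrightarrow> a < n \<Longrightarrow> F x a a = 0"
  shows "is_solution D k F g"
  unfolding is_solution_def n[symmetric]
proof (intro conjI allI ballI impI)
  show "flat_on D (n+1) (\<lambda>x j a b. omega n k (F x) (g x) j a b)"
  proof (rule flat_onI[OF D(1), where M=A and L="\<lambda>x a c. A x c a"])
    show "smooth_on D (\<lambda>x. omega n k (F x) (g x) j a b)" if "j < CARD('n)" "a < n+1" "b < n+1" for j a b
      unfolding omega_def using that n D(1)
      by (intro smooth_on_if smooth_on_add smooth_on_mult smooth_on_const assms) auto
  qed (use A_smooth pd_A A_orth n in auto)
  show "flat_on D n (\<lambda>x j a b. tau n k (F x) j a b)"
  \<comment> \<open>The left inverse of B is J B^T J, by \<open>B_orth\<close>.\<close>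
  proof (rule flat_onI[OF D(1), where M=B and L="\<lambda>x a c. eps n k a * eps n k c * B x c a"])
    show "smooth_on D (\<lambda>x. tau n k (F x) j a b)" if "j < CARD('n)" "a < n" "b < n" for j a b
      unfolding tau_def using that n D(1)
      by (intro smooth_on_if smooth_on_mult smooth_on_diff smooth_on_const assms) auto
    show "(\<Sum>c<n. eps n k a * eps n k c * B x c a * B x c b) = (if a = b then 1 else 0)"
      if "x \<in> D" "a < n" "b < n" for x a b
      using arg_cong[OF B_orth[OF that], of "\<lambda>t. eps n k a * t"] by (simp add: sum_distrib_left mult.assoc)
  qed (use B_smooth pd_B n in auto)
qed (use assms in auto)

end

section \<open>Combescure sequences\<close>

lemma smooth_on_det:
  fixes M :: "'a::euclidean_space \<Rightarrow> real^'m^'m"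
  assumes "open U" "\<And>i j. smooth_on U (\<lambda>x. M x $ i $ j)"
  shows "smooth_on U (\<lambda>x. det (M x))"
  unfolding det_def using assms
  by (intro smooth_on_sum smooth_on_mult smooth_on_prod smooth_on_const)

text \<open>The generalised cross product of an orthonormal \<open>p\<close>-frame in dimension \<open>p + 1\<close>.\<close>

lemma exists_unit_normal:
  fixes e :: "nat \<Rightarrow> 'a::euclidean_space \<Rightarrow> real^('m::{finite,linorder})"
  assumes U: "open U" and m: "CARD('m) = p + 1"
    and e: "\<And>j. j < p \<Longrightarrow> smooth_on U (e j)"
    and orth: "\<And>x i j. x \<in> U \<Longrightarrow> i < p \<Longrightarrow> j < p \<Longrightarrow> e i x \<bullet> e j x = (if i = j then 1 else 0)"
  shows "\<exists>\<nu>. smooth_on U \<nu> \<and> (\<forall>x\<in>U. \<nu> x \<bullet> \<nu> x = 1 \<and> (\<forall>j<p. \<nu> x \<bullet> e j x = 0))"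
proof -
  define idx where "idx = inv_into {..<CARD('m)} (ix :: nat \<Rightarrow> 'm)"
  have idx: "idx (ix j :: 'm) = j" if "j < p + 1" for j
    using bij_betw_inv_into_left[OF ix_bij[where 'n='m], of j] that m by (simp add: idx_def)
  have idx_lt: "idx r < p" if r: "r \<noteq> ix p" for r
  proof -
    obtain j where j: "j < CARD('m)" "r = ix j" using ix_surj by blast
    then have "idx r = j" using idx m by simp
    with j r m show ?thesis by (cases "j = p") auto
  qed
  \<comment> \<open>Rows are the given vectors, with w in the last place
    \<open>ix p\<close>.\<close>
  define M :: "'a \<Rightarrow> (real,'m) vec \<Rightarrow> ((real,'m) vec,'m) vec" where "M x w = (\<chi> r. if r = ix p then w else e (idx r) x)" for x w
  have row_e: "row (ix j) (M x w) = e j x" if "j < p" for j x w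
  proof -
    have "(ix j :: 'm) \<noteq> ix p" using ix_eq_iff[of j p, where 'n='m] that m by auto
    then show ?thesis using idx[of j] that by (simp add: M_def row_def)
  qed
  have row_w: "row (ix p) (M x w) = w" for x w by (simp add: M_def row_def)
  have rows: "(\<exists>j<p. r = ix j) \<or> r = ix p" for r :: 'm
    using ix_surj[of r] m by (metis Suc_eq_plus1 less_SucE)
  \<comment> \<open>The vector representing the linear functional w |-> det (M x w). Its components
    are polynomial in the frame, hence smooth.\<close>
  define \<nu> :: "'a \<Rightarrow> (real,'m) vec" where "\<nu> x = (\<Sum>r\<in>UNIV. det (M x (axis r 1)) *\<^sub>R axis r 1)" for x
  have smooth: "smooth_on U \<nu>"
    unfolding \<nu>_def
  proof (intro smooth_on_sum smooth_on_scaleR smooth_on_const smooth_on_det U)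
    fix r i j :: 'm
    show "smooth_on U (\<lambda>x. M x (axis r 1) $ i $ j)"
      using U e[OF idx_lt, of i] by (cases "i = ix p") (auto simp: M_def intro!: smooth_on_component)
  qed
  have inner: "\<nu> x \<bullet> w = det (M x w)" for x w
  proof -
    have "det (M x w) = det (\<chi> r. if r = ix p then (\<Sum>s\<in>UNIV. w $ s *s axis s 1) else e (idx r) x)"
      unfolding M_def basis_expansion ..
    also have "\<dots> = (\<Sum>s\<in>UNIV. det (\<chi> r. if r = ix p then w $ s *s axis s 1 else e (idx r) x))"
      by (rule det_linear_row_sum) simp
    also have "\<dots> = (\<Sum>s\<in>UNIV. w $ s * det (M x (axis s 1)))"
      unfolding M_def by (intro sum.cong refl det_row_mul)
    also have "\<dots> = \<nu> x \<bullet> w"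
      by (simp add: \<nu>_def inner_sum_left inner_axis' mult.commute)
    finally show ?thesis by simp
  qed
  have ortho: "\<nu> x \<bullet> e j x = 0" if "j < p" for x j
  proof -
    have "(ix j :: 'm) \<noteq> ix p" using ix_eq_iff[of j p, where 'n='m] that m by auto
    then show ?thesis unfolding inner by (rule det_identical_rows) (simp add: row_e[OF that] row_w)
  qed
  \<comment> \<open>Dimension count provides some unit normal v at the single point x, with no
    smoothness in x. Then M x v is orthogonal, so \<open>\<nu> x\<close> has inner product 1 or -1
    with v and is a multiple of it.\<close>
  have unit: "\<nu> x \<bullet> \<nu> x = 1" if x: "x \<in> U" for x
  proof -
    have "dim ((\<lambda>j. e j x) ` {..<p}) \<le> card ((\<lambda>j. e j x) ` {..<p})" by (rule dim_le_card') simp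
    also have "\<dots> \<le> p" using card_image_le[of "{..<p}" "\<lambda>j. e j x"] by simp
    finally have "dim ((\<lambda>j. e j x) ` {..<p}) < DIM((real,'m) vec)" using m by simp
    then obtain v0 where v0: "v0 \<noteq> 0" "\<And>y. y \<in> span ((\<lambda>j. e j x) ` {..<p}) \<Longrightarrow> orthogonal v0 y"
      by (rule orthogonal_to_subspace_exists) blast
    define v where "v = v0 /\<^sub>R norm v0"
    have v: "v \<bullet> v = 1" "\<And>j. j < p \<Longrightarrow> v \<bullet> e j x = 0"
      using v0(1) v0(2)[OF span_base] by (auto simp: v_def orthogonal_def dot_square_norm power2_eq_square)
    have om: "orthogonal_matrix (M x v)"
      unfolding orthogonal_matrix_orthonormal_rows
    proof (intro conjI allI impI)
      fix r :: 'm
      show "norm (row r (M x v)) = 1"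
        using rows[of r] v(1) orth[OF x] by (auto simp: row_e row_w norm_eq_1)
      fix s :: 'm assume "r \<noteq> s"
      then show "orthogonal (row r (M x v)) (row s (M x v))"
        using rows[of r] rows[of s] v(2) orth[OF x] by (auto simp: row_e row_w orthogonal_def inner_commute)
    qed
    have "\<nu> x - (\<nu> x \<bullet> v) *\<^sub>R v = 0"
    proof -
      let ?w = "\<nu> x - (\<nu> x \<bullet> v) *\<^sub>R v"
      have "row r (M x v) \<bullet> ?w = 0" for r
        using rows[of r] v ortho by (auto simp: row_e row_w inner_diff_right inner_commute)
      then have "M x v *v ?w = 0"
        by (simp add: vec_eq_iff matrix_vector_mul_component row_def inner_vec_def)
      then have "transpose (M x v) *v (M x v *v ?w) = 0" by simp
      then show ?thesis using om by (simp add: matrix_vector_mul_assoc orthogonal_matrix_def)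
    qed
    then have nu: "\<nu> x = (\<nu> x \<bullet> v) *\<^sub>R v" by simp
    have "\<nu> x \<bullet> v = 1 \<or> \<nu> x \<bullet> v = -1" unfolding inner using det_orthogonal_matrix[OF om] .
    then have "(\<nu> x \<bullet> v) * (\<nu> x \<bullet> v) = 1" by auto
    moreover have "\<nu> x \<bullet> \<nu> x = (\<nu> x \<bullet> v) * (\<nu> x \<bullet> v)"
      by (subst (2) nu) simp
    ultimately show ?thesis by simp
  qed
  from smooth ortho unit show ?thesis by blast
qed

locale combescure =
  fixes D :: "(real^('n::{finite,linorder})) set" and k :: nat
    and f :: "nat \<Rightarrow> (real,'n) vec \<Rightarrow> real^('m::{finite,linorder})" and n :: nat
  assumes n: "n = CARD('n)" and m: "CARD('m) = n + 1" and k: "k \<le> n"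
    and D: "open D" "simply_connected D" "0 \<in> D"
    and seq: "combescure_seq D k f"
    and f_0: "\<And>l. l < n \<Longrightarrow> f l 0 = 0"
begin

section \<open>The common principal frame and the metric coefficients\<close>

lemma isothermic: "l < n \<Longrightarrow> isothermic_k D k (f l)"
  using seq unfolding combescure_seq_def Let_def n by blast

lemma f_smooth: "l < n \<Longrightarrow> smooth_on D (f l)"
  and pd_f_nz: "l < n \<Longrightarrow> x \<in> D \<Longrightarrow> j < n \<Longrightarrow> pd j (f l) x \<noteq> 0"
  and pd_f_orth: "l < n \<Longrightarrow> x \<in> D \<Longrightarrow> i < n \<Longrightarrow> j < n \<Longrightarrow> i \<noteq> j \<Longrightarrow> pd i (f l) x \<bullet> pd j (f l) x = 0"
  and curvature_lines: "l < n \<Longrightarrow> x \<in> D \<Longrightarrow> i < n \<Longrightarrow> j < n \<Longrightarrow> i \<noteq> j \<Longrightarrow>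
    (\<And>h. h < n \<Longrightarrow> v \<bullet> pd h (f l) x = 0) \<Longrightarrow> v \<bullet> pd i (pd j (f l)) x = 0"
  and isothermic_sum: "l < n \<Longrightarrow> x \<in> D \<Longrightarrow> (\<Sum>j<n-k. (norm (pd j (f l) x))^2) = (\<Sum>j\<in>{n-k..<n}. (norm (pd j (f l) x))^2)"
  using isothermic[of l] unfolding isothermic_k_def Let_def n[symmetric] by blast+

lemma n_pos: "0 < n"
  by (simp add: n)

definition a :: "nat \<Rightarrow> (real,'n) vec \<Rightarrow> (real,'m) vec" where
  "a j = pd j (f 0)"

definition e :: "nat \<Rightarrow> (real,'n) vec \<Rightarrow> (real,'m) vec" where
  "e j x = inverse (norm (a j x)) *\<^sub>R a j x"

text \<open>An inner product with a smooth unit vector makes the coefficient smooth and fixes its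
  sign; U 0 j is positive on D.\<close>

definition U :: "nat \<Rightarrow> nat \<Rightarrow> (real,'n) vec \<Rightarrow> real" where
  "U l j x = pd j (f l) x \<bullet> e j x"

lemma a_smooth: "smooth_on D (a j)"
  unfolding a_def by (rule smooth_on_pd[OF D(1) f_smooth[OF n_pos]])

lemma a_nz: "x \<in> D \<Longrightarrow> j < n \<Longrightarrow> a j x \<noteq> 0"
  unfolding a_def by (rule pd_f_nz[OF n_pos])

lemma scale_smooth: "j < n \<Longrightarrow> smooth_on D (\<lambda>x. inverse (norm (a j x)))"
  using a_nz by (intro smooth_on_inverse smooth_on_norm D(1) a_smooth) auto

lemma e_smooth: "j < n \<Longrightarrow> smooth_on D (e j)"
  unfolding e_def by (intro smooth_on_scaleR scale_smooth D(1) a_smooth)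

lemma U_smooth: "l < n \<Longrightarrow> j < n \<Longrightarrow> smooth_on D (U l j)"
  unfolding U_def by (intro smooth_on_inner e_smooth smooth_on_pd f_smooth D(1))

lemma e_orth:
  assumes "x \<in> D" "i < n" "j < n"
  shows "e i x \<bullet> e j x = (if i = j then 1 else 0)"
  using pd_f_orth[OF n_pos assms] a_nz[OF assms(1,2)] unfolding a_def[symmetric]
  by (auto simp: e_def dot_square_norm power2_eq_square field_simps)

text \<open>The sign of \<open>u 0 j\<close> may vary from point to point, but it is shared by all \<open>u l j\<close>.\<close>

lemma combescure_coefficients:
  "\<exists>s :: nat \<Rightarrow> (real,'n) vec \<Rightarrow> real.
    (\<forall>l<n. \<forall>j<n. \<forall>x\<in>D. pd j (f l) x = U l j x *\<^sub>R e j x) \<and>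
    (\<forall>x\<in>D. lin_indep n (\<lambda>i j. s j x * U i j x))"
proof -
  obtain u :: "nat \<Rightarrow> nat \<Rightarrow> (real,'n) vec \<Rightarrow> real" where
    u: "\<forall>i<n. \<forall>j<n. \<forall>x\<in>D. (u i j x)^2 = (norm (pd j (f i) x))^2 \<and>
            pd j (f i) x /\<^sub>R u i j x = pd j (f 0) x /\<^sub>R u 0 j x"
    and indep: "\<forall>x\<in>D. lin_indep n (\<lambda>i j. u i j x)"
    using seq unfolding combescure_seq_def Let_def n[symmetric] by blast
  \<comment> \<open>Equal to 1 or -1, because the square of u 0 j is the squared norm of a
    j.\<close>
  define s where "s j x = u 0 j x / norm (a j x)" for j x
  have u_nz: "u l j x \<noteq> 0" if "l < n" "j < n" "x \<in> D" for l j x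
  proof
    assume "u l j x = 0"
    moreover have "(u l j x)^2 = (norm (pd j (f l) x))^2" using u that by blast
    ultimately show False using pd_f_nz[OF that(1,3,2)] by simp
  qed
  have pd_u: "pd j (f l) x = (u l j x / s j x) *\<^sub>R e j x" if "l < n" "j < n" "x \<in> D" for l j x
  proof -
    have "pd j (f l) x = u l j x *\<^sub>R (pd j (f l) x /\<^sub>R u l j x)" using u_nz[OF that] by simp
    also have "pd j (f l) x /\<^sub>R u l j x = pd j (f 0) x /\<^sub>R u 0 j x" using u that by blast
    also have "u l j x *\<^sub>R (pd j (f 0) x /\<^sub>R u 0 j x) = (u l j x / s j x) *\<^sub>R e j x"
      using a_nz[OF that(3,2)] by (simp add: s_def e_def a_def divide_inverse)
    finally show ?thesis .
  qed
  have U_u: "U l j x = u l j x / s j x" if "l < n" "j < n" "x \<in> D" for l j x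
    unfolding U_def pd_u[OF that] using e_orth[OF that(3,2,2)] by simp
  have s_nz: "s j x \<noteq> 0" if "j < n" "x \<in> D" for j x
    using u_nz[OF n_pos that] a_nz[OF that(2,1)] by (simp add: s_def)
  have "lin_indep n (\<lambda>i j. s j x * U i j x)" if "x \<in> D" for x
    using indep that U_u[OF _ _ that] s_nz[OF _ that] by (simp add: lin_indep_def)
  then show ?thesis using pd_u U_u by (intro exI[of _ s]) simp
qed

lemma pd_f: "l < n \<Longrightarrow> j < n \<Longrightarrow> x \<in> D \<Longrightarrow> pd j (f l) x = U l j x *\<^sub>R e j x"
  using combescure_coefficients by (elim exE conjE) simp

lemma U_nz: "l < n \<Longrightarrow> j < n \<Longrightarrow> x \<in> D \<Longrightarrow> U l j x \<noteq> 0"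
  using pd_f pd_f_nz by fastforce

lemma U_indep:
  assumes "x \<in> D"
  shows "lin_indep n (\<lambda>i j. U i j x)"
proof -
  obtain s :: "nat \<Rightarrow> (real,'n) vec \<Rightarrow> real"
    where s: "\<forall>x\<in>D. lin_indep n (\<lambda>i j. s j x * U i j x)"
    using combescure_coefficients by (elim exE conjE)
  show ?thesis
    unfolding lin_indep_def
  proof (intro allI impI)
    fix t and i :: nat
    assume t: "\<forall>b<n. (\<Sum>i<n. t i * U i b x) = 0" and i: "i < n"
    have "\<forall>b<n. (\<Sum>i<n. t i * (s b x * U i b x)) = 0"
    proof (intro allI impI)
      fix b assume "b < n"
      have "(\<Sum>i<n. t i * (s b x * U i b x)) = s b x * (\<Sum>i<n. t i * U i b x)"
        by (simp add: sum_distrib_left mult_ac)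
      with t \<open>b < n\<close> show "(\<Sum>i<n. t i * (s b x * U i b x)) = 0" by simp
    qed
    with s[THEN bspec, OF assms] i show "t i = 0" unfolding lin_indep_def by blast
  qed
qed

lemma U_null:
  assumes "l < n" "x \<in> D"
  shows "(\<Sum>j<n. eps n k j * (U l j x)^2) = 0"
proof -
  have norm: "(norm (pd j (f l) x))^2 = (U l j x)^2" if "j < n" for j
  proof -
    have "norm (e j x) = 1" using e_orth[OF assms(2) that that] by (simp add: norm_eq_1)
    then show ?thesis unfolding pd_f[OF assms(1) that assms(2)] by simp
  qed
  have "{..<n} = {..<n-k} \<union> {n-k..<n}" by auto
  then have "(\<Sum>j<n. eps n k j * (U l j x)^2) = (\<Sum>j\<in>{..<n-k} \<union> {n-k..<n}. eps n k j * (U l j x)^2)"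
    by simp
  also have "\<dots> = (\<Sum>j<n-k. eps n k j * (U l j x)^2) + (\<Sum>j\<in>{n-k..<n}. eps n k j * (U l j x)^2)"
    by (rule sum.union_disjoint) auto
  also have "(\<Sum>j<n-k. eps n k j * (U l j x)^2) = (\<Sum>j<n-k. (norm (pd j (f l) x))^2)"
    by (intro sum.cong refl) (simp add: norm eps_def)
  also have "(\<Sum>j\<in>{n-k..<n}. eps n k j * (U l j x)^2) = - (\<Sum>j\<in>{n-k..<n}. (norm (pd j (f l) x))^2)"
    unfolding sum_negf[symmetric] by (intro sum.cong refl) (simp add: norm eps_def)
  finally show ?thesis using isothermic_sum[OF assms] by simp
qed

definition \<nu> :: "(real,'n) vec \<Rightarrow> (real,'m) vec" where
  "\<nu> = (SOME \<nu>. smooth_on D \<nu> \<and> (\<forall>x\<in>D. \<nu> x \<bullet> \<nu> x = 1 \<and> (\<forall>j<n. \<nu> x \<bullet> e j x = 0)))"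

lemma \<nu>: "smooth_on D \<nu> \<and> (\<forall>x\<in>D. \<nu> x \<bullet> \<nu> x = 1 \<and> (\<forall>j<n. \<nu> x \<bullet> e j x = 0))"
  unfolding \<nu>_def by (rule someI_ex[OF exists_unit_normal[OF D(1) m e_smooth e_orth]])

definition fr :: "nat \<Rightarrow> (real,'n) vec \<Rightarrow> (real,'m) vec" where
  "fr j = (if j < n then e j else \<nu>)"

lemma fr_smooth: "smooth_on D (fr j)"
  using \<nu> e_smooth by (simp add: fr_def)

lemma fr_orth:
  assumes "x \<in> D" "i < n+1" "j < n+1"
  shows "fr i x \<bullet> fr j x = (if i = j then 1 else 0)"
  using assms \<nu> e_orth by (auto simp: fr_def inner_commute)

text \<open>A square matrix with orthonormal columns has orthonormal rows, which is the completeness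
  of n + 1 orthonormal vectors in dimension n + 1.\<close>

lemma fr_expand:
  assumes "x \<in> D"
  shows "v = (\<Sum>c<n+1. (v \<bullet> fr c x) *\<^sub>R fr c x)"
proof -
  have inner: "u \<bullet> w = (\<Sum>r<n+1. u $ ix r * w $ ix r)" for u w :: "(real,'m) vec"
    unfolding inner_vec_def using sum_ix[where 'n='m, of "\<lambda>i. u $ i * w $ i"] m by simp
  have "(\<Sum>r<n+1. fr i x $ ix r * fr j x $ ix r) = (if i = j then 1 else 0)" if "i < n+1" "j < n+1" for i j
    using fr_orth[OF assms that] unfolding inner .
  from left_inverse_imp_right_inverse[OF ix_bij[where 'n='m, unfolded m] this]
  have right: "(\<Sum>c<n+1. fr c x $ ix r * fr c x $ ix s) = (if r = s then 1 else 0)" if "r < n+1" "s < n+1" for r s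
    using that by blast
  have component: "(\<Sum>c<n+1. (v \<bullet> fr c x) *\<^sub>R fr c x) $ ix s = v $ ix s" if s: "s < n+1" for s
  proof -
    have "(\<Sum>c<n+1. (v \<bullet> fr c x) *\<^sub>R fr c x) $ ix s = (\<Sum>c<n+1. \<Sum>r<n+1. v $ ix r * (fr c x $ ix r * fr c x $ ix s))"
      unfolding inner by (simp add: sum_distrib_right mult.assoc del: sum.lessThan_Suc)
    also have "\<dots> = (\<Sum>r<n+1. v $ ix r * (\<Sum>c<n+1. fr c x $ ix r * fr c x $ ix s))"
      by (subst sum.swap) (simp add: sum_distrib_left del: sum.lessThan_Suc)
    also have "\<dots> = (\<Sum>r<n+1. v $ ix r * (if r = s then 1 else 0))"
      using right s by (intro sum.cong refl) simp
    also have "\<dots> = v $ ix s" using s by (rule sum_delta_mult(4))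
    finally show ?thesis .
  qed
  show ?thesis
    unfolding vec_eq_iff
  proof
    fix r :: 'm
    obtain s where "s < n+1" "r = ix s" using ix_surj[of r] m by auto
    with component show "v $ r = (\<Sum>c<n+1. (v \<bullet> fr c x) *\<^sub>R fr c x) $ r" by simp
  qed
qed

section \<open>Connection coefficients of the frame\<close>

lemma orth_derivative:
  assumes "x \<in> D" "i < n+1" "j < n+1"
  shows "pd h (fr i) x \<bullet> fr j x = - (pd h (fr j) x \<bullet> fr i x)"
proof -
  have "pd h (\<lambda>x. fr i x \<bullet> fr j x) x = pd h (\<lambda>x. if i = j then 1 else 0) x"
    by (rule pd_cong[OF D(1) assms(1)]) (rule fr_orth[OF _ assms(2,3)])
  then have "fr i x \<bullet> pd h (fr j) x + pd h (fr i) x \<bullet> fr j x = 0"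
    by (simp add: pd_inner[OF D(1) fr_smooth fr_smooth assms(1)])
  then show ?thesis by (simp add: inner_commute)
qed

text \<open>Christoffel symbols of the first kind of the induced metric of the first
  hypersurface.\<close>

definition T :: "nat \<Rightarrow> nat \<Rightarrow> nat \<Rightarrow> (real,'n) vec \<Rightarrow> real" where
  "T i j h x = pd i (a j) x \<bullet> a h x"

lemma T_sym: "x \<in> D \<Longrightarrow> T i j h x = T j i h x"
  unfolding T_def a_def using pd_commute[OF D(1) f_smooth[OF n_pos]] by simp

lemma T_skew:
  assumes "x \<in> D" "j < n" "h < n" "j \<noteq> h"
  shows "T i j h x = - T i h j x"
proof -
  have "pd i (\<lambda>x. a j x \<bullet> a h x) x = pd i (\<lambda>x. 0) x"
    by (rule pd_cong[OF D(1) assms(1)]) (use pd_f_orth[OF n_pos _ assms(2-4)] in \<open>simp add: a_def\<close>)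
  then show ?thesis
    by (simp add: pd_inner[OF D(1) a_smooth a_smooth assms(1)] T_def inner_commute)
qed

text \<open>Symmetric in the first two indices and, for distinct indices, skew in the last two;
  alternating both rules three times returns the symbol with the opposite sign.\<close>

lemma T_distinct:
  assumes "x \<in> D" "i < n" "j < n" "h < n" "i \<noteq> j" "j \<noteq> h" "i \<noteq> h"
  shows "T i j h x = 0"
proof -
  note x = assms(1)
  have "T i j h x = - T h i j x" using T_skew[OF x, of j h i] T_sym[OF x, of i h j] assms by simp
  also have "\<dots> = T j h i x" using T_skew[OF x, of i j h] T_sym[OF x, of h j i] assms by simp
  also have "\<dots> = - T i j h x" using T_skew[OF x, of h i j] T_sym[OF x, of j i h] assms by simp
  finally show ?thesis by simp
qed

lemma pd_e_a:
  assumes "x \<in> D" "j < n"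
  shows "pd i (e j) x = inverse (norm (a j x)) *\<^sub>R pd i (a j) x + pd i (\<lambda>x. inverse (norm (a j x))) x *\<^sub>R a j x"
  unfolding e_def by (rule pd_scaleR[OF D(1) scale_smooth[OF assms(2)] a_smooth assms(1)])

lemma pd_e_distinct:
  assumes "x \<in> D" "i < n" "j < n" "h < n" "i \<noteq> j" "j \<noteq> h" "i \<noteq> h"
  shows "pd i (e j) x \<bullet> e h x = 0"
proof -
  have "a j x \<bullet> a h x = 0" using pd_f_orth[OF n_pos assms(1,3,4,6)] by (simp add: a_def)
  with T_distinct[OF assms] show ?thesis
    unfolding pd_e_a[OF assms(1,3)] by (simp add: e_def[of h] inner_add_left T_def)
qed

text \<open>The second fundamental form is diagonal in curvature line coordinates, and rescaling a j
  to e j adds only a tangential term.\<close>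

lemma pd_e_normal:
  assumes "x \<in> D" "i < n" "j < n" "i \<noteq> j"
  shows "pd i (e j) x \<bullet> \<nu> x = 0"
proof -
  have a: "\<nu> x \<bullet> a h x = 0" if "h < n" for h
    using pd_f[OF n_pos that assms(1)] \<nu> assms(1) that by (simp add: a_def)
  have "\<nu> x \<bullet> pd i (a j) x = 0"
    unfolding a_def by (rule curvature_lines[OF n_pos assms]) (rule a[unfolded a_def])
  with a[OF assms(3)] show ?thesis
    unfolding pd_e_a[OF assms(1,3)] by (simp add: inner_add_left inner_add_right inner_commute[of _ "\<nu> x"])
qed

text \<open>Up to sign, the rotation coefficients of the orthogonal coordinates. Factor and sign are
  forced by the entry - eps_i F_ij of omega, which has to be the e_i-component of the x_i-derivative
  of e_j; \<open>g\<close> arises likewise from the normal.\<close>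

definition F :: "(real,'n) vec \<Rightarrow> nat \<Rightarrow> nat \<Rightarrow> real" where
  "F x i j = (if i = j then 0 else - eps n k i * (pd i (e j) x \<bullet> e i x))"

definition g :: "(real,'n) vec \<Rightarrow> nat \<Rightarrow> real" where
  "g x i = - eps n k i * (pd i \<nu> x \<bullet> e i x)"

lemma F_diag: "F x i i = 0"
  by (simp add: F_def)

lemma F_smooth: "i < n \<Longrightarrow> j < n \<Longrightarrow> smooth_on D (\<lambda>x. F x i j)"
  unfolding F_def
  by (intro smooth_on_if smooth_on_mult smooth_on_const smooth_on_inner smooth_on_pd e_smooth D(1))

lemma g_smooth: "i < n \<Longrightarrow> smooth_on D (\<lambda>x. g x i)"
  unfolding g_def using \<nu>
  by (intro smooth_on_mult smooth_on_const smooth_on_inner smooth_on_pd e_smooth D(1)) auto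

text \<open>Orthogonal coordinates and diagonal second fundamental form leave only entries in row i
  or column i, and skewness ties the two. This is exactly the shape of omega.\<close>

lemma omega_frame:
  assumes x: "x \<in> D" and i: "i < n" and ab: "b < n+1" "c < n+1"
  shows "omega n k (F x) (g x) i b c = pd i (fr c) x \<bullet> fr b x"
proof -
  have self: "pd i (fr b) x \<bullet> fr b x = 0" if "b < n+1" for b using orth_derivative[OF x that that, of i] by simp
  have off: "pd i (fr c) x \<bullet> fr b x = 0" if "b < n+1" "c < n" "c \<noteq> i" "b \<noteq> i" "b \<noteq> c" for b c
    using that pd_e_distinct[OF x i, of c b] pd_e_normal[OF x i, of c] by (auto simp: fr_def split: if_splits)
  have F1: "- eps n k i * F x i c = pd i (fr c) x \<bullet> fr i x" if "c < n" for c
    using self[of c] that i by (auto simp: F_def fr_def)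
  have g1: "- eps n k i * g x i = pd i (fr n) x \<bullet> fr i x"
    using i by (simp add: g_def fr_def)
  consider "b < n" "c < n" | "b = n" "c < n" | "b < n" "c = n" | "b = n" "c = n" using ab by linarith
  then show ?thesis
  proof cases
    case 1
    consider "b = i" "c = i" | "b = i" "c \<noteq> i" | "b \<noteq> i" "c = i" | "b \<noteq> i" "c \<noteq> i" by blast
    then show ?thesis
    proof cases
      case 1
      then show ?thesis using i self[of i] by (simp add: omega_def)
    next
      case 2
      then show ?thesis using i F1[of c] \<open>c < n\<close> by (simp add: omega_def)
    next
      case 3
      then show ?thesis using i F1[of b] \<open>b < n\<close> orth_derivative[OF x, of b i i] by (simp add: omega_def)
    next
      case 4
      then show ?thesis using \<open>b < n\<close> \<open>c < n\<close> self[of b] off[of b c] by (cases "b = c") (auto simp: omega_def)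
    qed
  next
    case 2
    then show ?thesis using i g1 off[of n c] orth_derivative[OF x, of n i i] by (cases "c = i") (auto simp: omega_def mult.commute)
  next
    case 3
    then show ?thesis using i g1 off[of n b] orth_derivative[OF x, of b n i] by (cases "b = i") (auto simp: omega_def)
  next
    case 4
    then show ?thesis using self[of n] by (simp add: omega_def)
  qed
qed

definition A :: "(real,'n) vec \<Rightarrow> nat \<Rightarrow> nat \<Rightarrow> real" where
  "A x b c = fr c x $ ix b"

lemma A_orth:
  assumes "x \<in> D" "b < n+1" "c < n+1"
  shows "(\<Sum>h<n+1. A x h b * A x h c) = (if b = c then 1 else 0)"
proof -
  have "fr b x \<bullet> fr c x = (\<Sum>h<n+1. A x h b * A x h c)"
    unfolding inner_vec_def A_def using sum_ix[where 'n='m, of "\<lambda>i. fr b x $ i * fr c x $ i"] m by simp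
  with fr_orth[OF assms] show ?thesis by simp
qed

lemma pd_A:
  assumes "x \<in> D" "j < n" "b < n+1" "c < n+1"
  shows "pd j (\<lambda>y. A y b c) x = (\<Sum>h<n+1. A x b h * omega n k (F x) (g x) j h c)"
proof -
  have "pd j (\<lambda>y. A y b c) x = pd j (fr c) x $ ix b"
    unfolding A_def by (rule pd_component[OF D(1) fr_smooth assms(1)])
  also have "\<dots> = (\<Sum>h<n+1. (pd j (fr c) x \<bullet> fr h x) *\<^sub>R fr h x) $ ix b"
    by (subst fr_expand[OF assms(1)]) (rule refl)
  also have "\<dots> = (\<Sum>h<n+1. A x b h * omega n k (F x) (g x) j h c)"
    unfolding sum_component using omega_frame[OF assms(1,2) _ assms(4)]
    by (intro sum.cong refl) (simp add: A_def mult.commute)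
  finally show ?thesis .
qed

text \<open>Expand both mixed second derivatives of f l through U and e, and compare their
  e_i-components. Since e is common to the sequence, the same F serves every l.\<close>

lemma pd_U_off:
  assumes "x \<in> D" "l < n" "i < n" "j < n" "i \<noteq> j"
  shows "pd j (U l i) x = - eps n k i * F x i j * U l j x"
proof -
  have pd2: "pd i (pd j (f l)) x = U l j x *\<^sub>R pd i (e j) x + pd i (U l j) x *\<^sub>R e j x" if "i < n" "j < n" for i j
  proof -
    have "pd i (pd j (f l)) x = pd i (\<lambda>x. U l j x *\<^sub>R e j x) x"
      by (rule pd_cong[OF D(1) assms(1)]) (rule pd_f[OF assms(2) that(2)])
    then show ?thesis by (simp add: pd_scaleR[OF D(1) U_smooth[OF assms(2) that(2)] e_smooth[OF that(2)] assms(1)])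
  qed
  have "pd i (pd j (f l)) x \<bullet> e i x = pd j (pd i (f l)) x \<bullet> e i x"
    using pd_commute[OF D(1) f_smooth[OF assms(2)] assms(1), of i j] by simp
  moreover have "pd j (e i) x \<bullet> e i x = 0"
    using orth_derivative[OF assms(1), of i i j] assms(3) by (simp add: fr_def)
  ultimately have "pd j (U l i) x = U l j x * (pd i (e j) x \<bullet> e i x)"
    using pd2[OF assms(3,4)] pd2[OF assms(4,3)] e_orth[OF assms(1,4,3)] e_orth[OF assms(1,3,3)] assms(5)
    by (simp add: inner_add_left)
  then show ?thesis using assms(5) by (simp add: F_def)
qed

text \<open>Differentiate the null condition \<open>U_null\<close> along x_j.
  \<open>pd_U_off\<close> replaces every term but the j-th, and the common factor U l j, which has
  no zero, cancels.\<close>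

lemma pd_U_diag:
  assumes "x \<in> D" "l < n" "j < n"
  shows "pd j (U l j) x = eps n k j * (\<Sum>i<n. F x i j * U l i x)"
proof -
  have "pd j (\<lambda>x. \<Sum>i<n. eps n k i * (U l i x * U l i x)) x = pd j (\<lambda>x. 0) x"
    by (rule pd_cong[OF D(1) assms(1)]) (use U_null[OF assms(2)] in \<open>simp add: power2_eq_square\<close>)
  moreover have "pd j (\<lambda>x. \<Sum>i<n. eps n k i * (U l i x * U l i x)) x = (\<Sum>i<n. pd j (\<lambda>x. eps n k i * (U l i x * U l i x)) x)"
    by (rule pd_sum[OF D(1) _ assms(1)]) (auto intro!: smooth_on_mult smooth_on_const U_smooth assms D(1))
  moreover have "pd j (\<lambda>x. eps n k i * (U l i x * U l i x)) x = 2 * (eps n k i * U l i x * pd j (U l i) x)" if "i < n" for i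
    using pd_cmult[OF D(1) smooth_on_mult[OF D(1) U_smooth[OF assms(2) that] U_smooth[OF assms(2) that]] assms(1)]
      pd_mult[OF D(1) U_smooth[OF assms(2) that] U_smooth[OF assms(2) that] assms(1)] by simp
  ultimately have "(\<Sum>i<n. 2 * (eps n k i * U l i x * pd j (U l i) x)) = 0" by simp
  then have "(\<Sum>i<n. eps n k i * U l i x * pd j (U l i) x) = 0" unfolding sum_distrib_left[symmetric] by simp
  moreover have "eps n k i * U l i x * pd j (U l i) x = - U l j x * (F x i j * U l i x) + (if i = j then eps n k j * U l j x * pd j (U l j) x else 0)"
    if "i < n" for i
  proof (cases "i = j")
    case True
    then show ?thesis by (simp add: F_def)
  next
    case False
    with pd_U_off[OF assms(1,2) that assms(3)] show ?thesis by simp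
  qed
  ultimately have "(\<Sum>i<n. - U l j x * (F x i j * U l i x) + (if i = j then eps n k j * U l j x * pd j (U l j) x else 0)) = 0" by simp
  then have "- U l j x * (\<Sum>i<n. F x i j * U l i x) + (\<Sum>i<n. if i = j then eps n k j * U l j x * pd j (U l j) x else 0) = 0"
    unfolding sum.distrib sum_distrib_left[symmetric] .
  then have "- U l j x * (\<Sum>i<n. F x i j * U l i x) + eps n k j * U l j x * pd j (U l j) x = 0"
    using assms(3) by simp
  then have "U l j x * (eps n k j * pd j (U l j) x) = U l j x * (\<Sum>i<n. F x i j * U l i x)" by (simp add: mult_ac)
  then have "eps n k j * pd j (U l j) x = (\<Sum>i<n. F x i j * U l i x)" using U_nz[OF assms(2,3,1)] by simp
  then have "eps n k j * (eps n k j * pd j (U l j) x) = eps n k j * (\<Sum>i<n. F x i j * U l i x)" by simp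
  then show ?thesis by simp
qed

lemma pd_U:
  assumes "x \<in> D" "l < n" "i < n" "j < n"
  shows "pd j (U l i) x = (\<Sum>c<n. U l c x * tau n k (F x) j c i)"
proof (cases "i = j")
  case True
  have "(\<Sum>c<n. U l c x * tau n k (F x) j c i) = (\<Sum>c<n. eps n k j * (F x c j * U l c x))"
    using True by (intro sum.cong refl) (auto simp: tau_def F_def)
  then show ?thesis using pd_U_diag[OF assms(1,2,4)] True by (simp add: sum_distrib_left)
next
  case False
  have "(\<Sum>c<n. U l c x * tau n k (F x) j c i) = (\<Sum>c<n. if c = j then - (U l j x * F x i j * eps n k i) else 0)"
    using False by (intro sum.cong refl) (auto simp: tau_def)
  then show ?thesis using pd_U_off[OF assms(1-4) False] assms(4) by (simp add: mult_ac)
qed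

section \<open>The parallel frame of tau and the potential Y\<close>

lemma tau_skew: "tau n k G j b c * eps n k c + tau n k G j c b * eps n k b = 0"
  by (auto simp: tau_def)

definition Q :: "nat \<Rightarrow> nat \<Rightarrow> real" where
  "Q = (SOME Q. \<forall>b<n. \<forall>c<n. (\<Sum>l<n. Q b l * U l c 0) = (if b = c then 1 else 0))"

lemma Q_left: "b < n \<Longrightarrow> c < n \<Longrightarrow> (\<Sum>l<n. Q b l * U l c 0) = (if b = c then 1 else 0)"
  using someI_ex[OF lin_indep_imp_inverse[OF ix_bij[where 'n='n, folded n] U_indep[OF D(3)]]]
  unfolding Q_def[symmetric] by blast

lemma Q_right: "b < n \<Longrightarrow> c < n \<Longrightarrow> (\<Sum>l<n. U b l 0 * Q l c) = (if b = c then 1 else 0)"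
  by (rule left_inverse_imp_right_inverse[OF ix_bij[where 'n='n, folded n] Q_left])

definition B :: "(real,'n) vec \<Rightarrow> nat \<Rightarrow> nat \<Rightarrow> real" where
  "B x b j = (\<Sum>l<n. Q b l * U l j x)"

lemma B_smooth: "j < n \<Longrightarrow> smooth_on D (\<lambda>x. B x b j)"
  unfolding B_def by (intro smooth_on_sum smooth_on_mult smooth_on_const D(1)) (auto intro: U_smooth)

lemma pd_B:
  assumes "x \<in> D" "j < n" "b < n" "i < n"
  shows "pd j (\<lambda>y. B y b i) x = (\<Sum>c<n. B x b c * tau n k (F x) j c i)"
proof -
  have "pd j (\<lambda>y. B y b i) x = (\<Sum>l<n. pd j (\<lambda>y. Q b l * U l i y) x)"
    unfolding B_def by (rule pd_sum[OF D(1) _ assms(1)]) (auto intro!: smooth_on_mult smooth_on_const U_smooth assms D(1))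
  also have "\<dots> = (\<Sum>l<n. \<Sum>c<n. Q b l * U l c x * tau n k (F x) j c i)"
  proof (rule sum.cong[OF refl])
    fix l assume "l \<in> {..<n}"
    then have l: "l < n" by simp
    show "pd j (\<lambda>y. Q b l * U l i y) x = (\<Sum>c<n. Q b l * U l c x * tau n k (F x) j c i)"
      unfolding pd_cmult[OF D(1) U_smooth[OF l assms(4)] assms(1)] pd_U[OF assms(1) l assms(4,2)]
      by (simp add: sum_distrib_left mult.assoc)
  qed
  also have "\<dots> = (\<Sum>c<n. B x b c * tau n k (F x) j c i)"
    unfolding B_def sum_distrib_right by (rule sum.swap)
  finally show ?thesis .
qed

text \<open>As tau J is skew, B J B^T has derivative zero; at 0 it equals J because B is the
  identity there.\<close>

lemma B_orth_rows:
  assumes "x \<in> D" "b < n" "c < n"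
  shows "(\<Sum>j<n. eps n k j * (B x b j * B x c j)) = (if b = c then eps n k b else 0)"
proof -
  let ?P = "\<lambda>x. \<Sum>j<n. eps n k j * (B x b j * B x c j)"
  have "?P x = ?P 0"
  proof (rule pd_zero_imp_constant[OF D(1) _ _ _ assms(1) D(3)])
    show "connected D" using D(2) simply_connected_imp_connected by blast
    show "smooth_on D ?P" using D(1) by (intro smooth_on_sum smooth_on_mult smooth_on_const B_smooth) auto
    fix i x assume "i < CARD('n)" and x: "x \<in> D"
    then have i: "i < n" by (simp add: n)
    let ?t = "tau n k (F x) i"
    have "pd i ?P x = (\<Sum>j<n. pd i (\<lambda>x. eps n k j * (B x b j * B x c j)) x)"
      by (rule pd_sum[OF D(1) _ x]) (auto intro!: smooth_on_mult smooth_on_const B_smooth D(1))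
    also have "\<dots> = (\<Sum>j<n. eps n k j * (B x b j * (\<Sum>h<n. B x c h * ?t h j) + (\<Sum>h<n. B x b h * ?t h j) * B x c j))"
    proof (rule sum.cong[OF refl])
      fix j assume "j \<in> {..<n}"
      then have j: "j < n" by simp
      show "pd i (\<lambda>x. eps n k j * (B x b j * B x c j)) x = eps n k j * (B x b j * (\<Sum>h<n. B x c h * ?t h j) + (\<Sum>h<n. B x b h * ?t h j) * B x c j)"
        unfolding pd_cmult[OF D(1) smooth_on_mult[OF D(1) B_smooth[OF j] B_smooth[OF j]] x]
          pd_mult[OF D(1) B_smooth[OF j] B_smooth[OF j] x] pd_B[OF x i assms(2) j] pd_B[OF x i assms(3) j] ..
    qed
    also have "\<dots> = (\<Sum>j<n. \<Sum>h<n. B x b j * B x c h * (?t h j * eps n k j)) + (\<Sum>j<n. \<Sum>h<n. B x b h * B x c j * (?t h j * eps n k j))"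
      unfolding sum.distrib[symmetric] by (intro sum.cong refl) (simp add: sum_distrib_left sum_distrib_right sum.distrib distrib_left mult_ac)
    also have "(\<Sum>j<n. \<Sum>h<n. B x b h * B x c j * (?t h j * eps n k j)) = (\<Sum>j<n. \<Sum>h<n. B x b j * B x c h * (?t j h * eps n k h))"
      by (rule sum.swap)
    also have "(\<Sum>j<n. \<Sum>h<n. B x b j * B x c h * (?t h j * eps n k j)) + \<dots> =
        (\<Sum>j<n. \<Sum>h<n. B x b j * B x c h * (?t h j * eps n k j + ?t j h * eps n k h))"
      by (simp add: sum.distrib distrib_left)
    also have "\<dots> = 0" unfolding tau_skew by simp
    finally show "pd i ?P x = 0" .
  qed
  also have "?P 0 = (\<Sum>j<n. if j = b then (if b = c then eps n k b else 0) else 0)"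
    using assms by (intro sum.cong refl) (auto simp: B_def Q_left)
  also have "\<dots> = (if b = c then eps n k b else 0)" using assms by simp
  finally show ?thesis .
qed

text \<open>B J B^T = J makes J B^T J a right inverse of B; being also a left inverse, it gives B^T
  J B = J.\<close>

lemma B_orth:
  assumes "x \<in> D" "b < n" "c < n"
  shows "(\<Sum>h<n. eps n k h * (B x h b * B x h c)) = (if b = c then eps n k b else 0)"
proof -
  have "(\<Sum>j<n. B x b j * (eps n k j * B x c j * eps n k c)) = (if b = c then 1 else 0)" if "b < n" "c < n" for b c
  proof -
    have "(\<Sum>j<n. B x b j * (eps n k j * B x c j * eps n k c)) = (\<Sum>j<n. eps n k j * (B x b j * B x c j)) * eps n k c"
      by (simp add: sum_distrib_left sum_distrib_right mult_ac)
    then show ?thesis using B_orth_rows[OF assms(1) that] by simp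
  qed
  from left_inverse_imp_right_inverse[OF ix_bij[where 'n='n, folded n] this assms(2,3)]
  have "(\<Sum>h<n. eps n k b * (eps n k h * (B x h b * B x h c))) = (if b = c then 1 else 0)" by (simp add: mult_ac)
  then have "eps n k b * (eps n k b * (\<Sum>h<n. eps n k h * (B x h b * B x h c))) = eps n k b * (if b = c then 1 else 0)"
    by (simp only: sum_distrib_left)
  then show ?thesis by auto
qed

text \<open>Q turns the coefficients U into B; the sign and eps produce the factor - J on the right
  that \<open>pd_Y\<close> demands.\<close>

definition Y :: "(real,'n) vec \<Rightarrow> nat \<Rightarrow> nat \<Rightarrow> real" where
  "Y x b c = - eps n k c * (\<Sum>l<n. Q c l * f l x $ ix b)"

lemma Y_smooth: "smooth_on D (\<lambda>x. Y x b c)"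
  unfolding Y_def by (intro smooth_on_mult smooth_on_sum smooth_on_const D(1)) (auto intro!: smooth_on_component f_smooth D(1))

lemma pd_Y:
  assumes "x \<in> D" "j < n" "b < n+1" "c < n"
  shows "pd j (\<lambda>y. Y y b c) x = - (A x b j * B x c j * eps n k c)"
proof -
  have fs: "smooth_on D (\<lambda>y. f l y $ ix b)" if "l < n" for l by (rule smooth_on_component[OF D(1) f_smooth[OF that]])
  have "smooth_on D (\<lambda>y. \<Sum>l<n. Q c l * f l y $ ix b)"
    by (intro smooth_on_mult smooth_on_sum smooth_on_const D(1)) (auto intro!: fs)
  then have "pd j (\<lambda>y. Y y b c) x = - eps n k c * pd j (\<lambda>y. \<Sum>l<n. Q c l * f l y $ ix b) x"
    unfolding Y_def by (rule pd_cmult[OF D(1) _ assms(1)])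
  also have "pd j (\<lambda>y. \<Sum>l<n. Q c l * f l y $ ix b) x = (\<Sum>l<n. pd j (\<lambda>y. Q c l * f l y $ ix b) x)"
    by (rule pd_sum[OF D(1) _ assms(1)]) (auto intro!: smooth_on_mult smooth_on_const fs D(1))
  also have "\<dots> = (\<Sum>l<n. Q c l * U l j x * A x b j)"
  proof (rule sum.cong[OF refl])
    fix l assume "l \<in> {..<n}"
    then have l: "l < n" by simp
    show "pd j (\<lambda>y. Q c l * f l y $ ix b) x = Q c l * U l j x * A x b j"
      unfolding pd_cmult[OF D(1) fs[OF l] assms(1)] pd_component[OF D(1) f_smooth[OF l] assms(1)] pd_f[OF l assms(2,1)]
      using assms(2) by (simp add: A_def fr_def)
  qed
  also have "\<dots> = B x c j * A x b j" by (simp add: B_def sum_distrib_right)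
  finally show ?thesis by simp
qed

text \<open>Undoes the definition of Y with the other one-sided inverse property of Q; the vectors
  that appear are c_l = - J u_l(0).\<close>

lemma f_Y:
  assumes "l < n"
  shows "f l x $ ix b = (\<Sum>c<n. Y x b c * (- eps n k c * U l c 0))"
proof -
  have "(\<Sum>c<n. Y x b c * (- eps n k c * U l c 0)) = (\<Sum>c<n. \<Sum>h<n. U l c 0 * Q c h * f h x $ ix b)"
    unfolding Y_def by (intro sum.cong refl) (simp add: sum_distrib_left sum_distrib_right mult_ac)
  also have "\<dots> = (\<Sum>h<n. (\<Sum>c<n. U l c 0 * Q c h) * f h x $ ix b)"
    unfolding sum_distrib_right by (rule sum.swap)
  also have "\<dots> = (\<Sum>h<n. (if l = h then 1 else 0) * f h x $ ix b)"
    using Q_right[OF assms] by (intro sum.cong refl) simp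
  also have "\<dots> = f l x $ ix b" using assms by (rule sum_delta_mult(1))
  finally show ?thesis by simp
qed

text \<open>Multiplication by - J is invertible and preserves the quadratic form, so independence
  and nullity come from the rows of U at 0.\<close>

lemma null_basis_U: "null_basis n k (\<lambda>l c. - eps n k c * U l c 0)"
  unfolding null_basis_def
proof (intro conjI allI impI)
  show "lin_indep n (\<lambda>l c. - eps n k c * U l c 0)"
    unfolding lin_indep_def
  proof (intro allI impI)
    fix t and i :: nat
    assume t: "\<forall>b<n. (\<Sum>i<n. t i * (- eps n k b * U i b 0)) = 0" and i: "i < n"
    have "(\<Sum>i<n. t i * U i b 0) = 0" if "b < n" for b
    proof -
      have "(\<Sum>i<n. t i * (- eps n k b * U i b 0)) = - eps n k b * (\<Sum>i<n. t i * U i b 0)"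
        by (simp add: sum_distrib_left mult_ac)
      with t that show ?thesis by simp
    qed
    with U_indep[OF D(3)] i show "t i = 0" unfolding lin_indep_def by blast
  qed
  show "(\<Sum>b<n. eps n k b * (- eps n k b * U l b 0)^2) = 0" if "l < n" for l
    using U_null[OF that D(3)] by (simp add: power2_eq_square mult_ac)
qed

sublocale moving_frame D k 0 A B F g Y n "2*n+1"
proof
  show "smooth_on D (\<lambda>x. A x b c)" for b c
    unfolding A_def by (rule smooth_on_component[OF D(1) fr_smooth])
  \<comment> \<open>The normalisation f l 0 = 0 enters here: it removes the constant of integration
    between \<open>H 1\<close> and Z.\<close>
  show "Y 0 b c = 0" for b c
    by (simp add: Y_def f_0)
qed (rule n refl D B_smooth Y_smooth A_orth B_orth pd_A pd_B pd_Y; assumption)+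

end

theorem theorem4p3:
  fixes D :: "(real^('n::{finite,linorder})) set"
    and f :: "nat \<Rightarrow> real^('n::{finite,linorder}) \<Rightarrow> real^('m::{finite,linorder})"
    and k :: nat
  assumes "CARD('n) \<ge> 2" and "1 \<le> k" and "k \<le> CARD('n) - 1"
    and "CARD('m) = CARD('n) + 1"
    and "open D" and "simply_connected D" and "0 \<in> D"
    and "combescure_seq D k f"
    and "\<forall>i<CARD('n). f i 0 = 0"
  shows "\<exists>F g E c Y. is_solution D k F g \<and> ext_frame D k F g E \<and> null_basis (CARD('n)) k c \<and>
     (\<forall>x\<in>D. \<forall>a<2*CARD('n)+1. \<forall>b<2*CARD('n)+1.
        (\<Sum>d<2*CARD('n)+1. Mblock (CARD('n)) k (Y x) a d * E x 0 d b) = deriv (\<lambda>l. E x l a b) 0) \<and>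
     (\<forall>l<CARD('n). \<forall>x\<in>D. \<forall>a\<le>CARD('n).
        complex_of_real (f l x $ ix a) = (\<Sum>b<CARD('n). Y x a b * complex_of_real (c l b)))"
proof -
  interpret combescure D k f "CARD('n)"
    using assms by unfold_locales auto
  let ?n = "CARD('n)"
  have "is_solution D k F g"
    by (rule is_solution_frame) (auto intro: F_smooth g_smooth simp: F_diag)
  moreover have "(\<Sum>d<2*?n+1. Mblock ?n k (\<lambda>a b. of_real (Y x a b)) a d * E x 0 d b) = deriv (\<lambda>l. E x l a b) 0"
    if "x \<in> D" "a < 2*?n+1" "b < 2*?n+1" for x a b by (rule deriv_E_0[OF that])
  moreover have "complex_of_real (f l x $ ix a) = (\<Sum>b<?n. of_real (Y x a b) * complex_of_real (- eps ?n k b * U l b 0))"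
    if "l < ?n" for l x a
    unfolding f_Y[OF that] of_real_sum of_real_mult ..
  ultimately show ?thesis
    using ext_frame_E null_basis_U
    by (intro exI[of _ F] exI[of _ g] exI[of _ E] exI[of _ "\<lambda>l c. - eps ?n k c * U l c 0"] exI[of _ "\<lambda>x a b. of_real (Y x a b)"]) blast
qed

end
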